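(* Let $\varphi \colon \partial \mathbb{D} \to\partial \mathbb{D}$ be a homeomorphism onto $\partial\mathbb{D}$. Suppose $\Phi \colon [0, \infty) \to [0, \infty)$ is an $N$-function that satisfies the doubling condition and, for some $p>1$ and $t_0\ge0$, satisfies $(\mathrm{aInc})_p$ on $t\ge t_0$. Then $\varphi$ satisfies the $\Phi$-Douglas condition if and only if $\varphi$ admits a homeomorphic extension $h\colon\overline{\mathbb{D}}\to\overline{\mathbb{D}}$ (that is, a homeomorphism of $\overline{\mathbb{D}}$ onto $\overline{\mathbb{D}}$ with $h|_{\partial\mathbb{D}}=\varphi$) that belongs to $W^{1,\Phi}(\mathbb{D}, \mathbb{C})$.
   Context: $\mathbb{D}\subset\mathbb{C}$ is the open unit disk, $\partial\mathbb{D}$ the unit circle, $\overline{\mathbb{D}}$ the closed unit disk. An $N$-function is a function $\Phi\colon[0,\infty)\to[0,\infty)$ that is continuous, convex, increasing, with $\Phi(0)=0$, $\lim_{t\to0^+}\Phi(t)/t=0$ and $\lim_{t\to\infty}\Phi(t)/t=\infty$. $\Phi$ satisfies the doubling condition if there is a constant $C_D\ge 2$ such that $\Phi(2t)\le C_D\Phi(t)$ for all $t\ge0$. $\Phi$ satisfies $(\mathrm{aInc})_p$ on $t\ge t_0$ if there is a constant $C_A\ge1$ such that $\Phi(s)/s^p\le C_A\,\Phi(t)/t^p$ whenever $t_0\le s\le t$ and $s>0$. A homeomorphism $\varphi\colon\partial\mathbb{D}\to\partial\mathbb{D}$ satisfies the $\Phi$-Douglas condition if $$\int_{\partial \mathbb{D}}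 \int_{\partial \mathbb{D}} \Phi\left( \left| \frac{\varphi(\xi) - \varphi(\eta)}{\xi - \eta} \right| \right) |d\xi|\,|d\eta| < \infty,$$ where $|d\xi|,|d\eta|$ denote arc length. The Orlicz--Sobolev space is $$W^{1,\Phi}(\mathbb{D},\mathbb{C})=\left\{f\in W^{1,1}(\mathbb{D},\mathbb{C}):\int_{\mathbb{D}}\Phi(|Df(x)|)\,dx<\infty\right\}.$$ Membership of $h$ refers to its restriction to $\mathbb{D}$. *)

theory Defs
  imports "HOL-Analysis.Analysis"
begin

definition N_function :: "(real \<Rightarrow> real) \<Rightarrow> bool" where
  "N_function \<Phi> \<longleftrightarrow>
     (\<forall>t\<ge>0. 0 \<le> \<Phi> t) \<and>
     continuous_on {0..} \<Phi> \<and> convex_on {0..} \<Phi> \<and> mono_on {0..} \<Phi> \<and> \<Phi> 0 = 0 \<and>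
     ((\<lambda>t. \<Phi> t / t) \<longlongrightarrow> 0) (at_right 0) \<and>
     filterlim (\<lambda>t. \<Phi> t / t) at_top at_top"

definition doubling :: "(real \<Rightarrow> real) \<Rightarrow> bool" where
  "doubling \<Phi> \<longleftrightarrow> (\<exists>C\<ge>2. \<forall>t\<ge>0. \<Phi> (2 * t) \<le> C * \<Phi> t)"

definition aInc :: "real \<Rightarrow> real \<Rightarrow> (real \<Rightarrow> real) \<Rightarrow> bool" where
  "aInc p t0 \<Phi> \<longleftrightarrow>
     (\<exists>C\<ge>1. \<forall>s t. t0 \<le> s \<and> s \<le> t \<and> 0 < s \<longrightarrow>
        \<Phi> s / s powr p \<le> C * (\<Phi> t / t powr p))"

definition arc_length :: "complex measure" where
  "arc_length =
     distr (restrict_space lborel {0..<2 * pi}) (restrict_space borel (sphere 0 1)) cis"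

text \<open>On the diagonal the quotient is \<open>0 / 0 = 0\<close>; the diagonal is a null set.\<close>

definition Douglas_condition :: "(real \<Rightarrow> real) \<Rightarrow> (complex \<Rightarrow> complex) \<Rightarrow> bool" where
  "Douglas_condition \<Phi> \<phi> \<longleftrightarrow>
     (\<integral>\<^sup>+ \<eta>. (\<integral>\<^sup>+ \<xi>. ennreal (\<Phi> (cmod ((\<phi> \<xi> - \<phi> \<eta>) / (\<xi> - \<eta>)))) \<partial>arc_length) \<partial>arc_length) < \<infinity>"

primrec C_k :: "nat \<Rightarrow> ('a::euclidean_space \<Rightarrow> real) \<Rightarrow> bool" where
  "C_k 0 \<psi> \<longleftrightarrow> continuous_on UNIV \<psi>"
| "C_k (Suc k) \<psi> \<longleftrightarrow>
     (\<forall>x. \<psi> differentiable (at x)) \<and> (\<forall>v. C_k k (\<lambda>x. frechet_derivative \<psi> (at x) v))"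

definition test_function :: "'a::euclidean_space set \<Rightarrow> ('a \<Rightarrow> real) \<Rightarrow> bool" where
  "test_function U \<psi> \<longleftrightarrow>
     (\<forall>k. C_k k \<psi>) \<and> compact (closure {x. \<psi> x \<noteq> 0}) \<and> closure {x. \<psi> x \<noteq> 0} \<subseteq> U"

text \<open>Local integrability is part of the notion, since the Bochner integral of a
  non-integrable function is \<open>0\<close> by convention.  Integrability of \<open>Df\<close> is stated direction
  by direction, i.e. for each partial derivative.\<close>

definition has_weak_derivative ::
  "('a::euclidean_space \<Rightarrow> 'b::euclidean_space) \<Rightarrow> ('a \<Rightarrow> 'a \<Rightarrow>\<^sub>L 'b) \<Rightarrow> 'a set \<Rightarrow> bool" where
  "has_weak_derivative f Df U \<longleftrightarrow>
     (\<forall>K. compact K \<and> K \<subseteq> U \<longrightarrow> set_integrable lebesgue K f \<and>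
        (\<forall>v. set_integrable lebesgue K (\<lambda>x. blinfun_apply (Df x) v))) \<and>
     (\<forall>\<psi> v. test_function U \<psi> \<longrightarrow>
        (LINT x:U|lebesgue. frechet_derivative \<psi> (at x) v *\<^sub>R f x) =
        - (LINT x:U|lebesgue. \<psi> x *\<^sub>R blinfun_apply (Df x) v))"

definition Sobolev_1_1 :: "'a::euclidean_space set \<Rightarrow> ('a \<Rightarrow> 'b::euclidean_space) set" where
  "Sobolev_1_1 U =
     {f. set_integrable lebesgue U f \<and>
         (\<exists>Df. has_weak_derivative f Df U \<and>
            (\<forall>v. set_integrable lebesgue U (\<lambda>x. blinfun_apply (Df x) v)))}"

text \<open>Members are total functions of which only the values on \<open>U\<close> matter.  The weak
  derivative is unique up to null sets, so its choice is irrelevant.  The norm on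
  \<open>'a \<Rightarrow>\<^sub>L 'b\<close> is the operator norm; for doubling \<open>\<Phi>\<close> any other matrix norm
  gives the same space.\<close>

definition Orlicz_Sobolev ::
  "(real \<Rightarrow> real) \<Rightarrow> 'a::euclidean_space set \<Rightarrow> ('a \<Rightarrow> 'b::euclidean_space) set" where
  "Orlicz_Sobolev \<Phi> U =
     {f \<in> Sobolev_1_1 U.
        \<exists>Df. has_weak_derivative f Df U \<and>
             (\<integral>\<^sup>+x\<in>U. ennreal (\<Phi> (norm (Df x))) \<partial>lebesgue) < \<infinity>}"

end

theory Submission
  imports Defs "HOL-Probability.Probability"
begin

text \<open>
  Extension.  Lift \<open>\<phi>\<close> to an increasing homeomorphism \<open>\<theta>\<close> of the line with \<open>\<theta> (x + 2\<pi>) = \<theta> x + 2\<pi>\<close>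
  and write \<open>z = exp (\<i> (x + \<i> y))\<close>.  The two Beurling--Ahlfors means of \<open>\<theta>\<close> over \<open>[x, x + y]\<close> and
  \<open>[x - y, x]\<close> are monotone in \<open>x\<close> and in \<open>y\<close>, which makes the extension built from them injective, and
  its gradient at \<open>z\<close> is at most a constant times \<open>(\<theta> (x + y) - \<theta> (x - y)) / y\<close>.  In polar
  coordinates the \<open>\<Phi>\<close>-modular of this bound is controlled by the Douglas integral.

  Trace.  Join boundary points \<open>cis b\<close> and \<open>cis (b + 2\<tau>)\<close> to a common interior point by the paths
  \<open>(1 - \<tau> u\<^sup>2) cis (b + \<tau> u\<^sup>2)\<close> and \<open>(1 - \<tau> u\<^sup>2) cis (b + 2\<tau> - \<tau> u\<^sup>2)\<close>, \<open>0 \<le> u \<le> 1\<close>, of speed at most \<open>4 \<tau> u\<close>.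
  Jensen's inequality bounds \<open>\<Phi>\<close> of the difference quotient by integrals of \<open>\<Phi> (8 u |Dh|)\<close>, hence of
  \<open>u\<^sup>p \<Phi> (|Dh|)\<close>, along the paths.  Integrating over \<open>b\<close> and substituting \<open>t = \<tau> u\<^sup>2\<close> leaves the factor
  \<open>\<integral> u\<^bsup>p - 2\<^esup> du = 1 / (p - 1)\<close>.  The estimate is applied to mollifications of \<open>h\<close> and passes to the
  limit by Fatou's lemma.
\<close>

section \<open>Integration on the circle and the disc\<close>

text \<open>Why the paths slow down: at constant speed the substitution t = \<tau> u would leave the
  weight 1 / u, and the estimate would diverge logarithmically. With u^2 the speed puts a factor u
  inside \<Phi>, \<open>aInc\<close> turns it into u^p, and this beats the Jacobian u^(-2) because p
  > 1.

  Why mollify: a weak gradient says nothing along a single path, while the argument needs an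
  inequality along each one. A bump travelling along a path is an admissible test function at every
  moment, provided that the path is first shrunk a little towards the origin. The constant of the
  trace estimate must therefore be the same for all mollified functions.

  Why logarithmic coordinates: \<theta> commutes with the period, so a half-plane construction
  descends to the punctured disc, with the origin at y = infinity. There the extension decays
  linearly in |z|, which cancels the factor 1 / |z| produced by differentiating the logarithm. Only
  a primitive of \<theta> is ever differentiated, so a merely continuous \<phi> still gives a
  gradient in the classical sense away from the branch cut.\<close>

lemma lborel_complex: "distr lborel borel (\<lambda>(x, y). Complex x y) = (lborel :: complex measure)"
proof (rule lborel_eqI[symmetric])
  fix l u :: complex assume le: "\<And>b. b \<in> Basis \<Longrightarrow> l \<bullet> b \<le> u \<bullet> b"
  have le': "Re l \<le> Re u" "Im l \<le> Im u"
    using le[of 1] le[of \<i>] by (auto simp: Basis_complex_def)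
  have meas: "(\<lambda>(x, y). Complex x y) \<in> borel \<rightarrow>\<^sub>M borel"
    unfolding case_prod_beta by (intro borel_measurable_continuous_onI continuous_intros)
  have "(\<lambda>(x, y). Complex x y) -` box l u = box (Re l, Im l) (Re u, Im u)"
    by (auto simp: box_def Basis_complex_def Basis_prod_def)
  then have "emeasure (distr lborel borel (\<lambda>(x, y). Complex x y)) (box l u)
     = emeasure lborel (box (Re l, Im l) (Re u, Im u))"
    using meas by (subst emeasure_distr) auto
  also have "\<dots> = (\<Prod>b\<in>Basis. ((Re u, Im u) - (Re l, Im l)) \<bullet> b)"
    using le' by (subst emeasure_lborel_box) (auto simp: Basis_prod_def)
  also have "\<dots> = (Re u - Re l) * (Im u - Im l)"
    by (simp add: Basis_prod_def mult.commute)
  also have "\<dots> = (\<Prod>b\<in>Basis. (u - l) \<bullet> b)"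
    by (simp add: Basis_complex_def)
  finally show "emeasure (distr lborel borel (\<lambda>(x, y). Complex x y)) (box l u) = (\<Prod>b\<in>Basis. (u - l) \<bullet> b)" .
qed simp

lemma measurable_Complex [measurable]:
  assumes [measurable]: "f \<in> borel_measurable M" "g \<in> borel_measurable M"
  shows "(\<lambda>x. Complex (f x) (g x)) \<in> borel_measurable M"
  unfolding Complex_eq by measurable

lemma measurable_cis [measurable]:
  assumes [measurable]: "f \<in> borel_measurable M"
  shows "(\<lambda>x. cis (f x)) \<in> borel_measurable M"
  unfolding cis_conv_exp by measurable

lemma pred_mem_borel:
  assumes "f \<in> borel_measurable M" "A \<in> sets borel"
  shows "Measurable.pred M (\<lambda>x. f x \<in> A)"
  using assms by measurable

lemma measurable_pred_ball [measurable]: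
  "f \<in> borel_measurable M \<Longrightarrow> Measurable.pred M (\<lambda>x. f x \<in> ball (c::'a::euclidean_space) r)"
  by (rule pred_mem_borel) auto

lemma measurable_pred_atLeastLessThan [measurable]:
  "f \<in> borel_measurable M \<Longrightarrow> Measurable.pred M (\<lambda>x. f x \<in> {a..<b::real})"
  by (rule pred_mem_borel) auto

lemma nn_integral_complex:
  fixes F :: "complex \<Rightarrow> ennreal"
  assumes [measurable]: "F \<in> borel_measurable borel"
  shows nn_integral_complex_xy: "(\<integral>\<^sup>+z. F z \<partial>lborel) = (\<integral>\<^sup>+x. \<integral>\<^sup>+y. F (Complex x y) \<partial>lborel \<partial>lborel)"
    and nn_integral_complex_yx: "(\<integral>\<^sup>+z. F z \<partial>lborel) = (\<integral>\<^sup>+y. \<integral>\<^sup>+x. F (Complex x y) \<partial>lborel \<partial>lborel)"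
proof -
  have "(\<integral>\<^sup>+z. F z \<partial>lborel) = (\<integral>\<^sup>+z. F z \<partial>distr (lborel \<Otimes>\<^sub>M lborel) borel (\<lambda>(x, y). Complex x y))"
    by (simp add: lborel_prod lborel_complex)
  also have "\<dots> = (\<integral>\<^sup>+w. F (case w of (x, y) \<Rightarrow> Complex x y) \<partial>(lborel \<Otimes>\<^sub>M lborel))"
    by (rule nn_integral_distr) (auto simp: case_prod_beta)
  finally have *: "(\<integral>\<^sup>+z. F z \<partial>lborel) = (\<integral>\<^sup>+w. F (case w of (x, y) \<Rightarrow> Complex x y) \<partial>(lborel \<Otimes>\<^sub>M lborel))" .
  show "(\<integral>\<^sup>+z. F z \<partial>lborel) = (\<integral>\<^sup>+x. \<integral>\<^sup>+y. F (Complex x y) \<partial>lborel \<partial>lborel)"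
    unfolding * by (subst lborel.nn_integral_fst[symmetric]) (auto simp: case_prod_beta)
  show "(\<integral>\<^sup>+z. F z \<partial>lborel) = (\<integral>\<^sup>+y. \<integral>\<^sup>+x. F (Complex x y) \<partial>lborel \<partial>lborel)"
    unfolding * by (subst lborel_pair.nn_integral_snd[symmetric]) (auto simp: case_prod_beta)
qed

lemma set_nn_integral_swap:
  fixes f :: "'a::euclidean_space \<Rightarrow> 'b::euclidean_space \<Rightarrow> ennreal"
  assumes [measurable]: "(\<lambda>(x, y). f x y) \<in> borel_measurable (borel \<Otimes>\<^sub>M borel)" "A \<in> sets borel" "B \<in> sets borel"
  shows "(\<integral>\<^sup>+x\<in>A. (\<integral>\<^sup>+y\<in>B. f x y \<partial>lborel) \<partial>lborel) = (\<integral>\<^sup>+y\<in>B. (\<integral>\<^sup>+x\<in>A. f x y \<partial>lborel) \<partial>lborel)"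
proof -
  have "(\<integral>\<^sup>+x\<in>A. (\<integral>\<^sup>+y\<in>B. f x y \<partial>lborel) \<partial>lborel) = (\<integral>\<^sup>+x. (\<integral>\<^sup>+y. f x y * indicator B y * indicator A x \<partial>lborel) \<partial>lborel)"
    by (simp add: nn_integral_multc)
  also have "\<dots> = (\<integral>\<^sup>+y. (\<integral>\<^sup>+x. f x y * indicator B y * indicator A x \<partial>lborel) \<partial>lborel)"
    by (rule lborel_pair.Fubini') measurable
  also have "\<dots> = (\<integral>\<^sup>+y. (\<integral>\<^sup>+x. f x y * indicator A x * indicator B y \<partial>lborel) \<partial>lborel)"
    by (simp only: ac_simps)
  also have "\<dots> = (\<integral>\<^sup>+y\<in>B. (\<integral>\<^sup>+x\<in>A. f x y \<partial>lborel) \<partial>lborel)"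
    by (simp add: nn_integral_multc)
  finally show ?thesis .
qed

lemma nn_integral_translate:
  fixes f :: "real \<Rightarrow> ennreal"
  assumes "f \<in> borel_measurable borel"
  shows "(\<integral>\<^sup>+x. f (x + c) \<partial>lborel) = (\<integral>\<^sup>+x. f x \<partial>lborel)"
  using nn_integral_real_affine[OF assms, of 1 c] by (simp add: add.commute)

text \<open>For fixed second coordinate a shear is a translation of the first, so Tonelli reduces
  the claim to translation invariance on the line.\<close>

lemma nn_integral_shear:
  fixes F :: "complex \<Rightarrow> ennreal"
  assumes [measurable]: "F \<in> borel_measurable borel"
  shows nn_integral_shear_x: "(\<integral>\<^sup>+z. F (Complex (Re z + t * Im z) (Im z)) \<partial>lborel) = (\<integral>\<^sup>+z. F z \<partial>lborel)"
    and nn_integral_shear_y: "(\<integral>\<^sup>+z. F (Complex (Re z) (Im z + t * Re z)) \<partial>lborel) = (\<integral>\<^sup>+z. F z \<partial>lborel)"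
proof -
  show "(\<integral>\<^sup>+z. F (Complex (Re z + t * Im z) (Im z)) \<partial>lborel) = (\<integral>\<^sup>+z. F z \<partial>lborel)"
    by (simp add: nn_integral_complex_yx nn_integral_translate[where f="\<lambda>x. F (Complex x _)"])
  show "(\<integral>\<^sup>+z. F (Complex (Re z) (Im z + t * Re z)) \<partial>lborel) = (\<integral>\<^sup>+z. F z \<partial>lborel)"
    by (simp add: nn_integral_complex_xy nn_integral_translate[where f="\<lambda>y. F (Complex _ y)"])
qed

text \<open>A rotation by an angle \<open>a\<close> with \<open>cos (a / 2) \<noteq> 0\<close> is a product of three shears.\<close>

lemma nn_integral_rotate_aux:
  fixes F :: "complex \<Rightarrow> ennreal"
  assumes [measurable]: "F \<in> borel_measurable borel" and a: "cos (a / 2) \<noteq> 0"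
  shows "(\<integral>\<^sup>+z. F (cis a * z) \<partial>lborel) = (\<integral>\<^sup>+z. F z \<partial>lborel)"
proof -
  define t where "t = tan (a / 2)"
  have s: "sin a = 2 * sin (a/2) * cos (a/2)" using sin_double[of "a/2"] by simp
  have c: "cos a = 2 * (cos (a/2))^2 - 1" using cos_double_cos[of "a/2"] by simp
  have sc: "sin (a/2)^2 = 1 - cos (a/2)^2" using sin_cos_squared_add[of "a/2"] by linarith
  \<comment> \<open>The two half-angle identities \<open>ts\<close> and \<open>tc\<close> are
    exactly what makes the entries of the product of the three shear matrices equal to \<plusminus>
    sin a and cos a.\<close>
  have ts: "t * sin a = 1 - cos a"
    using a sc by (simp add: t_def tan_def s c power2_eq_square)
  have tc: "t * (1 + cos a) = sin a"
    using a by (simp add: t_def tan_def s c power2_eq_square)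
  define S where "S = (\<lambda>z. Complex (Re z + (- t) * Im z) (Im z))"
  define R where "R = (\<lambda>z. Complex (Re z) (Im z + sin a * Re z))"
  have ts': "x * (t * sin a) = x - x * cos a" for x unfolding ts by (simp add: algebra_simps)
  have tc': "x * (t * cos a) = x * sin a - t * x" for x
    using arg_cong[OF tc, of "\<lambda>u. x * u"] by (simp add: algebra_simps)
  have eq: "cis a * z = S (R (S z))" for z
  proof (rule complex_eqI)
    have "Re z - t * Im z - t * (Im z + sin a * (Re z - t * Im z)) =
       Re z - t * Im z - t * Im z - Re z * (t * sin a) + t * Im z * (t * sin a)" by algebra
    also have "\<dots> = Re z * cos a - Im z * (t * (1 + cos a))" unfolding ts by algebra
    finally show "Re (cis a * z) = Re (S (R (S z)))" unfolding tc by (simp add: S_def R_def algebra_simps)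
    have "Im z + sin a * (Re z - t * Im z) = Im z * (1 - t * sin a) + sin a * Re z" by algebra
    then show "Im (cis a * z) = Im (S (R (S z)))" unfolding ts by (simp add: S_def R_def algebra_simps)
  qed
  have [measurable]: "S \<in> borel \<rightarrow>\<^sub>M borel" "R \<in> borel \<rightarrow>\<^sub>M borel" by (auto simp: S_def R_def)
  have "(\<integral>\<^sup>+z. F (cis a * z) \<partial>lborel) = (\<integral>\<^sup>+z. F (S (R (S z))) \<partial>lborel)" by (simp add: eq)
  also have "\<dots> = (\<integral>\<^sup>+z. F (S (R z)) \<partial>lborel)"
    unfolding S_def by (rule nn_integral_shear_x[where F="\<lambda>z. F (Complex (Re (R z) + - t * Im (R z)) (Im (R z)))"]) measurable
  also have "\<dots> = (\<integral>\<^sup>+z. F (S z) \<partial>lborel)"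
    unfolding R_def by (rule nn_integral_shear_y[where F="\<lambda>z. F (S z)"]) measurable
  also have "\<dots> = (\<integral>\<^sup>+z. F z \<partial>lborel)"
    unfolding S_def by (rule nn_integral_shear_x) measurable
  finally show ?thesis .
qed

text \<open>The shear decomposition breaks down at a = pi, where cos (a / 2) = 0. Rotating twice by
  a / 2 only requires cos (a / 4) \<noteq> 0, which holds on the whole range.\<close>

lemma nn_integral_rotate:
  fixes F :: "complex \<Rightarrow> ennreal"
  assumes [measurable]: "F \<in> borel_measurable borel" and a: "0 \<le> a" "a < 2 * pi"
  shows "(\<integral>\<^sup>+z. F (cis a * z) \<partial>lborel) = (\<integral>\<^sup>+z. F z \<partial>lborel)"
proof -
  have c: "cos (a / 2 / 2) \<noteq> 0"
    using cos_gt_zero_pi[of "a / 2 / 2"] a by simp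
  have "(\<integral>\<^sup>+z. F (cis a * z) \<partial>lborel) = (\<integral>\<^sup>+z. F (cis (a/2) * (cis (a/2) * z)) \<partial>lborel)"
    by (simp add: mult.assoc[symmetric] cis_mult)
  also have "\<dots> = (\<integral>\<^sup>+z. F (cis (a/2) * z) \<partial>lborel)"
    by (rule nn_integral_rotate_aux[OF _ c, where F="\<lambda>z. F (cis (a/2) * z)"]) measurable
  also have "\<dots> = (\<integral>\<^sup>+z. F z \<partial>lborel)"
    by (rule nn_integral_rotate_aux[OF _ c]) measurable
  finally show ?thesis .
qed

section \<open>Integrals of periodic functions over a period\<close>

lemma nn_integral_periodic_shift:
  fixes f :: "real \<Rightarrow> ennreal"
  assumes [measurable]: "f \<in> borel_measurable borel" and per: "\<And>x. f (x + 2 * pi) = f x"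
  shows "(\<integral>\<^sup>+x\<in>{c..<c + 2 * pi}. f x \<partial>lborel) = (\<integral>\<^sup>+x\<in>{0..<2 * pi}. f x \<partial>lborel)"
proof -
  define I where "I = (\<lambda>a. \<integral>\<^sup>+x\<in>{a..<a + 2 * pi}. f x \<partial>lborel)"
  have step: "I (a + 2 * pi) = I a" for a
  proof -
    have "I (a + 2 * pi) = (\<integral>\<^sup>+x. f (x + 2 * pi) * indicator {a + 2 * pi..<a + 2 * pi + 2 * pi} (x + 2 * pi) \<partial>lborel)"
      unfolding I_def
      by (subst nn_integral_translate[where c="2 * pi", symmetric]) auto
    also have "\<dots> = I a"
      unfolding I_def by (intro nn_integral_cong) (auto simp: per split: split_indicator)
    finally show ?thesis .
  qed
  have nat_step: "I (a + 2 * pi * real n) = I a" for a n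
  proof (induction n)
    case (Suc n)
    have "I (a + 2 * pi * real (Suc n)) = I ((a + 2 * pi * real n) + 2 * pi)" by (simp add: algebra_simps)
    with Suc step show ?case by simp
  qed simp
  have int_step: "I (a + 2 * pi * of_int k) = I a" for a k
  proof (cases "k \<ge> 0")
    case True then show ?thesis using nat_step[of a "nat k"] by simp
  next
    case False then show ?thesis using nat_step[of "a + 2 * pi * of_int k" "nat (-k)"] by simp
  qed
  \<comment> \<open>The part of the window that sticks out beyond 2 pi is moved back by one period
    and fills the gap [0, a).\<close>
  have base: "I a = I 0" if a: "0 \<le> a" "a < 2 * pi" for a
  proof -
    have "I a = (\<integral>\<^sup>+x. f x * indicator {a..<2 * pi} x + f x * indicator {2 * pi..<a + 2 * pi} x \<partial>lborel)"
      unfolding I_def using a by (intro nn_integral_cong) (auto split: split_indicator)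
    also have "\<dots> = (\<integral>\<^sup>+x. f x * indicator {a..<2 * pi} x \<partial>lborel) + (\<integral>\<^sup>+x. f x * indicator {2 * pi..<a + 2 * pi} x \<partial>lborel)"
      by (rule nn_integral_add) auto
    also have "(\<integral>\<^sup>+x. f x * indicator {2 * pi..<a + 2 * pi} x \<partial>lborel) = (\<integral>\<^sup>+x. f (x + 2 * pi) * indicator {2 * pi..<a + 2 * pi} (x + 2 * pi) \<partial>lborel)"
      by (subst nn_integral_translate[where c="2 * pi", symmetric]) auto
    also have "\<dots> = (\<integral>\<^sup>+x. f x * indicator {0..<a} x \<partial>lborel)"
      by (intro nn_integral_cong) (auto simp: per split: split_indicator)
    also have "(\<integral>\<^sup>+x. f x * indicator {a..<2 * pi} x \<partial>lborel) + (\<integral>\<^sup>+x. f x * indicator {0..<a} x \<partial>lborel)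
      = (\<integral>\<^sup>+x. f x * indicator {a..<2 * pi} x + f x * indicator {0..<a} x \<partial>lborel)"
      by (rule nn_integral_add[symmetric]) auto
    also have "\<dots> = I 0"
      unfolding I_def using a by (intro nn_integral_cong) (auto split: split_indicator)
    finally show ?thesis .
  qed
  define k where "k = \<lfloor>c / (2 * pi)\<rfloor>"
  have k: "of_int k \<le> c / (2 * pi)" "c / (2 * pi) < of_int k + 1"
    unfolding k_def by linarith+
  have "0 \<le> c - 2 * pi * of_int k" "c - 2 * pi * of_int k < 2 * pi"
    using k by (simp_all add: field_simps)
  then have "I (c - 2 * pi * of_int k) = I 0" by (rule base)
  with int_step[of "c - 2 * pi * of_int k" k] show ?thesis by (simp add: I_def)
qed

lemma nn_integral_periodic_translate:
  fixes f :: "real \<Rightarrow> ennreal"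
  assumes [measurable]: "f \<in> borel_measurable borel" and per: "\<And>x. f (x + 2 * pi) = f x"
  shows "(\<integral>\<^sup>+x\<in>{0..<2 * pi}. f (x + c) \<partial>lborel) = (\<integral>\<^sup>+x\<in>{0..<2 * pi}. f x \<partial>lborel)"
proof -
  have "(\<integral>\<^sup>+x\<in>{0..<2 * pi}. f (x + c) \<partial>lborel) = (\<integral>\<^sup>+x. f (x + c) * indicator {c..<c + 2 * pi} (x + c) \<partial>lborel)"
    by (intro nn_integral_cong) (auto split: split_indicator)
  also have "\<dots> = (\<integral>\<^sup>+x\<in>{c..<c + 2 * pi}. f x \<partial>lborel)"
    by (rule nn_integral_translate[where f="\<lambda>x. f x * indicator {c..<c + 2 * pi} x"]) measurable
  also note nn_integral_periodic_shift[OF assms]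
  finally show ?thesis .
qed

section \<open>Polar coordinates\<close>

lemma emeasure_disc: "0 \<le> r \<Longrightarrow> emeasure lborel (cball (0::complex) r) = ennreal (pi * r\<^sup>2)"
  by (simp add: emeasure_cball unit_ball_vol_2)

text \<open>Measures on the line that are finite on right half-lines are determined by these values.
  Both tails are areas of annuli, pi - pi a^2, where one side uses the area of a disc and the other
  the primitive pi r^2.\<close>

lemma distr_cmod_disc:
  "distr (density lborel (indicator (ball (0::complex) 1))) borel cmod =
   density lborel (\<lambda>r. ennreal (2 * pi * r) * indicator {0<..<1} r)" (is "?M = ?N")
proof (rule measure_eqI_lessThan)
  show "sets ?M = sets borel" "sets ?N = sets borel" by simp_all
  have [measurable]: "cmod -` {x<..} \<in> sets borel" for x
    by (intro borel_open open_vimage continuous_intros)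
  have M: "emeasure ?M {x<..} = emeasure lborel (ball (0::complex) 1 - cball 0 x)" for x
  proof -
    have "emeasure ?M {x<..} = (\<integral>\<^sup>+z. indicator (ball 0 1) z * indicator (cmod -` {x<..}) z \<partial>lborel)"
      by (subst emeasure_distr, simp, simp, subst emeasure_density)
         (auto intro!: borel_measurable_indicator)
    also have "\<dots> = (\<integral>\<^sup>+z. indicator (ball 0 1 - cball 0 x) (z::complex) \<partial>lborel)"
      by (intro nn_integral_cong) (auto split: split_indicator)
    finally show ?thesis by simp
  qed
  have ball1: "emeasure lborel (ball (0::complex) 1) = ennreal pi"
    by (simp add: emeasure_ball unit_ball_vol_2)
  show "emeasure ?M {x<..} < \<infinity>" for x
  proof -
    have "emeasure ?M {x<..} \<le> emeasure lborel (ball (0::complex) 1)"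
      unfolding M by (rule emeasure_mono) auto
    also have "\<dots> < \<infinity>" by (simp add: ball1)
    finally show ?thesis .
  qed
  show "emeasure ?M {x<..} = emeasure ?N {x<..}" for x
  proof -
    \<comment> \<open>Clamping x to [0, 1] gives one formula for the tail, valid also below 0 and
      above 1.\<close>
    define a where "a = max 0 (min 1 x)"
    have a: "0 \<le> a" "a \<le> 1" by (auto simp: a_def)
    have "emeasure ?N {x<..} = (\<integral>\<^sup>+r. ennreal (2 * pi * r) * indicator {0<..<1} r * indicator {x<..} r \<partial>lborel)"
      by (subst emeasure_density) auto
    also have "\<dots> = (\<integral>\<^sup>+r. ennreal (2 * pi * r) * indicator {a..1} r \<partial>lborel)"
    proof (rule nn_integral_cong_AE)
      have "AE r in lborel. r \<noteq> a \<and> r \<noteq> (1::real)"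
        by (intro AE_conjI AE_lborel_singleton)
      then show "AE r in lborel. ennreal (2 * pi * r) * indicator {0<..<1} r * indicator {x<..} r = ennreal (2 * pi * r) * indicator {a..1} r"
        by eventually_elim (auto simp: a_def split: split_indicator)
    qed
    also have "\<dots> = ennreal (pi * 1\<^sup>2 - pi * a\<^sup>2)"
      using a by (intro nn_integral_FTC_Icc) (auto intro!: derivative_eq_intros)
    finally have N: "emeasure ?N {x<..} = ennreal (pi - pi * a\<^sup>2)" by simp
    consider "x < 0" | "0 \<le> x" "x < 1" | "1 \<le> x" by linarith
    then show ?thesis
    proof cases
      case 1 then show ?thesis unfolding M N by (simp add: a_def ball1)
    next
      case 2
      have "emeasure lborel (ball (0::complex) 1 - cball 0 x) = emeasure lborel (ball (0::complex) 1) - emeasure lborel (cball (0::complex) x)"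
        using 2 by (intro emeasure_Diff) (auto simp: emeasure_disc)
      also have "\<dots> = ennreal (pi - pi * x\<^sup>2)"
        using 2 by (simp add: ball1 emeasure_disc ennreal_minus)
      finally show ?thesis unfolding M N using 2 by (simp add: a_def)
    next
      case 3
      then have e: "ball (0::complex) 1 - cball 0 x = {}" by auto
      show ?thesis unfolding M N e using 3 by (simp add: a_def)
    qed
  qed
qed

text \<open>No change of variables in the plane is involved. By rotation invariance F may be
  replaced by its average over all rotations; the average depends on |z| only, and
  \<open>distr_cmod_disc\<close> gives the distribution of |z|. The total angle 2 pi of the
  averaging cancels against the density 2 pi r.\<close>

lemma nn_integral_polar:
  fixes F :: "complex \<Rightarrow> ennreal"
  assumes [measurable]: "F \<in> borel_measurable borel"
  shows "(\<integral>\<^sup>+z\<in>ball 0 1. F z \<partial>lborel) =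
    (\<integral>\<^sup>+r\<in>{0<..<1}. ennreal r * (\<integral>\<^sup>+x\<in>{0..<2 * pi}. F (of_real r * cis x) \<partial>lborel) \<partial>lborel)"
proof -
  define m where "m = (\<lambda>r. \<integral>\<^sup>+x\<in>{0..<2 * pi}. F (of_real r * cis x) \<partial>lborel)"
  have [measurable]: "m \<in> borel_measurable borel" unfolding m_def by measurable
  have inner: "(\<integral>\<^sup>+a\<in>{0..<2 * pi}. F (cis a * z) \<partial>lborel) = m (cmod z)" for z
  proof -
    have z: "z = of_real (cmod z) * cis (Arg z)" by (metis rcis_cmod_Arg rcis_def)
    have "cis a * z = of_real (cmod z) * cis (a + Arg z)" for a
      using arg_cong[OF z, of "\<lambda>w. cis a * w"] by (metis cis_mult mult.left_commute)
    then have "(\<integral>\<^sup>+a\<in>{0..<2 * pi}. F (cis a * z) \<partial>lborel) = (\<integral>\<^sup>+a\<in>{0..<2 * pi}. F (of_real (cmod z) * cis (a + Arg z)) \<partial>lborel)"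
      by simp
    also have "\<dots> = m (cmod z)" unfolding m_def
      by (rule nn_integral_periodic_translate[where f="\<lambda>a. F (of_real (cmod z) * cis a)"])
         (measurable, simp add: cis_mult[symmetric])
    finally show ?thesis .
  qed
  have "ennreal (2 * pi) * (\<integral>\<^sup>+z\<in>ball 0 1. F z \<partial>lborel)
     = (\<integral>\<^sup>+a. (\<integral>\<^sup>+z\<in>ball 0 1. F z \<partial>lborel) * indicator {0..<2 * pi} a \<partial>lborel)"
    by (subst nn_integral_cmult_indicator) (auto simp: mult.commute)
  also have "\<dots> = (\<integral>\<^sup>+a. (\<integral>\<^sup>+z\<in>ball 0 1. F (cis a * z) \<partial>lborel) * indicator {0..<2 * pi} a \<partial>lborel)"
  proof (intro nn_integral_cong)
    fix a :: real
    have mb: "(\<lambda>z. F z * indicator (ball 0 1) z) \<in> borel_measurable borel"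
      by (intro borel_measurable_times_ennreal borel_measurable_indicator assms) auto
    have "(\<integral>\<^sup>+z\<in>ball 0 1. F z \<partial>lborel) = (\<integral>\<^sup>+z. F (cis a * z) * indicator (ball 0 1) (cis a * z) \<partial>lborel)" if "a \<in> {0..<2*pi}"
      using that mb by (intro nn_integral_rotate[symmetric]) auto
    also have "\<dots> = (\<integral>\<^sup>+z\<in>ball 0 1. F (cis a * z) \<partial>lborel)"
      by (intro nn_integral_cong) (auto simp: norm_mult split: split_indicator)
    finally show "(\<integral>\<^sup>+z\<in>ball 0 1. F z \<partial>lborel) * indicator {0..<2 * pi} a = (\<integral>\<^sup>+z\<in>ball 0 1. F (cis a * z) \<partial>lborel) * indicator {0..<2 * pi} a"
      by (auto split: split_indicator)
  qed
  also have "\<dots> = (\<integral>\<^sup>+z\<in>ball 0 1. (\<integral>\<^sup>+a\<in>{0..<2 * pi}. F (cis a * z) \<partial>lborel) \<partial>lborel)"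
  proof -
    have "(\<lambda>(a, z). F (cis a * z)) \<in> borel_measurable (borel \<Otimes>\<^sub>M borel)" by measurable
    then show ?thesis by (rule set_nn_integral_swap) (rule atLeastLessThan_borel borel_open open_ball)+
  qed
  also have "\<dots> = (\<integral>\<^sup>+z. m (cmod z) * indicator (ball 0 1) z \<partial>lborel)"
    by (simp only: inner)
  also have "\<dots> = (\<integral>\<^sup>+z. m (cmod z) \<partial>density lborel (indicator (ball (0::complex) 1)))"
    by (subst nn_integral_density) (auto simp: mult.commute)
  also have "\<dots> = (\<integral>\<^sup>+r. m r \<partial>distr (density lborel (indicator (ball (0::complex) 1))) borel cmod)"
    by (subst nn_integral_distr) auto
  also have "\<dots> = (\<integral>\<^sup>+r. ennreal (2 * pi * r) * indicator {0<..<1} r * m r \<partial>lborel)"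
    unfolding distr_cmod_disc by (subst nn_integral_density) auto
  also have "\<dots> = (\<integral>\<^sup>+r. ennreal (2 * pi) * (ennreal r * m r * indicator {0<..<1} r) \<partial>lborel)"
    by (intro nn_integral_cong) (auto simp: ennreal_mult ac_simps split: split_indicator)
  also have "\<dots> = ennreal (2 * pi) * (\<integral>\<^sup>+r\<in>{0<..<1}. ennreal r * m r \<partial>lborel)"
    by (rule nn_integral_cmult) measurable
  finally show ?thesis unfolding m_def
    by (subst (asm) ennreal_mult_cancel_left) auto
qed

section \<open>Arc length and the Douglas integral in angular coordinates\<close>

lemma space_arc_length [simp]: "space arc_length = sphere 0 1"
  by (simp add: arc_length_def space_restrict_space)

lemma nn_integral_arc_length:
  fixes F :: "complex \<Rightarrow> ennreal"
  assumes [measurable]: "F \<in> borel_measurable borel"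
  shows "(\<integral>\<^sup>+\<xi>. F \<xi> \<partial>arc_length) = (\<integral>\<^sup>+t\<in>{0..<2 * pi}. F (cis t) \<partial>lborel)"
proof -
  have "cis \<in> restrict_space lborel {0..<2 * pi} \<rightarrow>\<^sub>M restrict_space borel (sphere 0 1)"
    by (intro measurable_restrict_space2 measurable_restrict_space1) auto
  moreover have "F \<in> borel_measurable (restrict_space borel (sphere 0 1))"
    by (intro measurable_restrict_space1) measurable
  ultimately show ?thesis
    unfolding arc_length_def by (subst nn_integral_distr) (auto simp: nn_integral_restrict_space)
qed

lemma cmod_cis_diff: "cmod (cis (b + s) - cis b) = cmod (cis s - 1)"
proof -
  have "cis (b + s) - cis b = cis b * (cis s - 1)" by (simp add: cis_mult algebra_simps)
  then show ?thesis by (simp add: norm_mult)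
qed

lemma continuous_on_circle_cis:
  assumes "continuous_on (sphere 0 1) \<phi>"
  shows "continuous_on UNIV (\<lambda>t. \<phi> (cis t))"
  by (rule continuous_on_compose2[OF assms]) (auto intro!: continuous_intros)

text \<open>The Douglas integral with \<eta> = cis b and \<xi> = cis (b + s). Centring s at 0 puts
  the singularity inside the range of integration, so that near and far pairs are told apart by |s|
  alone.\<close>

definition quotient_modular :: "(real \<Rightarrow> real) \<Rightarrow> (complex \<Rightarrow> complex) \<Rightarrow> ennreal" where
  "quotient_modular \<Phi> \<phi> = (\<integral>\<^sup>+b\<in>{0..<2 * pi}. (\<integral>\<^sup>+s\<in>{-pi..<pi}.
     ennreal (\<Phi> (cmod (\<phi> (cis (b + s)) - \<phi> (cis b)) / cmod (cis s - 1))) \<partial>lborel) \<partial>lborel)"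

lemma Douglas_condition_iff:
  assumes \<phi>: "continuous_on (sphere 0 1) \<phi>" and \<Phi>: "continuous_on {0..} \<Phi>"
  shows "Douglas_condition \<Phi> \<phi> \<longleftrightarrow> quotient_modular \<Phi> \<phi> < \<infinity>"
proof -
  \<comment> \<open>Both functions are replaced by Borel functions on the whole space which agree
    with them on the circle and on [0, \<infinity>), the only places where the integrand evaluates
    them. On the diagonal both versions read 0 / 0 = 0.\<close>
  define \<phi>' where "\<phi>' = (\<lambda>z. if z \<in> sphere 0 1 then \<phi> z else 0)"
  define \<Phi>' where "\<Phi>' = (\<lambda>t. \<Phi> (max 0 t))"
  have [measurable]: "\<phi>' \<in> borel_measurable borel"
    unfolding \<phi>'_def by (rule borel_measurable_continuous_on_if) (auto intro: \<phi>)
  have "continuous_on UNIV \<Phi>'"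
    unfolding \<Phi>'_def by (rule continuous_on_compose2[OF \<Phi>]) (auto intro!: continuous_intros)
  then have [measurable]: "\<Phi>' \<in> borel_measurable borel"
    by (rule borel_measurable_continuous_onI)
  define E where "E = (\<lambda>\<eta> \<xi>. ennreal (\<Phi>' (cmod ((\<phi>' \<xi> - \<phi>' \<eta>) / (\<xi> - \<eta>)))))"
  have [measurable]: "(\<lambda>(\<eta>, \<xi>). E \<eta> \<xi>) \<in> borel_measurable (borel \<Otimes>\<^sub>M borel)"
    unfolding E_def by measurable
  have "(\<integral>\<^sup>+ \<eta>. (\<integral>\<^sup>+ \<xi>. ennreal (\<Phi> (cmod ((\<phi> \<xi> - \<phi> \<eta>) / (\<xi> - \<eta>)))) \<partial>arc_length) \<partial>arc_length)
     = (\<integral>\<^sup>+ \<eta>. (\<integral>\<^sup>+ \<xi>. E \<eta> \<xi> \<partial>arc_length) \<partial>arc_length)"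
    by (intro nn_integral_cong) (auto simp: E_def \<phi>'_def \<Phi>'_def)
  also have "\<dots> = (\<integral>\<^sup>+ \<eta>. (\<integral>\<^sup>+t\<in>{0..<2 * pi}. E \<eta> (cis t) \<partial>lborel) \<partial>arc_length)"
    by (intro nn_integral_cong nn_integral_arc_length) measurable
  also have "\<dots> = (\<integral>\<^sup>+b\<in>{0..<2 * pi}. (\<integral>\<^sup>+t\<in>{0..<2 * pi}. E (cis b) (cis t) \<partial>lborel) \<partial>lborel)"
    by (rule nn_integral_arc_length) measurable
  also have "\<dots> = (\<integral>\<^sup>+b\<in>{0..<2 * pi}. (\<integral>\<^sup>+s\<in>{-pi..<pi}. E (cis b) (cis (b + s)) \<partial>lborel) \<partial>lborel)"
  proof -
    have "(\<integral>\<^sup>+t\<in>{0..<2 * pi}. E (cis b) (cis t) \<partial>lborel) = (\<integral>\<^sup>+s\<in>{-pi..<pi}. E (cis b) (cis (b + s)) \<partial>lborel)" for b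
    proof -
      have "(\<integral>\<^sup>+t\<in>{0..<2 * pi}. E (cis b) (cis t) \<partial>lborel) = (\<integral>\<^sup>+t\<in>{b - pi..<b - pi + 2 * pi}. E (cis b) (cis t) \<partial>lborel)"
        by (rule nn_integral_periodic_shift[symmetric]) (measurable, simp add: cis_mult[symmetric])
      also have "\<dots> = (\<integral>\<^sup>+t. E (cis b) (cis (t + b)) * indicator {b - pi..<b - pi + 2 * pi} (t + b) \<partial>lborel)"
        by (rule nn_integral_translate[symmetric]) measurable
      also have "\<dots> = (\<integral>\<^sup>+s\<in>{-pi..<pi}. E (cis b) (cis (b + s)) \<partial>lborel)"
        by (intro nn_integral_cong) (auto simp: add.commute split: split_indicator)
      finally show ?thesis .
    qed
    then show ?thesis by simp
  qed
  also have "\<dots> = quotient_modular \<Phi> \<phi>"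
    by (simp add: quotient_modular_def E_def \<phi>'_def \<Phi>'_def norm_divide cmod_cis_diff)
  finally show ?thesis by (simp add: Douglas_condition_def)
qed

section \<open>N-functions: measurability, scaling and integrability\<close>

lemma N_functionD:
  assumes "N_function \<Phi>"
  shows N_function_nonneg: "\<And>t. 0 \<le> t \<Longrightarrow> 0 \<le> \<Phi> t"
    and N_function_continuous: "continuous_on {0..} \<Phi>"
    and N_function_convex: "convex_on {0..} \<Phi>"
    and N_function_mono: "\<And>s t. 0 \<le> s \<Longrightarrow> s \<le> t \<Longrightarrow> \<Phi> s \<le> \<Phi> t"
    and N_function_0: "\<Phi> 0 = 0"
  using assms by (auto simp: N_function_def mono_on_def)

lemma N_function_borel:
  assumes "N_function \<Phi>" shows "(\<lambda>t. \<Phi> (max 0 t)) \<in> borel_measurable borel"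
  by (intro borel_measurable_continuous_onI continuous_on_compose2[OF N_function_continuous[OF assms]])
     (auto intro!: continuous_intros)

lemma borel_measurable_N_function:
  assumes "N_function \<Phi>" and f: "f \<in> borel_measurable M" "\<And>x. x \<in> space M \<Longrightarrow> 0 \<le> f x"
  shows "(\<lambda>x. \<Phi> (f x)) \<in> borel_measurable M"
proof -
  have "(\<lambda>x. \<Phi> (max 0 (f x))) \<in> borel_measurable M"
    by (rule measurable_compose[OF f(1) N_function_borel[OF assms(1)]])
  then show ?thesis by (rule measurable_cong[THEN iffD1, rotated]) (simp add: f)
qed

text \<open>Jensen's inequality is applied on an open interval, for which 0 must not be an endpoint.
  Extending \<Phi> by its value at 0 keeps convexity because \<Phi> increases.\<close>

lemma N_function_convex_extension:
  assumes "N_function \<Phi>" shows "convex_on UNIV (\<lambda>t. \<Phi> (max 0 t))"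
proof (rule convex_onI)
  fix t x y :: real assume t: "0 < t" "t < 1"
  have "max 0 ((1 - t) *\<^sub>R x + t *\<^sub>R y) \<le> (1 - t) * max 0 x + t * max 0 y"
  proof -
    have "(1 - t) * x \<le> (1 - t) * max 0 x" "t * y \<le> t * max 0 y"
      using t by (intro mult_left_mono; simp)+
    moreover have "0 \<le> (1 - t) * max 0 x" "0 \<le> t * max 0 y" using t by simp_all
    ultimately show ?thesis by simp
  qed
  then have "\<Phi> (max 0 ((1 - t) *\<^sub>R x + t *\<^sub>R y)) \<le> \<Phi> ((1 - t) * max 0 x + t * max 0 y)"
    by (intro N_function_mono[OF assms]) auto
  also have "\<dots> \<le> (1 - t) * \<Phi> (max 0 x) + t * \<Phi> (max 0 y)"
    using convex_onD[OF N_function_convex[OF assms], of t "max 0 x" "max 0 y"] t by simp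
  finally show "\<Phi> (max 0 ((1 - t) *\<^sub>R x + t *\<^sub>R y)) \<le> (1 - t) * \<Phi> (max 0 x) + t * \<Phi> (max 0 y)" .
qed simp

lemma doubling_scale:
  assumes N: "N_function \<Phi>" and "doubling \<Phi>" and L: "L \<ge> 0"
  obtains C where "C \<ge> 1" "\<And>t. 0 \<le> t \<Longrightarrow> \<Phi> (L * t) \<le> C * \<Phi> t"
proof -
  obtain D where D: "D \<ge> 2" "\<And>t. t \<ge> 0 \<Longrightarrow> \<Phi> (2 * t) \<le> D * \<Phi> t"
    using assms by (auto simp: doubling_def)
  have pow: "\<Phi> (2 ^ n * t) \<le> D ^ n * \<Phi> t" if "t \<ge> 0" for n t
  proof (induction n)
    case (Suc n)
    have "\<Phi> (2 ^ Suc n * t) \<le> D * \<Phi> (2 ^ n * t)" using D(2)[of "2 ^ n * t"] that by (simp add: mult.assoc)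
    also have "\<dots> \<le> D * (D ^ n * \<Phi> t)" using Suc D by (intro mult_left_mono) auto
    finally show ?case by simp
  qed simp
  obtain n where n: "max 0 L < 2 ^ n" using real_arch_pow[of 2 "max 0 L"] by auto
  have "\<Phi> (L * t) \<le> D ^ n * \<Phi> t" if t: "0 \<le> t" for t
  proof -
    have "\<Phi> (L * t) \<le> \<Phi> (2 ^ n * t)" using n t L by (intro N_function_mono[OF N] mult_right_mono) auto
    then show ?thesis using pow[OF t, of n] by simp
  qed
  then show ?thesis using that[of "D ^ n"] D by simp
qed

text \<open>Comparison of the identity with \<Phi> turns a finite modular into integrability on sets
  of finite measure, as in \<open>N_function_set_integrable\<close>.\<close>

lemma N_function_superlinear:
  assumes "N_function \<Phi>"
  obtains T where "T \<ge> 0" "\<And>t. 0 \<le> t \<Longrightarrow> t \<le> T + \<Phi> t"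
proof -
  have "filterlim (\<lambda>t. \<Phi> t / t) at_top at_top" using assms by (simp add: N_function_def)
  then have "eventually (\<lambda>t. \<Phi> t / t \<ge> 1) at_top" by (simp add: filterlim_at_top)
  then obtain T where T: "\<And>t. t \<ge> T \<Longrightarrow> \<Phi> t / t \<ge> 1" by (auto simp: eventually_at_top_linorder)
  have "t \<le> max 1 T + \<Phi> t" if "0 \<le> t" for t
  proof (cases "t \<ge> max 1 T")
    case True
    then have "t \<le> \<Phi> t" using T[of t] by (auto simp: field_simps)
    then show ?thesis using True by linarith
  next
    case False
    then show ?thesis using N_function_nonneg[OF assms that] by linarith
  qed
  then show ?thesis using that[of "max 1 T"] by auto
qed

lemma N_function_set_integrable:
  fixes G :: "'a::euclidean_space \<Rightarrow> real"
  assumes N: "N_function \<Phi>" and [measurable]: "G \<in> borel_measurable borel" "A \<in> sets borel" and G0: "\<And>z. 0 \<le> G z"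
    and A: "emeasure lborel A < \<infinity>" and fin: "(\<integral>\<^sup>+z\<in>A. ennreal (\<Phi> (G z)) \<partial>lborel) < \<infinity>"
  shows "integrable lborel (\<lambda>z. indicator A z *\<^sub>R G z)"
proof (rule integrableI_nonneg)
  obtain T where T: "T \<ge> 0" "\<And>t. 0 \<le> t \<Longrightarrow> t \<le> T + \<Phi> t" using N_function_superlinear[OF N] by blast
  have [measurable]: "(\<lambda>z. \<Phi> (G z)) \<in> borel_measurable borel"
    by (rule borel_measurable_N_function[OF N]) (auto simp: G0)
  have "(\<integral>\<^sup>+z. ennreal (indicator A z *\<^sub>R G z) \<partial>lborel)
    \<le> (\<integral>\<^sup>+z. ennreal T * indicator A z + ennreal (\<Phi> (G z)) * indicator A z \<partial>lborel)"
  proof (rule nn_integral_mono)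
    fix z
    have "ennreal (G z) \<le> ennreal (T + \<Phi> (G z))" by (intro ennreal_leI T G0)
    then show "ennreal (indicator A z *\<^sub>R G z) \<le> ennreal T * indicator A z + ennreal (\<Phi> (G z)) * indicator A z"
      using T N_function_nonneg[OF N G0] by (auto split: split_indicator)
  qed
  also have "\<dots> = ennreal T * emeasure lborel A + (\<integral>\<^sup>+z\<in>A. ennreal (\<Phi> (G z)) \<partial>lborel)"
    by (subst nn_integral_add) (auto simp: nn_integral_cmult)
  also have "\<dots> < \<infinity>" using fin A by (simp add: ennreal_mult_less_top)
  finally show "(\<integral>\<^sup>+z. ennreal (indicator A z *\<^sub>R G z) \<partial>lborel) < \<infinity>" .
qed (auto simp: G0)

lemma N_function_add:
  assumes "N_function \<Phi>" "0 \<le> x" "0 \<le> y"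
  shows "\<Phi> (x + y) \<le> \<Phi> (2 * x) + \<Phi> (2 * y)"
proof -
  have "\<Phi> (x + y) \<le> \<Phi> (2 * max x y)" using assms by (intro N_function_mono[OF assms(1)]) auto
  also have "\<dots> \<le> \<Phi> (2 * x) + \<Phi> (2 * y)"
    using assms N_function_nonneg[OF assms(1), of "2 * x"] N_function_nonneg[OF assms(1), of "2 * y"]
    by (auto simp: max_def)
  finally show ?thesis .
qed

section \<open>The trace estimate\<close>

lemma N_function_Jensen:
  assumes N: "N_function \<Phi>" and M: "prob_space M"
    and X: "integrable M X" "\<And>x. x \<in> space M \<Longrightarrow> 0 \<le> X x"
  shows "ennreal (\<Phi> (integral\<^sup>L M X)) \<le> (\<integral>\<^sup>+x. ennreal (\<Phi> (X x)) \<partial>M)"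
proof (cases "(\<integral>\<^sup>+x. ennreal (\<Phi> (X x)) \<partial>M) = \<infinity>")
  case False
  interpret prob_space M by fact
  define q where "q = (\<lambda>t. \<Phi> (max 0 t))"
  have q: "q (X x) = \<Phi> (X x)" if "x \<in> space M" for x using X(2)[OF that] by (simp add: q_def)
  have nn: "(\<integral>\<^sup>+x. ennreal (q (X x)) \<partial>M) = (\<integral>\<^sup>+x. ennreal (\<Phi> (X x)) \<partial>M)"
    by (intro nn_integral_cong) (simp add: q)
  have [measurable]: "X \<in> borel_measurable M" using X(1) by auto
  have q0: "0 \<le> q t" for t unfolding q_def by (intro N_function_nonneg[OF N]) simp
  have meas: "(\<lambda>x. q (X x)) \<in> borel_measurable M"
    unfolding q_def by (rule measurable_compose[OF _ N_function_borel[OF N]]) measurable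
  have int: "integrable M (\<lambda>x. q (X x))"
    using False q0 by (intro integrableI_nonneg meas) (auto simp: nn top.not_eq_extremum)
  have "0 \<le> expectation X" by (intro integral_nonneg_AE AE_I2) (simp add: X)
  then have "\<Phi> (expectation X) = q (expectation X)" by (simp add: q_def)
  also have "\<dots> \<le> expectation (\<lambda>x. q (X x))"
    by (rule jensens_inequality[where I=UNIV, OF X(1) _ _ int])
       (auto simp: q_def intro: N_function_convex_extension[OF N])
  finally have "ennreal (\<Phi> (expectation X)) \<le> ennreal (expectation (\<lambda>x. q (X x)))" by (rule ennreal_leI)
  also have "\<dots> = (\<integral>\<^sup>+x. ennreal (q (X x)) \<partial>M)"
    using q0 by (intro nn_integral_eq_integral[symmetric] int) auto
  finally show ?thesis by (simp add: nn)
qed simp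

lemma prob_space_unit_interval: "prob_space (restrict_space lborel {0..1::real})"
  by (rule prob_spaceI) (simp add: emeasure_restrict_space space_restrict_space)

lemma N_function_Jensen_unit_interval:
  assumes N: "N_function \<Phi>"
    and X: "set_integrable lborel {0..1} X" "\<And>u. 0 \<le> u \<Longrightarrow> u \<le> 1 \<Longrightarrow> 0 \<le> X u"
  shows "ennreal (\<Phi> (LINT u:{0..1}|lborel. X u)) \<le> (\<integral>\<^sup>+u\<in>{0..1::real}. ennreal (\<Phi> (X u)) \<partial>lborel)"
proof -
  have "integrable (restrict_space lborel {0..1}) X"
    using X(1) by (simp add: set_integrable_def integrable_restrict_space)
  from N_function_Jensen[OF N prob_space_unit_interval this]
  have "ennreal (\<Phi> (integral\<^sup>L (restrict_space lborel {0..1}) X)) \<le> (\<integral>\<^sup>+u. ennreal (\<Phi> (X u)) \<partial>restrict_space lborel {0..1})"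
    using X(2) by (simp add: space_restrict_space)
  also have "\<dots> = (\<integral>\<^sup>+u\<in>{0..1}. ennreal (\<Phi> (X u)) \<partial>lborel)"
    by (rule nn_integral_restrict_space) simp
  finally show ?thesis by (simp add: set_lebesgue_integral_def integral_restrict_space)
qed

text \<open>For \<open>u G \<ge> t\<^sub>0\<close> this is \<open>(aInc)\<^sub>p\<close> between \<open>u G\<close> and \<open>G\<close>.\<close>

lemma aInc_scale:
  assumes N: "N_function \<Phi>" and d: "doubling \<Phi>" and "p > 1" "t0 \<ge> 0" and a: "aInc p t0 \<Phi>"
  obtains C where "C \<ge> 1"
    "\<And>u G. 0 < u \<Longrightarrow> u \<le> 1 \<Longrightarrow> 0 \<le> G \<Longrightarrow> \<Phi> (8 * (u * G)) \<le> C * (u powr p * \<Phi> G + 1)"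
proof -
  \<comment> \<open>The 8 is the 4 in the speed bound 4 \<tau> u of the paths times the 2 lost in
    \<open>N_function_add\<close> when the two halves of a path are separated.\<close>
  obtain D where D: "D \<ge> 1" "\<And>t. 0 \<le> t \<Longrightarrow> \<Phi> (8 * t) \<le> D * \<Phi> t"
    using doubling_scale[OF N d, of 8] by auto
  obtain A where A: "A \<ge> 1" "\<And>s t. t0 \<le> s \<Longrightarrow> s \<le> t \<Longrightarrow> 0 < s \<Longrightarrow> \<Phi> s / s powr p \<le> A * (\<Phi> t / t powr p)"
    using a by (auto simp: aInc_def)
  \<comment> \<open>\<open>A\<close> serves the arguments u G \<ge> t0. Below t0 the value \<Phi> (u
    G) is at most \<Phi> t0, which the summand 1 absorbs.\<close>
  define B where "B = max A (\<Phi> t0)"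
  have "\<Phi> (8 * (u * G)) \<le> (D * B) * (u powr p * \<Phi> G + 1)" if u: "0 < u" "u \<le> 1" and G: "0 \<le> G" for u G
  proof -
    have nn: "0 \<le> u powr p * \<Phi> G" using N_function_nonneg[OF N G] by simp
    have "\<Phi> (u * G) \<le> B * (u powr p * \<Phi> G + 1)"
    proof (cases "t0 \<le> u * G \<and> 0 < u * G")
      case True
      then have G0: "G > 0" using u by (simp add: zero_less_mult_iff)
      have "u * G \<le> G" using u G by (simp add: mult_left_le_one_le)
      with A(2)[of "u * G" G] True have "\<Phi> (u * G) / (u * G) powr p \<le> A * (\<Phi> G / G powr p)" by simp
      then have "\<Phi> (u * G) \<le> A * (\<Phi> G / G powr p) * (u * G) powr p"
        using True by (subst (asm) pos_divide_le_eq) auto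
      also have "\<dots> = A * (u powr p * \<Phi> G)" using G0 u by (simp add: powr_mult)
      also have "\<dots> \<le> B * (u powr p * \<Phi> G)" using nn by (intro mult_right_mono) (auto simp: B_def)
      also have "\<dots> \<le> B * (u powr p * \<Phi> G + 1)" using A by (intro mult_left_mono) (auto simp: B_def)
      finally show ?thesis .
    next
      case False
      then have "u * G \<le> t0" using u G \<open>t0 \<ge> 0\<close> by (auto simp: not_less)
      then have "\<Phi> (u * G) \<le> \<Phi> t0" using u G by (intro N_function_mono[OF N]) auto
      also have "\<dots> \<le> B * 1" by (simp add: B_def)
      also have "\<dots> \<le> B * (u powr p * \<Phi> G + 1)" using nn A by (intro mult_left_mono) (auto simp: B_def)
      finally show ?thesis .
    qed
    then have "D * \<Phi> (u * G) \<le> D * (B * (u powr p * \<Phi> G + 1))" using D by (intro mult_left_mono) auto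
    with D(2)[of "u * G"] u G show ?thesis by (simp add: mult.assoc)
  qed
  moreover have "1 * 1 \<le> D * B" using D A by (intro mult_mono) (auto simp: B_def)
  ultimately show ?thesis using that[of "D * B"] by simp
qed

section \<open>Arcs and chords\<close>

lemma sin_ge_half: "0 \<le> x \<Longrightarrow> x \<le> 1 \<Longrightarrow> x / 2 \<le> sin (x::real)"
proof -
  assume x: "0 \<le> x" "x \<le> 1"
  have "(\<lambda>x. sin x - x / 2) 0 \<le> (\<lambda>x. sin x - x / 2) x"
  proof (rule DERIV_nonneg_imp_nondecreasing[OF x(1)])
    fix y assume y: "0 \<le> y" "y \<le> x"
    have "cos y \<ge> cos (pi / 3)" using y x pi_gt3 by (intro cos_monotone_0_pi_le) auto
    then have "cos y \<ge> 1 / 2" by (simp add: cos_60)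
    then show "\<exists>d. ((\<lambda>x. sin x - x / 2) has_real_derivative d) (at y) \<and> 0 \<le> d"
      by (intro exI[of _ "cos y - 1 / 2"]) (auto intro!: derivative_eq_intros)
  qed
  then show ?thesis by simp
qed

lemma cmod_cis_minus_1: "cmod (cis s - 1) = 2 * \<bar>sin (s / 2)\<bar>"
proof -
  have "(cmod (cis s - 1))\<^sup>2 = (cos s - 1)\<^sup>2 + (sin s)\<^sup>2" by (simp add: cmod_def)
  also have "\<dots> = 2 - 2 * cos s" using sin_cos_squared_add[of s] by (simp add: power2_eq_square algebra_simps)
  also have "\<dots> = (2 * \<bar>sin (s / 2)\<bar>)\<^sup>2"
    using cos_double_sin[of "s / 2"] by (simp add: power_mult_distrib)
  finally show ?thesis by (rule power2_eq_imp_eq) auto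
qed

lemma cmod_cis_minus_1_ge: "\<bar>s\<bar> \<le> 1 \<Longrightarrow> \<bar>s\<bar> / 2 \<le> cmod (cis s - 1)"
  using sin_ge_half[of "\<bar>s\<bar> / 2"] unfolding cmod_cis_minus_1 by (cases "s \<ge> 0") auto

lemma cmod_cis_minus_1_ge_half:
  assumes "1 \<le> \<bar>s\<bar>" "\<bar>s\<bar> \<le> pi"
  shows "1 / 2 \<le> cmod (cis s - 1)"
proof -
  have "1 / 4 \<le> sin (1 / 2 :: real)" using sin_ge_half[of "1/2"] by simp
  also have "\<dots> \<le> sin (\<bar>s\<bar> / 2)" using assms by (intro sin_monotone_2pi_le) auto
  also have "\<dots> \<le> \<bar>sin (s / 2)\<bar>" by (cases "s \<ge> 0") auto
  finally show ?thesis unfolding cmod_cis_minus_1 by simp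
qed

section \<open>Averages over the boundary layer\<close>

lemma nn_integral_powr_unit:
  assumes "(p::real) > 1"
  shows "(\<integral>\<^sup>+u\<in>{0..1}. ennreal (u powr (p - 2)) \<partial>lborel) = ennreal (1 / (p - 1))"
proof -
  have hi: "((\<lambda>u. u powr (p - 2)) has_integral (1 / (p - 1))) {0..1}"
    using has_integral_powr_from_0[of "p - 2" 1] assms by simp
  then have "((\<lambda>u. u powr (p - 2) * indicator {0..1} u) has_integral (1 / (p - 1))) UNIV"
    by (subst (asm) has_integral_restrict_UNIV[symmetric])
       (auto simp: indicator_def of_bool_def if_distrib cong: if_cong)
  then have "(\<integral>\<^sup>+u. ennreal (u powr (p - 2) * indicator {0..1} u) \<partial>lborel) = ennreal (1 / (p - 1))"
    by (intro nn_integral_has_integral_lborel) auto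
  then show ?thesis by (simp add: ennreal_mult'' ennreal_indicator)
qed

text \<open>For t \<le> 1/2 the radius r = 1 - t is at least 1/2, so inserting the polar Jacobian r
  costs a factor 2 at most.\<close>

lemma nn_integral_boundary_layer:
  fixes P :: "complex \<Rightarrow> ennreal"
  assumes [measurable]: "P \<in> borel_measurable borel"
  shows "(\<integral>\<^sup>+t\<in>{0<..1/2}. (\<integral>\<^sup>+b\<in>{0..<2 * pi}. P (of_real (1 - t) * cis b) \<partial>lborel) \<partial>lborel)
    \<le> 2 * (\<integral>\<^sup>+z\<in>ball 0 1. P z \<partial>lborel)"
proof -
  define m where "m = (\<lambda>r. \<integral>\<^sup>+b\<in>{0..<2 * pi}. P (of_real r * cis b) \<partial>lborel)"
  have [measurable]: "m \<in> borel_measurable borel" unfolding m_def by measurable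
  have "(\<integral>\<^sup>+t\<in>{0<..1/2}. m (1 - t) \<partial>lborel) \<le> (\<integral>\<^sup>+t. 2 * (ennreal (1 - t) * m (1 - t) * indicator {0<..<1} (1 - t)) \<partial>lborel)"
  proof (intro nn_integral_mono)
    fix t :: real
    show "m (1 - t) * indicator {0<..1/2} t \<le> 2 * (ennreal (1 - t) * m (1 - t) * indicator {0<..<1} (1 - t))"
    proof (cases "t \<in> {0<..1/2}")
      case True
      have "1 * m (1 - t) \<le> ennreal (2 * (1 - t)) * m (1 - t)"
        using True by (intro mult_right_mono) (auto simp: ennreal_leI simp flip: ennreal_1)
      also have "\<dots> = 2 * (ennreal (1 - t) * m (1 - t))"
        using True by (subst ennreal_mult) (auto simp: mult.assoc)
      finally show ?thesis using True by simp
    qed simp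
  qed
  also have "\<dots> = 2 * (\<integral>\<^sup>+t. (ennreal (1 - t) * m (1 - t) * indicator {0<..<1} (1 - t)) \<partial>lborel)"
    by (rule nn_integral_cmult) measurable
  also have "(\<integral>\<^sup>+t. (ennreal (1 - t) * m (1 - t) * indicator {0<..<1} (1 - t)) \<partial>lborel) = (\<integral>\<^sup>+r\<in>{0<..<1}. ennreal r * m r \<partial>lborel)"
    using nn_integral_real_affine[of "\<lambda>r. ennreal r * m r * indicator {0<..<1} r" "-1" 1] by simp
  also have "\<dots> = (\<integral>\<^sup>+z\<in>ball 0 1. P z \<partial>lborel)"
    unfolding m_def by (rule nn_integral_polar[symmetric]) measurable
  finally show ?thesis by (simp add: m_def)
qed

text \<open>For fixed \<tau> and u the angular drift \<kappa> \<tau> u^2 is a rotation, so the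
  integral over b sees only the radius 1 - \<tau> u^2. The bound is therefore the same for every
  \<kappa>.\<close>

lemma periodic_path_average:
  fixes P :: "complex \<Rightarrow> ennreal"
  assumes [measurable]: "P \<in> borel_measurable borel" and p: "p > 1"
  shows "(\<integral>\<^sup>+b\<in>{0..<2 * pi}. (\<integral>\<^sup>+\<tau>\<in>{0<..1/2}. (\<integral>\<^sup>+u\<in>{0<..1}.
      ennreal (u powr p) * P (of_real (1 - \<tau> * u\<^sup>2) * cis (b + \<kappa> * \<tau> * u\<^sup>2)) \<partial>lborel) \<partial>lborel) \<partial>lborel)
    \<le> ennreal (2 / (p - 1)) * (\<integral>\<^sup>+z\<in>ball 0 1. P z \<partial>lborel)"
proof -
  define m where "m = (\<lambda>t. \<integral>\<^sup>+b\<in>{0..<2 * pi}. P (of_real (1 - t) * cis b) \<partial>lborel)"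
  have [measurable]: "m \<in> borel_measurable borel" unfolding m_def by measurable
  define S where "S = (\<integral>\<^sup>+z\<in>ball 0 1. P z \<partial>lborel)"
  define f where "f = (\<lambda>b \<tau> u. ennreal (u powr p) * P (of_real (1 - \<tau> * u\<^sup>2) * cis (b + \<kappa> * \<tau> * u\<^sup>2)))"
  have [measurable]: "(\<lambda>x. f (g1 x) (g2 x) (g3 x)) \<in> borel_measurable M"
    if [measurable]: "g1 \<in> borel_measurable M" "g2 \<in> borel_measurable M" "g3 \<in> borel_measurable M"
    for g1 g2 g3 and M :: "'z measure" unfolding f_def by measurable
  have inner: "(\<integral>\<^sup>+b\<in>{0..<2 * pi}. f b \<tau> u \<partial>lborel) = ennreal (u powr p) * m (\<tau> * u\<^sup>2)" for \<tau> u
  proof -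
    have "(\<integral>\<^sup>+b\<in>{0..<2 * pi}. f b \<tau> u \<partial>lborel) =
      ennreal (u powr p) * (\<integral>\<^sup>+b\<in>{0..<2 * pi}. P (of_real (1 - \<tau> * u\<^sup>2) * cis (b + \<kappa> * \<tau> * u\<^sup>2)) \<partial>lborel)"
      unfolding f_def mult.assoc by (rule nn_integral_cmult) measurable
    also have "(\<integral>\<^sup>+b\<in>{0..<2 * pi}. P (of_real (1 - \<tau> * u\<^sup>2) * cis (b + \<kappa> * \<tau> * u\<^sup>2)) \<partial>lborel) = m (\<tau> * u\<^sup>2)"
      unfolding m_def
      by (rule nn_integral_periodic_translate[where f="\<lambda>b. P (of_real (1 - \<tau> * u\<^sup>2) * cis b)"])
         (measurable, simp add: cis_mult[symmetric])
    finally show ?thesis .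
  qed
  have scale: "(\<integral>\<^sup>+\<tau>\<in>{0<..1/2}. m (\<tau> * u\<^sup>2) \<partial>lborel) \<le> ennreal (1 / u\<^sup>2) * (2 * S)" if u: "0 < u" "u \<le> 1" for u
  proof -
    have u2: "0 < u\<^sup>2" "u\<^sup>2 \<le> 1" using u by (auto simp: power_le_one)
    \<comment> \<open>Since u^2 \<le> 1, the substituted variable t = \<tau> u^2 stays in (0, 1/2];
      enlarging the domain to all of that interval makes the bound depend on u only through the
      Jacobian.\<close>
    have "(\<integral>\<^sup>+\<tau>\<in>{0<..1/2}. m (\<tau> * u\<^sup>2) \<partial>lborel) \<le> (\<integral>\<^sup>+\<tau>. m (\<tau> * u\<^sup>2) * indicator {0<..1/2} (\<tau> * u\<^sup>2) \<partial>lborel)"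
    proof (intro nn_integral_mono mult_left_mono)
      fix \<tau> :: real
      have h: "0 < \<tau> \<Longrightarrow> \<tau> \<le> 1/2 \<Longrightarrow> \<tau> * u\<^sup>2 \<le> 1/2"
        using u2 mult_left_le[of "u\<^sup>2" \<tau>] by linarith
      show "indicator {0<..1/2} \<tau> \<le> (indicator {0<..1/2} (\<tau> * u\<^sup>2) :: ennreal)"
        using u2 h by (auto simp: zero_less_mult_iff split: split_indicator)
    qed simp
    also have "\<dots> = ennreal (1 / u\<^sup>2) * (\<integral>\<^sup>+t\<in>{0<..1/2}. m t \<partial>lborel)"
      using u2 nn_integral_real_affine[of "\<lambda>t. m (t * u\<^sup>2) * indicator {0<..1/2} (t * u\<^sup>2)" "1 / u\<^sup>2" 0] by simp
    also have "\<dots> \<le> ennreal (1 / u\<^sup>2) * (2 * S)"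
      unfolding m_def S_def by (intro mult_left_mono nn_integral_boundary_layer) auto
    finally show ?thesis .
  qed
  \<comment> \<open>The order of integration becomes b innermost, then \<tau>, then u: the rotation
    is removed first, and the substitution is done for fixed u.\<close>
  have "(\<integral>\<^sup>+b\<in>{0..<2 * pi}. (\<integral>\<^sup>+\<tau>\<in>{0<..1/2}. (\<integral>\<^sup>+u\<in>{0<..1}. f b \<tau> u \<partial>lborel) \<partial>lborel) \<partial>lborel)
      = (\<integral>\<^sup>+\<tau>\<in>{0<..1/2}. (\<integral>\<^sup>+b\<in>{0..<2 * pi}. (\<integral>\<^sup>+u\<in>{0<..1}. f b \<tau> u \<partial>lborel) \<partial>lborel) \<partial>lborel)"
    by (rule set_nn_integral_swap) auto
  also have "\<dots> = (\<integral>\<^sup>+\<tau>\<in>{0<..1/2}. (\<integral>\<^sup>+u\<in>{0<..1}. (\<integral>\<^sup>+b\<in>{0..<2 * pi}. f b \<tau> u \<partial>lborel) \<partial>lborel) \<partial>lborel)"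
    by (subst set_nn_integral_swap) auto
  also have "\<dots> = (\<integral>\<^sup>+u\<in>{0<..1}. (\<integral>\<^sup>+\<tau>\<in>{0<..1/2}. ennreal (u powr p) * m (\<tau> * u\<^sup>2) \<partial>lborel) \<partial>lborel)"
    unfolding inner by (rule set_nn_integral_swap) auto
  also have "\<dots> \<le> (\<integral>\<^sup>+u. (ennreal (u powr (p - 2)) * indicator {0..1} u) * (2 * S) \<partial>lborel)"
  proof (intro nn_integral_mono)
    fix u :: real
    show "(\<integral>\<^sup>+\<tau>\<in>{0<..1/2}. ennreal (u powr p) * m (\<tau> * u\<^sup>2) \<partial>lborel) * indicator {0<..1} u
      \<le> (ennreal (u powr (p - 2)) * indicator {0..1} u) * (2 * S)"
    proof (cases "0 < u \<and> u \<le> 1")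
      case True
      have "(\<integral>\<^sup>+\<tau>\<in>{0<..1/2}. ennreal (u powr p) * m (\<tau> * u\<^sup>2) \<partial>lborel) = ennreal (u powr p) * (\<integral>\<^sup>+\<tau>\<in>{0<..1/2}. m (\<tau> * u\<^sup>2) \<partial>lborel)"
        unfolding mult.assoc by (rule nn_integral_cmult) measurable
      also have "\<dots> \<le> ennreal (u powr p) * (ennreal (1 / u\<^sup>2) * (2 * S))"
        using True by (intro mult_left_mono scale) auto
      also have "\<dots> = ennreal (u powr p * (1 / u\<^sup>2)) * (2 * S)"
        by (subst ennreal_mult) (auto simp: mult.assoc)
      also have "u powr p * (1 / u\<^sup>2) = u powr (p - 2)"
        using True by (simp add: powr_diff powr_numeral)
      finally show ?thesis using True by simp
    qed auto
  qed
  also have "\<dots> = ennreal (1 / (p - 1)) * (2 * S)"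
    by (subst nn_integral_multc) (auto simp: nn_integral_powr_unit[OF p])
  also have "\<dots> = ennreal (2 / (p - 1)) * S"
    using p by (simp add: mult.assoc[symmetric] ennreal_mult'[symmetric] flip: ennreal_numeral)
  finally show ?thesis unfolding f_def S_def .
qed

text \<open>All that the trace estimate uses of a gradient: G dominates the change of F along one
  half of each path, weighted by the speed bound 4 \<tau> u. The sign \<kappa> is the direction in
  which the half path turns.\<close>

definition path_bounded :: "(complex \<Rightarrow> complex) \<Rightarrow> (complex \<Rightarrow> real) \<Rightarrow> bool" where
  "path_bounded F G \<longleftrightarrow> (\<forall>b \<tau> \<kappa>. 0 < \<tau> \<longrightarrow> \<tau> \<le> 1/2 \<longrightarrow> \<kappa> \<in> {1, -1} \<longrightarrow>
     cmod (F (cis b) - F (of_real (1 - \<tau>) * cis (b + \<kappa> * \<tau>)))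
       \<le> (LINT u:{0..1}|lborel. 4 * \<tau> * u * G (of_real (1 - \<tau> * u\<^sup>2) * cis (b + \<kappa> * \<tau> * u\<^sup>2))))"

text \<open>The order of quantifiers is the point: C is fixed before F, G and B, so it serves a
  whole sequence of mollifications. B does not enter the bound; it only ensures that the path
  integrals are integrals of integrable functions.\<close>

lemma trace_estimate:
  assumes N: "N_function \<Phi>" and d: "doubling \<Phi>" and p: "p > 1" and t0: "t0 \<ge> 0" and a: "aInc p t0 \<Phi>"
  obtains C :: real where
    "\<And>F G B. \<lbrakk>\<And>z. z \<in> sphere 0 1 \<Longrightarrow> cmod (F z) \<le> 1; G \<in> borel_measurable borel; \<And>z. 0 \<le> G z; \<And>z. G z \<le> B;
      path_bounded F G\<rbrakk> \<Longrightarrow> quotient_modular \<Phi> F \<le> ennreal C * ((\<integral>\<^sup>+z\<in>ball 0 1. ennreal (\<Phi> (G z)) \<partial>lborel) + 1)"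
proof -
  obtain C where C: "C \<ge> 1"
    "\<And>u G. 0 < u \<Longrightarrow> u \<le> 1 \<Longrightarrow> 0 \<le> G \<Longrightarrow> \<Phi> (8 * (u * G)) \<le> C * (u powr p * \<Phi> G + 1)"
    using aInc_scale[OF N d p t0 a] by blast
  \<comment> \<open>c1 collects the far part |s| \<ge> 1, namely 2 pi times 2 pi \<Phi> 4, and the
    additive constants of \<open>R\<close>. c2 is the coefficient of S: two orientations, each with
    the factor 2 from s = 2 \<tau> and the factor C * (4 / (p - 1)) from \<open>T\<close>.\<close>
  define c1 where "c1 = 4 * pi\<^sup>2 * \<Phi> 4 + 8 * C * pi"
  define c2 where "c2 = 4 * C * (4 / (p - 1))"
  have \<Phi>4: "0 \<le> \<Phi> 4" using N_function_nonneg[OF N] by simp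
  have c: "0 \<le> c1" "0 \<le> c2" using C p \<Phi>4 by (auto simp: c1_def c2_def)
  show ?thesis
  proof (rule that[of "c1 + c2"])
    fix F :: "complex \<Rightarrow> complex" and G :: "complex \<Rightarrow> real" and B :: real
    assume F1: "\<And>z. z \<in> sphere 0 1 \<Longrightarrow> cmod (F z) \<le> 1" and G [measurable]: "G \<in> borel_measurable borel"
      and G0: "\<And>z. 0 \<le> G z" and GB: "\<And>z. G z \<le> B"
      and path: "path_bounded F G"
    define g where "g = (\<lambda>\<kappa> b \<tau> u. of_real (1 - \<tau> * u\<^sup>2) * cis (b + \<kappa> * \<tau> * u\<^sup>2))"
    define P where "P = (\<lambda>z. ennreal (\<Phi> (G z)))"
    define S where "S = (\<integral>\<^sup>+z\<in>ball 0 1. P z \<partial>lborel)"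
    have [measurable]: "(\<lambda>z. \<Phi> (G z)) \<in> borel_measurable borel"
      by (rule borel_measurable_N_function[OF N G]) (rule G0)
    have [measurable]: "P \<in> borel_measurable borel" unfolding P_def by measurable
    have [measurable]: "(\<lambda>x. g (g0 x) (g1 x) (g2 x) (g3 x)) \<in> borel_measurable M"
      if [measurable]: "g0 \<in> borel_measurable M" "g1 \<in> borel_measurable M" "g2 \<in> borel_measurable M" "g3 \<in> borel_measurable M"
      for g0 g1 g2 g3 and M :: "'z measure" unfolding g_def by measurable
    define J where "J = (\<lambda>\<kappa> b \<tau>. \<integral>\<^sup>+u\<in>{0<..1}. ennreal (u powr p) * P (g \<kappa> b \<tau> u) \<partial>lborel)"
    have Jmeas [measurable]: "(\<lambda>x. J (g0 x) (g1 x) (g2 x)) \<in> borel_measurable M"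
      if [measurable]: "g0 \<in> borel_measurable M" "g1 \<in> borel_measurable M" "g2 \<in> borel_measurable M"
      for g0 g1 g2 and M :: "'z measure" unfolding J_def by measurable
    have Jper: "J \<kappa> (b + 2 * pi) \<tau> = J \<kappa> b \<tau>" for \<kappa> b \<tau>
      unfolding J_def g_def by (simp add: cis_mult[symmetric])
    define K where "K = (\<lambda>\<kappa> b \<tau>. \<integral>\<^sup>+u\<in>{0..1}. ennreal (\<Phi> (8 * (u * G (g \<kappa> b \<tau> u)))) \<partial>lborel)"
    have KJ: "K \<kappa> b \<tau> \<le> ennreal C * (J \<kappa> b \<tau> + 1)" for \<kappa> b \<tau>
    proof -
      have "K \<kappa> b \<tau> \<le> (\<integral>\<^sup>+u. ennreal C * (ennreal (u powr p) * P (g \<kappa> b \<tau> u) * indicator {0<..1} u + indicator {0<..1} u) \<partial>lborel)"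
        unfolding K_def
      proof (rule nn_integral_mono_AE)
        have "AE u in lborel. u \<noteq> (0::real)" by (rule AE_lborel_singleton)
        then show "AE u in lborel. ennreal (\<Phi> (8 * (u * G (g \<kappa> b \<tau> u)))) * indicator {0..1} u
          \<le> ennreal C * (ennreal (u powr p) * P (g \<kappa> b \<tau> u) * indicator {0<..1} u + indicator {0<..1} u)"
        proof eventually_elim
          case (elim u)
          show ?case
          proof (cases "0 < u \<and> u \<le> 1")
            case True
            have "ennreal (\<Phi> (8 * (u * G (g \<kappa> b \<tau> u)))) \<le> ennreal (C * (u powr p * \<Phi> (G (g \<kappa> b \<tau> u)) + 1))"
              using True C(2) G0 by (intro ennreal_leI) auto
            also have "\<dots> = ennreal C * (ennreal (u powr p) * P (g \<kappa> b \<tau> u) + 1)"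
              using C(1) N_function_nonneg[OF N G0] by (simp add: P_def ennreal_mult)
            finally show ?thesis using True by simp
          next
            case False
            then show ?thesis using elim by (auto split: split_indicator)
          qed
        qed
      qed
      also have "\<dots> = ennreal C * (J \<kappa> b \<tau> + 1)"
        unfolding J_def by (simp add: nn_integral_cmult nn_integral_add)
      finally show ?thesis .
    qed
    define D where "D = (\<lambda>b s. ennreal (\<Phi> (cmod (F (cis (b + s)) - F (cis b)) / cmod (cis s - 1))))"
    \<comment> \<open>One \<open>J\<close> for each half of the path: from the angle b, and from the
      other endpoint b + 2 \<kappa> \<tau> with the opposite turning direction. The 2 adds up the
      two constants in \<open>KJ\<close>.\<close>
    define R where "R = (\<lambda>\<kappa> b \<tau>. ennreal C * (J \<kappa> b \<tau> + J (-\<kappa>) (b + 2 * \<kappa> * \<tau>) \<tau> + 2))"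
    have Rmeas [measurable]: "(\<lambda>x. R (g0 x) (g1 x) (g2 x)) \<in> borel_measurable M"
      if [measurable]: "g0 \<in> borel_measurable M" "g1 \<in> borel_measurable M" "g2 \<in> borel_measurable M"
      for g0 g1 g2 and M :: "'z measure" unfolding R_def by measurable
    have DR: "D b (2 * \<kappa> * \<tau>) \<le> R \<kappa> b \<tau>" if \<tau>: "0 < \<tau>" "\<tau> \<le> 1/2" and \<kappa>: "\<kappa> \<in> {1, -1}" for b \<tau> \<kappa>
    proof -
      define s where "s = 2 * \<kappa> * \<tau>"
      define I where "I = (\<lambda>\<kappa> b. LINT u:{0..1}|lborel. 4 * u * G (g \<kappa> b \<tau> u))"
      have int: "set_integrable lborel {0..1} (\<lambda>u. 4 * u * G (g \<kappa> b \<tau> u))" for \<kappa> b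
        unfolding set_integrable_def
      proof (rule integrableI_bounded_set_indicator[where B="4 * B"])
        show "AE x in lborel. x \<in> {0..1} \<longrightarrow> norm (4 * x * G (g \<kappa> b \<tau> x)) \<le> 4 * B"
        proof (intro AE_I2 impI)
          fix x :: real assume x: "x \<in> {0..1}"
          have "x * G (g \<kappa> b \<tau> x) \<le> 1 * B" using x G0 GB by (intro mult_mono) auto
          then show "norm (4 * x * G (g \<kappa> b \<tau> x)) \<le> 4 * B" using x G0 by (simp add: abs_mult)
        qed
      qed auto
      have int2: "set_integrable lborel {0..1} (\<lambda>u. 2 * (4 * u * G (g \<kappa> b \<tau> u)))" for \<kappa> b
        by (rule set_integrable_mult_right[OF int])
      have I0: "0 \<le> I \<kappa> b" for \<kappa> b
        unfolding I_def set_lebesgue_integral_def using G0 by (intro integral_nonneg_AE AE_I2) (auto split: split_indicator)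
      have IK: "ennreal (\<Phi> (2 * I \<kappa> b)) \<le> K \<kappa> b \<tau>" for \<kappa> b
      proof -
        have "2 * I \<kappa> b = (LINT u:{0..1}|lborel. 2 * (4 * u * G (g \<kappa> b \<tau> u)))"
          unfolding I_def by (rule set_integral_mult_right[symmetric])
        then show ?thesis unfolding K_def
          using N_function_Jensen_unit_interval[OF N int2, of \<kappa> b] G0 by (simp add: mult.assoc)
      qed
      have path': "cmod (F (cis b) - F (of_real (1 - \<tau>) * cis (b + \<kappa> * \<tau>))) \<le> \<tau> * I \<kappa> b" if "\<kappa> \<in> {1, -1}" for \<kappa> b
      proof -
        have "(LINT u:{0..1}|lborel. 4 * \<tau> * u * G (g \<kappa> b \<tau> u)) = (LINT u:{0..1}|lborel. \<tau> * (4 * u * G (g \<kappa> b \<tau> u)))"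
          by (simp only: ac_simps)
        also have "\<dots> = \<tau> * I \<kappa> b" unfolding I_def by (rule set_integral_mult_right)
        finally show ?thesis using path[unfolded path_bounded_def, rule_format, OF \<tau> that, of b] by (simp only: g_def)
      qed
      \<comment> \<open>Both halves arrive at the same angle, hence at a common interior point,
        through which the triangle inequality is applied.\<close>
      have apex: "b + s + - \<kappa> * \<tau> = b + \<kappa> * \<tau>" by (simp add: s_def)
      have "cmod (F (cis (b + s)) - F (cis b)) \<le> \<tau> * I \<kappa> b + \<tau> * I (-\<kappa>) (b + s)"
      proof -
        define A where "A = F (of_real (1 - \<tau>) * cis (b + \<kappa> * \<tau>))"
        have "cmod (F (cis b) - A) \<le> \<tau> * I \<kappa> b" unfolding A_def by (rule path') (rule \<kappa>)
        moreover have "cmod (F (cis (b + s)) - A) \<le> \<tau> * I (-\<kappa>) (b + s)"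
          unfolding A_def using path'[of "-\<kappa>" "b + s"] \<kappa> unfolding apex by auto
        moreover have "F (cis (b + s)) - F (cis b) = (F (cis (b + s)) - A) - (F (cis b) - A)" by simp
        ultimately show ?thesis by (smt (verit) norm_triangle_ineq4)
      qed
      \<comment> \<open>Here |s| = 2 \<tau> \<le> 1, so the chord is at least |s| / 2 = \<tau>. This
        cancels the \<tau> in the speed and leaves averages over u, ready for Jensen's
        inequality.\<close>
      moreover have "\<tau> \<le> cmod (cis s - 1)"
        using cmod_cis_minus_1_ge[of s] \<tau> \<kappa> by (auto simp: s_def)
      ultimately have "cmod (F (cis (b + s)) - F (cis b)) / cmod (cis s - 1) \<le> (\<tau> * I \<kappa> b + \<tau> * I (-\<kappa>) (b + s)) / \<tau>"
        using \<tau> by (intro frac_le) (auto simp: I0)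
      also have "\<dots> = I \<kappa> b + I (-\<kappa>) (b + s)" using \<tau> by (simp add: field_simps)
      finally have "\<Phi> (cmod (F (cis (b + s)) - F (cis b)) / cmod (cis s - 1)) \<le> \<Phi> (I \<kappa> b + I (-\<kappa>) (b + s))"
        by (intro N_function_mono[OF N]) auto
      also have "\<dots> \<le> \<Phi> (2 * I \<kappa> b) + \<Phi> (2 * I (-\<kappa>) (b + s))"
        by (intro N_function_add[OF N] I0)
      finally have "D b s \<le> ennreal (\<Phi> (2 * I \<kappa> b)) + ennreal (\<Phi> (2 * I (-\<kappa>) (b + s)))"
        unfolding D_def using N_function_nonneg[OF N] I0 by (simp add: ennreal_plus[symmetric] ennreal_leI del: ennreal_plus)
      also have "\<dots> \<le> ennreal C * (J \<kappa> b \<tau> + 1) + ennreal C * (J (-\<kappa>) (b + s) \<tau> + 1)"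
        by (intro add_mono order_trans[OF IK KJ])
      also have "\<dots> = R \<kappa> b \<tau>"
      proof -
        have two: "x + 1 + (y + 1) = x + y + 2" for x y :: ennreal
          unfolding one_add_one[symmetric] by (simp only: ac_simps)
        show ?thesis unfolding R_def s_def distrib_left[symmetric] two ..
      qed
      finally show ?thesis unfolding s_def .
    qed
    have T: "(\<integral>\<^sup>+b\<in>{0..<2 * pi}. (\<integral>\<^sup>+\<tau>\<in>{0<..1/2}. R \<kappa> b \<tau> \<partial>lborel) \<partial>lborel)
        \<le> ennreal C * (ennreal (4 / (p - 1)) * S + ennreal (2 * pi))" for \<kappa>
    proof -
      have J1: "(\<integral>\<^sup>+b\<in>{0..<2 * pi}. (\<integral>\<^sup>+\<tau>\<in>{0<..1/2}. J \<kappa> b \<tau> \<partial>lborel) \<partial>lborel) \<le> ennreal (2 / (p - 1)) * S" for \<kappa>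
        unfolding J_def g_def S_def by (rule periodic_path_average[OF _ p]) measurable
      \<comment> \<open>The base point of the second half depends on \<tau>. Once b is the inner
        variable, periodicity removes this dependence.\<close>
      have shift: "(\<integral>\<^sup>+b\<in>{0..<2 * pi}. J \<mu> (b + c) \<tau> \<partial>lborel) = (\<integral>\<^sup>+b\<in>{0..<2 * pi}. J \<mu> b \<tau> \<partial>lborel)" for \<mu> c \<tau>
        by (rule nn_integral_periodic_translate[where f="\<lambda>b. J \<mu> b \<tau>"]) (measurable, rule Jper)
      have J2: "(\<integral>\<^sup>+b\<in>{0..<2 * pi}. (\<integral>\<^sup>+\<tau>\<in>{0<..1/2}. J (-\<kappa>) (b + 2 * \<kappa> * \<tau>) \<tau> \<partial>lborel) \<partial>lborel) \<le> ennreal (2 / (p - 1)) * S"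
      proof -
        have "(\<integral>\<^sup>+b\<in>{0..<2 * pi}. (\<integral>\<^sup>+\<tau>\<in>{0<..1/2}. J (-\<kappa>) (b + 2 * \<kappa> * \<tau>) \<tau> \<partial>lborel) \<partial>lborel)
          = (\<integral>\<^sup>+\<tau>\<in>{0<..1/2}. (\<integral>\<^sup>+b\<in>{0..<2 * pi}. J (-\<kappa>) (b + 2 * \<kappa> * \<tau>) \<tau> \<partial>lborel) \<partial>lborel)"
          by (rule set_nn_integral_swap) auto
        also have "\<dots> = (\<integral>\<^sup>+b\<in>{0..<2 * pi}. (\<integral>\<^sup>+\<tau>\<in>{0<..1/2}. J (-\<kappa>) b \<tau> \<partial>lborel) \<partial>lborel)"
          unfolding shift by (rule set_nn_integral_swap[symmetric]) auto
        finally show ?thesis using J1[of "-\<kappa>"] by simp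
      qed
      have "(\<integral>\<^sup>+\<tau>\<in>{0<..1/2}. R \<kappa> b \<tau> \<partial>lborel) = ennreal C * ((\<integral>\<^sup>+\<tau>\<in>{0<..1/2}. J \<kappa> b \<tau> \<partial>lborel) + (\<integral>\<^sup>+\<tau>\<in>{0<..1/2}. J (-\<kappa>) (b + 2 * \<kappa> * \<tau>) \<tau> \<partial>lborel) + 1)" for b
      proof -
        have "(\<integral>\<^sup>+\<tau>\<in>{0<..1/2}. R \<kappa> b \<tau> \<partial>lborel) = (\<integral>\<^sup>+\<tau>. ennreal C * (J \<kappa> b \<tau> * indicator {0<..1/2} \<tau> + J (-\<kappa>) (b + 2 * \<kappa> * \<tau>) \<tau> * indicator {0<..1/2} \<tau> + 2 * indicator {0<..1/2} \<tau>) \<partial>lborel)"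
          unfolding R_def by (intro nn_integral_cong) (auto split: split_indicator)
        also have "\<dots> = ennreal C * ((\<integral>\<^sup>+\<tau>\<in>{0<..1/2}. J \<kappa> b \<tau> \<partial>lborel) + (\<integral>\<^sup>+\<tau>\<in>{0<..1/2}. J (-\<kappa>) (b + 2 * \<kappa> * \<tau>) \<tau> \<partial>lborel) + 2 * ennreal (1/2))"
          by (simp add: nn_integral_cmult nn_integral_add)
        also have "2 * ennreal (1/2) = 1"
        proof -
          have "ennreal (2 * (1/2)) = ennreal 2 * ennreal (1/2)" by (rule ennreal_mult) auto
          then show ?thesis by (simp only: ennreal_numeral) simp
        qed
        finally show ?thesis .
      qed
      then have "(\<integral>\<^sup>+b\<in>{0..<2 * pi}. (\<integral>\<^sup>+\<tau>\<in>{0<..1/2}. R \<kappa> b \<tau> \<partial>lborel) \<partial>lborel)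
        = (\<integral>\<^sup>+b. ennreal C * ((\<integral>\<^sup>+\<tau>\<in>{0<..1/2}. J \<kappa> b \<tau> \<partial>lborel) * indicator {0..<2 * pi} b + (\<integral>\<^sup>+\<tau>\<in>{0<..1/2}. J (-\<kappa>) (b + 2 * \<kappa> * \<tau>) \<tau> \<partial>lborel) * indicator {0..<2 * pi} b + indicator {0..<2 * pi} b) \<partial>lborel)"
        by (intro nn_integral_cong) (auto split: split_indicator)
      also have "\<dots> = ennreal C * ((\<integral>\<^sup>+b\<in>{0..<2 * pi}. (\<integral>\<^sup>+\<tau>\<in>{0<..1/2}. J \<kappa> b \<tau> \<partial>lborel) \<partial>lborel)
         + (\<integral>\<^sup>+b\<in>{0..<2 * pi}. (\<integral>\<^sup>+\<tau>\<in>{0<..1/2}. J (-\<kappa>) (b + 2 * \<kappa> * \<tau>) \<tau> \<partial>lborel) \<partial>lborel) + ennreal (2 * pi))"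
        by (simp add: nn_integral_cmult nn_integral_add)
      also have "\<dots> \<le> ennreal C * (ennreal (2 / (p - 1)) * S + ennreal (2 / (p - 1)) * S + ennreal (2 * pi))"
        by (intro mult_left_mono add_mono J1 J2) auto
      also have "ennreal (2 / (p - 1)) * S + ennreal (2 / (p - 1)) * S = ennreal (4 / (p - 1)) * S"
        using p by (simp add: distrib_right[symmetric] ennreal_plus[symmetric] del: ennreal_plus)
      finally show ?thesis .
    qed
    \<comment> \<open>For far pairs the numerator is at most 2 and the chord at least 1/2, so the
      quotient is at most 4.\<close>
    have D4: "D b s \<le> ennreal (\<Phi> 4)" if "1 \<le> \<bar>s\<bar>" "\<bar>s\<bar> \<le> pi" for b s
    proof -
      have "cmod (F (cis (b + s)) - F (cis b)) \<le> 2"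
        using F1[of "cis (b + s)"] F1[of "cis b"] norm_triangle_ineq4[of "F (cis (b + s))" "F (cis b)"] by simp
      then have "cmod (F (cis (b + s)) - F (cis b)) / cmod (cis s - 1) \<le> 2 / (1 / 2)"
        using cmod_cis_minus_1_ge_half[OF that] by (intro frac_le) auto
      then show ?thesis unfolding D_def by (intro ennreal_leI N_function_mono[OF N]) auto
    qed
    have bound: "D b s * indicator {-pi..<pi} s \<le> ennreal (\<Phi> 4) * indicator {-pi..<pi} s
      + R 1 b (s / 2) * indicator {0<..1/2} (s / 2) + R (-1) b (- s / 2) * indicator {0<..1/2} (- s / 2)" for b s
    proof -
      consider "s = 0" | "0 < s" "s \<le> 1" | "-1 \<le> s" "s < 0" | "1 \<le> \<bar>s\<bar>" by linarith
      then show ?thesis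
      proof cases
        case 1 then show ?thesis by (simp add: D_def N_function_0[OF N])
      next
        case 2
        then have "D b s \<le> R 1 b (s / 2)" using DR[of "s / 2" 1 b] by simp
        then show ?thesis using 2 by (auto split: split_indicator intro: add_increasing add_increasing2)
      next
        case 3
        then have "D b s \<le> R (-1) b (- s / 2)" using DR[of "- s / 2" "-1" b] by simp
        then show ?thesis using 3 by (auto split: split_indicator intro: add_increasing)
      next
        case 4
        then show ?thesis using D4[of s b] by (auto split: split_indicator intro: add_increasing2)
      qed
    qed
    have "(\<integral>\<^sup>+s\<in>{-pi..<pi}. D b s \<partial>lborel) \<le> ennreal (2 * pi * \<Phi> 4)
        + 2 * (\<integral>\<^sup>+\<tau>\<in>{0<..1/2}. R 1 b \<tau> \<partial>lborel) + 2 * (\<integral>\<^sup>+\<tau>\<in>{0<..1/2}. R (-1) b \<tau> \<partial>lborel)" for b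
    proof -
      have "(\<integral>\<^sup>+s\<in>{-pi..<pi}. D b s \<partial>lborel) \<le> (\<integral>\<^sup>+s. ennreal (\<Phi> 4) * indicator {-pi..<pi} s
        + R 1 b (s / 2) * indicator {0<..1/2} (s / 2) + R (-1) b (- s / 2) * indicator {0<..1/2} (- s / 2) \<partial>lborel)"
        by (intro nn_integral_mono bound)
      also have "\<dots> = (\<integral>\<^sup>+s. ennreal (\<Phi> 4) * indicator {-pi..<pi} s \<partial>lborel)
        + (\<integral>\<^sup>+s. R 1 b (s / 2) * indicator {0<..1/2} (s / 2) \<partial>lborel) + (\<integral>\<^sup>+s. R (-1) b (- s / 2) * indicator {0<..1/2} (- s / 2) \<partial>lborel)"
        by (simp add: nn_integral_add)
      also have "(\<integral>\<^sup>+s. ennreal (\<Phi> 4) * indicator {-pi..<pi} s \<partial>lborel) = ennreal (2 * pi * \<Phi> 4)"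
        using \<Phi>4 by (subst nn_integral_cmult_indicator) (auto simp: ennreal_mult'[symmetric] mult.commute)
      also have "(\<integral>\<^sup>+s. R 1 b (s / 2) * indicator {0<..1/2} (s / 2) \<partial>lborel) = 2 * (\<integral>\<^sup>+\<tau>\<in>{0<..1/2}. R 1 b \<tau> \<partial>lborel)"
        using nn_integral_real_affine[of "\<lambda>s. R 1 b (s / 2) * indicator {0<..1/2} (s / 2)" 2 0] by simp
      also have "(\<integral>\<^sup>+s. R (-1) b (- s / 2) * indicator {0<..1/2} (- s / 2) \<partial>lborel) = 2 * (\<integral>\<^sup>+\<tau>\<in>{0<..1/2}. R (-1) b \<tau> \<partial>lborel)"
        using nn_integral_real_affine[of "\<lambda>s. R (-1) b (- s / 2) * indicator {0<..1/2} (- s / 2)" "-2" 0] by simp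
      finally show ?thesis .
    qed
    then have "(\<integral>\<^sup>+b\<in>{0..<2 * pi}. (\<integral>\<^sup>+s\<in>{-pi..<pi}. D b s \<partial>lborel) \<partial>lborel)
      \<le> (\<integral>\<^sup>+b\<in>{0..<2 * pi}. (ennreal (2 * pi * \<Phi> 4)
        + 2 * (\<integral>\<^sup>+\<tau>\<in>{0<..1/2}. R 1 b \<tau> \<partial>lborel) + 2 * (\<integral>\<^sup>+\<tau>\<in>{0<..1/2}. R (-1) b \<tau> \<partial>lborel)) \<partial>lborel)"
      by (intro nn_integral_mono mult_right_mono) auto
    also have "\<dots> = (\<integral>\<^sup>+b. ennreal (2 * pi * \<Phi> 4) * indicator {0..<2 * pi} b
        + 2 * ((\<integral>\<^sup>+\<tau>\<in>{0<..1/2}. R 1 b \<tau> \<partial>lborel) * indicator {0..<2 * pi} b) + 2 * ((\<integral>\<^sup>+\<tau>\<in>{0<..1/2}. R (-1) b \<tau> \<partial>lborel) * indicator {0..<2 * pi} b) \<partial>lborel)"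
      by (intro nn_integral_cong) (auto split: split_indicator)
    also have "\<dots> = ennreal (2 * pi * \<Phi> 4) * ennreal (2 * pi)
        + 2 * (\<integral>\<^sup>+b\<in>{0..<2 * pi}. (\<integral>\<^sup>+\<tau>\<in>{0<..1/2}. R 1 b \<tau> \<partial>lborel) \<partial>lborel) + 2 * (\<integral>\<^sup>+b\<in>{0..<2 * pi}. (\<integral>\<^sup>+\<tau>\<in>{0<..1/2}. R (-1) b \<tau> \<partial>lborel) \<partial>lborel)"
      by (simp add: nn_integral_add nn_integral_cmult)
    also have "\<dots> \<le> ennreal (2 * pi * \<Phi> 4) * ennreal (2 * pi)
        + 2 * (ennreal C * (ennreal (4 / (p - 1)) * S + ennreal (2 * pi))) + 2 * (ennreal C * (ennreal (4 / (p - 1)) * S + ennreal (2 * pi)))"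
      by (intro add_mono mult_left_mono T order_refl) auto
    also have "\<dots> = ennreal c1 + ennreal c2 * S"
    proof (cases S)
      case (real x)
      then show ?thesis using C p \<Phi>4
        by (simp add: c1_def c2_def ennreal_mult'[symmetric] ennreal_plus[symmetric] power2_eq_square algebra_simps
            del: ennreal_plus flip: ennreal_numeral)
    next
      case top
      \<comment> \<open>If S is infinite, so are both sides; this needs a positive coefficient
        because 0 times \<open>top\<close> is 0.\<close>
      have "0 < c2" using C p by (auto simp: c2_def)
      then show ?thesis using top C p by (simp add: ennreal_mult_top)
    qed
    also have "\<dots> \<le> ennreal (c1 + c2) * (S + 1)"
    proof -
      have "ennreal c1 * 1 + ennreal c2 * S \<le> ennreal c1 * (S + 1) + ennreal c2 * (S + 1)"
        by (intro add_mono mult_left_mono) auto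
      then show ?thesis using c by (simp add: distrib_right)
    qed
    finally show "quotient_modular \<Phi> F \<le> ennreal (c1 + c2) * ((\<integral>\<^sup>+z\<in>ball 0 1. ennreal (\<Phi> (G z)) \<partial>lborel) + 1)"
      by (simp add: quotient_modular_def D_def S_def P_def)
  qed
qed

section \<open>Mollification of the weak gradient\<close>

text \<open>The functions \<open>exp (- 1 / t) / t ^ n\<close>, extended by \<open>0\<close>, are closed under differentiation
  up to linear combinations; this yields a smooth bump without any theory of smooth functions.\<close>

definition exp_flat :: "nat \<Rightarrow> real \<Rightarrow> real" where
  "exp_flat n t = (if 0 < t then exp (- 1 / t) / t ^ n else 0)"

lemma exp_flat_tendsto_0: "(exp_flat n \<longlongrightarrow> 0) (at_right 0)"
proof -
  have "((\<lambda>t. (inverse t) ^ n / exp (inverse t)) \<longlongrightarrow> 0) (at_right (0::real))"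
    by (rule filterlim_compose[OF tendsto_power_div_exp_0 filterlim_inverse_at_top_right])
  moreover have "eventually (\<lambda>t. (inverse t) ^ n / exp (inverse t) = exp_flat n t) (at_right 0)"
    by (auto simp: eventually_at_filter exp_flat_def exp_minus field_simps power_inverse)
  ultimately show ?thesis by (rule Lim_transform_eventually)
qed

lemma has_field_derivative_exp_flat:
  "(exp_flat n has_field_derivative (exp_flat (n + 2) t - real n * exp_flat (n + 1) t)) (at t)"
proof -
  consider "0 < t" | "t < 0" | "t = 0" by linarith
  then show ?thesis
  proof cases
    case 1
    have "((\<lambda>t. exp (- 1 / t) / t ^ n) has_field_derivative
        (exp (- 1 / t) * (1 / t\<^sup>2) * t ^ n - exp (- 1 / t) * (real n * t ^ (n - 1))) / (t ^ n * t ^ n)) (at t)"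
      using 1 by (auto intro!: derivative_eq_intros simp: power2_eq_square)
    also have "(exp (- 1 / t) * (1 / t\<^sup>2) * t ^ n - exp (- 1 / t) * (real n * t ^ (n - 1))) / (t ^ n * t ^ n)
       = exp_flat (n + 2) t - real n * exp_flat (n + 1) t"
    proof (cases n)
      case 0 then show ?thesis using 1 by (simp add: exp_flat_def power2_eq_square)
    next
      case (Suc m)
      then show ?thesis using 1 by (simp add: exp_flat_def field_simps power_add power2_eq_square)
    qed
    finally show ?thesis
      by (rule has_field_derivative_transform_within_open[where S="{0<..}"]) (use 1 in \<open>auto simp: exp_flat_def\<close>)
  next
    case 2
    have "((\<lambda>t. 0) has_field_derivative 0) (at t)" by simp
    then have "(exp_flat n has_field_derivative 0) (at t)"
      by (rule has_field_derivative_transform_within_open[where S="{..<0}"]) (use 2 in \<open>auto simp: exp_flat_def\<close>)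
    then show ?thesis using 2 by (simp add: exp_flat_def)
  next
    case 3
    \<comment> \<open>For h > 0 the difference quotient at 0 is \<open>exp_flat (Suc n) h\<close>,
      so differentiability at 0 is the limit already known, with the exponent raised by one.\<close>
    have "((\<lambda>h. exp_flat n h / h) \<longlongrightarrow> 0) (at 0)"
      unfolding filterlim_at_split
    proof
      show "((\<lambda>h. exp_flat n h / h) \<longlongrightarrow> 0) (at_left 0)"
        by (rule Lim_transform_eventually[OF tendsto_const]) (auto simp: eventually_at_filter exp_flat_def)
      show "((\<lambda>h. exp_flat n h / h) \<longlongrightarrow> 0) (at_right 0)"
        by (rule Lim_transform_eventually[OF exp_flat_tendsto_0[of "Suc n"]])
           (auto simp: eventually_at_filter exp_flat_def field_simps)
    qed
    then show ?thesis using 3 by (simp add: has_field_derivative_iff exp_flat_def)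
  qed
qed

lemma continuous_on_exp_flat [continuous_intros]:
  assumes "continuous_on S f" shows "continuous_on S (\<lambda>x. exp_flat n (f x))"
proof (rule continuous_on_compose2[OF _ assms])
  show "continuous_on UNIV (exp_flat n)"
    by (intro continuous_at_imp_continuous_on ballI DERIV_isCont[OF has_field_derivative_exp_flat])
qed auto

text \<open>An algebra that contains the bump together with everything its derivatives produce.
  Since it is closed under directional derivatives, one induction on the order gives all
  \<open>C_k\<close>. In use, k is 1 / e^2 for a bump of radius e.\<close>

inductive bump_class :: "'a::euclidean_space \<Rightarrow> real \<Rightarrow> ('a \<Rightarrow> real) \<Rightarrow> bool" for a k where
  bump: "bump_class a k (\<lambda>x. exp_flat n (1 - k * ((x - a) \<bullet> (x - a))))"
| const: "bump_class a k (\<lambda>x. c)"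
| inner: "bump_class a k (\<lambda>x. x \<bullet> v)"
| add: "bump_class a k f \<Longrightarrow> bump_class a k g \<Longrightarrow> bump_class a k (\<lambda>x. f x + g x)"
| mult: "bump_class a k f \<Longrightarrow> bump_class a k g \<Longrightarrow> bump_class a k (\<lambda>x. f x * g x)"

lemma has_derivative_bump:
  fixes a :: "'a::euclidean_space"
  shows "((\<lambda>x. exp_flat n (1 - k * ((x - a) \<bullet> (x - a)))) has_derivative
    (\<lambda>v. (exp_flat (n + 2) (1 - k * ((x - a) \<bullet> (x - a))) - real n * exp_flat (n + 1) (1 - k * ((x - a) \<bullet> (x - a))))
       * (- 2 * k * ((x - a) \<bullet> v)))) (at x)"
proof -
  have "((\<lambda>x. 1 - k * ((x - a) \<bullet> (x - a))) has_derivative (\<lambda>v. - 2 * k * ((x - a) \<bullet> v))) (at x)"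
    by (auto intro!: derivative_eq_intros simp: algebra_simps inner_commute)
  from has_derivative_compose[OF this has_field_derivative_imp_has_derivative[OF has_field_derivative_exp_flat]]
  show ?thesis by simp
qed

lemma bump_class_has_derivative:
  assumes "bump_class a k f"
  shows "\<exists>f'. (\<forall>x. (f has_derivative f' x) (at x)) \<and> (\<forall>v. bump_class a k (\<lambda>x. f' x v))"
  using assms
proof induction
  case (bump n)
  let ?e = "\<lambda>n x. exp_flat n (1 - k * ((x - a) \<bullet> (x - a)))"
  define f' where "f' = (\<lambda>x v. (?e (n + 2) x - real n * ?e (n + 1) x) * (- 2 * k * ((x - a) \<bullet> v)))"
  have "bump_class a k (\<lambda>x. (?e (n + 2) x + (- real n) * ?e (n + 1) x) * ((- 2 * k) * (x \<bullet> v + - (a \<bullet> v))))" for v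
    by (intro bump_class.intros)
  then have "bump_class a k (\<lambda>x. f' x v)" for v by (simp add: f'_def inner_diff_left)
  moreover have "(?e n has_derivative f' x) (at x)" for x unfolding f'_def by (rule has_derivative_bump)
  ultimately show ?case by blast
next
  case (const c)
  show ?case by (intro exI[of _ "\<lambda>x v. 0"]) (auto intro: bump_class.intros)
next
  case (inner v)
  show ?case by (intro exI[of _ "\<lambda>x w. w \<bullet> v"]) (auto intro!: bump_class.intros derivative_eq_intros)
next
  case (add f g)
  then obtain f' g' where f: "\<And>x. (f has_derivative f' x) (at x)" "\<And>v. bump_class a k (\<lambda>x. f' x v)"
    and g: "\<And>x. (g has_derivative g' x) (at x)" "\<And>v. bump_class a k (\<lambda>x. g' x v)" by blast
  show ?case
    by (intro exI[of _ "\<lambda>x v. f' x v + g' x v"]) (auto intro!: bump_class.intros f g has_derivative_add)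
next
  case (mult f g)
  then obtain f' g' where f: "\<And>x. (f has_derivative f' x) (at x)" "\<And>v. bump_class a k (\<lambda>x. f' x v)"
    and g: "\<And>x. (g has_derivative g' x) (at x)" "\<And>v. bump_class a k (\<lambda>x. g' x v)" by blast
  show ?case
    by (intro exI[of _ "\<lambda>x v. f x * g' x v + f' x v * g x"])
       (auto intro!: bump_class.add bump_class.mult f g mult.hyps has_derivative_mult)
qed

lemma bump_class_C_k: "bump_class a k f \<Longrightarrow> C_k n f"
proof (induction n arbitrary: f)
  case 0
  from bump_class_has_derivative[OF 0] show ?case
    by (auto intro!: continuous_at_imp_continuous_on intro: has_derivative_continuous)
next
  case (Suc n)
  from bump_class_has_derivative[OF Suc.prems] obtain f' where
    f': "\<And>x. (f has_derivative f' x) (at x)" "\<And>v. bump_class a k (\<lambda>x. f' x v)" by blast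
  have "frechet_derivative f (at x) = f' x" for x
    using frechet_derivative_at[OF f'(1)] by simp
  then show ?case using f' Suc.IH by (auto simp: differentiable_def)
qed

text \<open>The standard mollifier of radius e, not normalised. The centre is an argument of its own
  because it will travel along a path.\<close>

definition bump :: "real \<Rightarrow> 'a::euclidean_space \<Rightarrow> 'a \<Rightarrow> real" where
  "bump e a w = exp_flat 0 (1 - (1 / e\<^sup>2) * ((w - a) \<bullet> (w - a)))"

lemma bump_nonneg: "0 \<le> bump e a w" and bump_le_1: "bump e a w \<le> 1"
  by (auto simp: bump_def exp_flat_def)

lemma bump_pos_iff: "0 < e \<Longrightarrow> 0 < bump e a w \<longleftrightarrow> w \<in> ball a e"
proof -
  assume e: "0 < e"
  have "0 < bump e a w \<longleftrightarrow> (norm (w - a))\<^sup>2 < e\<^sup>2"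
    using e by (simp add: bump_def exp_flat_def power2_norm_eq_inner[symmetric] field_simps)
  also have "\<dots> \<longleftrightarrow> norm (w - a) < e"
    using e power2_less_imp_less[of "norm (w - a)" e] by (auto intro: power_strict_mono)
  finally show ?thesis by (simp add: dist_norm norm_minus_commute)
qed

lemma bump_eq_0: "0 < e \<Longrightarrow> w \<notin> ball a e \<Longrightarrow> bump e a w = 0"
  using bump_pos_iff[of e a w] bump_nonneg[of e a w] by auto

lemma test_function_bump:
  assumes "0 < e" "cball a e \<subseteq> U"
  shows "test_function U (bump e a)"
proof -
  have "{x. bump e a x \<noteq> 0} = ball a e"
    using bump_pos_iff[OF assms(1), of a] bump_eq_0[OF assms(1), of _ a] by force
  moreover have "C_k k (bump e a)" for k
    unfolding bump_def[abs_def] by (rule bump_class_C_k[OF bump_class.bump])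
  ultimately show ?thesis using assms by (simp add: test_function_def closure_ball)
qed

lemma frechet_derivative_bump:
  "frechet_derivative (bump e a) (at w) v = exp_flat 2 (1 - (1 / e\<^sup>2) * ((w - a) \<bullet> (w - a))) * (- 2 * (1 / e\<^sup>2) * ((w - a) \<bullet> v))"
  using frechet_derivative_at[OF has_derivative_bump[of 0 "1 / e\<^sup>2" a w]]
  unfolding bump_def[abs_def] by (simp add: fun_eq_iff numeral_2_eq_2)

lemma continuous_on_bump [continuous_intros]:
  "continuous_on S f \<Longrightarrow> continuous_on S g \<Longrightarrow> continuous_on S (\<lambda>x. bump e (f x) (g x))"
  unfolding bump_def by (intro continuous_intros)

text \<open>The bump depends on the difference of centre and variable only, so moving the centre is
  minus moving the variable. This turns the time derivative along a path into the derivative of a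
  test function, the form in which a weak derivative can be used.\<close>

lemma bump_path_derivative:
  assumes "(\<gamma> has_vector_derivative \<gamma>') (at u)"
  shows "((\<lambda>u. bump e (\<gamma> u) w) has_vector_derivative - frechet_derivative (bump e (\<gamma> u)) (at w) \<gamma>') (at u)"
proof -
  have sym: "bump e a w = bump e w a" for a
    by (simp add: bump_def inner_commute inner_diff_left inner_diff_right algebra_simps)
  have "(bump e w has_derivative (\<lambda>v. exp_flat 2 (1 - (1 / e\<^sup>2) * ((\<gamma> u - w) \<bullet> (\<gamma> u - w))) * (- 2 * (1 / e\<^sup>2) * ((\<gamma> u - w) \<bullet> v)))) (at (\<gamma> u))"
    using has_derivative_bump[of 0 "1 / e\<^sup>2" w "\<gamma> u"] unfolding bump_def[abs_def] by (simp add: numeral_2_eq_2)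
  from has_derivative_compose[OF assms[unfolded has_vector_derivative_def] this]
  have "((\<lambda>u. bump e w (\<gamma> u)) has_derivative (\<lambda>r. exp_flat 2 (1 - (1 / e\<^sup>2) * ((\<gamma> u - w) \<bullet> (\<gamma> u - w))) * (- 2 * (1 / e\<^sup>2) * ((\<gamma> u - w) \<bullet> (r *\<^sub>R \<gamma>'))))) (at u)" .
  moreover have "(\<lambda>r. exp_flat 2 (1 - (1 / e\<^sup>2) * ((\<gamma> u - w) \<bullet> (\<gamma> u - w))) * (- 2 * (1 / e\<^sup>2) * ((\<gamma> u - w) \<bullet> (r *\<^sub>R \<gamma>'))))
     = (\<lambda>r. r *\<^sub>R (- frechet_derivative (bump e (\<gamma> u)) (at w) \<gamma>'))"
  proof -
    have "(\<gamma> u - w) \<bullet> (\<gamma> u - w) = (w - \<gamma> u) \<bullet> (w - \<gamma> u)"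
      by (simp add: inner_commute inner_diff_left inner_diff_right algebra_simps)
    moreover have "(\<gamma> u - w) \<bullet> v = - ((w - \<gamma> u) \<bullet> v)" for v by (simp add: inner_diff_left)
    ultimately show ?thesis
      by (simp add: frechet_derivative_bump fun_eq_iff)
  qed
  ultimately show ?thesis by (simp add: has_vector_derivative_def sym)
qed

text \<open>The difference of the two endpoint averages is the integral over u of the derivative of
  the average centred at \<open>\<gamma> u\<close>. After Fubini each inner integral pairs h with a
  derivative of a bump supported in the disc, and the weak derivative moves this onto
  \<open>Df\<close>, which g dominates.\<close>

lemma mollified_path_estimate:
  fixes h :: "complex \<Rightarrow> complex"
  assumes h: "continuous_on (ball 0 1) h" "\<And>z. z \<in> ball 0 1 \<Longrightarrow> cmod (h z) \<le> 1"
    and wd: "has_weak_derivative h Df (ball 0 1)"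
    and g [measurable]: "g \<in> borel_measurable borel" and g0: "\<And>z. 0 \<le> g z" and gi: "integrable lborel g"
    and Dg: "AE w in lborel. w \<in> ball 0 1 \<longrightarrow> (\<forall>v. cmod (blinfun_apply (Df w) v) \<le> cmod v * g w)"
    and e: "0 < e"
    and \<gamma>: "\<And>u. (\<gamma> has_vector_derivative \<gamma>' u) (at u)" "continuous_on UNIV \<gamma>'"
    and ball: "\<And>u. u \<in> {0..1} \<Longrightarrow> cball (\<gamma> u) e \<subseteq> ball 0 1"
  shows "cmod ((LINT w|lborel. bump e (\<gamma> 1) w *\<^sub>R (indicator (ball 0 1) w *\<^sub>R h w)) - (LINT w|lborel. bump e (\<gamma> 0) w *\<^sub>R (indicator (ball 0 1) w *\<^sub>R h w)))
    \<le> (LINT u:{0..1}|lborel. cmod (\<gamma>' u) * (LINT w|lborel. bump e (\<gamma> u) w * g w))"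
proof -
  define H where "H = (\<lambda>w. indicator (ball 0 1) w *\<^sub>R h w)"
  define k where "k = (\<lambda>u w. - frechet_derivative (bump e (\<gamma> u)) (at w) (\<gamma>' u))"
  have kdef: "k u w = exp_flat 2 (1 - (1 / e\<^sup>2) * ((w - \<gamma> u) \<bullet> (w - \<gamma> u))) * (2 * (1 / e\<^sup>2) * ((w - \<gamma> u) \<bullet> \<gamma>' u))" for u w
    unfolding k_def frechet_derivative_bump by simp
  have \<gamma>c: "continuous_on UNIV \<gamma>"
    by (intro continuous_at_imp_continuous_on ballI has_vector_derivative_continuous[OF \<gamma>(1)])
  have [measurable]: "H \<in> borel_measurable borel"
    unfolding H_def by (rule borel_measurable_continuous_on_indicator[OF _ h(1)]) auto
  have kc: "continuous_on UNIV (\<lambda>(u, w). k u w)"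
    unfolding kdef case_prod_beta
    by (intro continuous_intros continuous_on_compose2[OF \<gamma>c] continuous_on_compose2[OF \<gamma>(2)]) auto
  have kc1: "continuous_on S (\<lambda>u. k u w)" for S w
    using continuous_on_compose2[OF kc, of S "\<lambda>u. (u, w)"] by (simp add: continuous_on_Pair)
  have [measurable]: "(\<lambda>(u, w). k u w) \<in> borel_measurable (borel \<Otimes>\<^sub>M borel)"
    unfolding borel_prod by (rule borel_measurable_continuous_onI[OF kc])
  have "continuous_on UNIV (\<lambda>(u, w). bump e (\<gamma> u) w)"
    unfolding case_prod_beta
    by (intro continuous_intros continuous_on_compose2[OF \<gamma>c]) auto
  then have [measurable]: "(\<lambda>(u, w). bump e (\<gamma> u) w) \<in> borel_measurable (borel \<Otimes>\<^sub>M borel)"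
    unfolding borel_prod by (rule borel_measurable_continuous_onI)
  have [measurable]: "bump e (\<gamma> u) \<in> borel_measurable borel" for u
    by (intro borel_measurable_continuous_onI continuous_intros)
  have [measurable]: "\<gamma>' \<in> borel_measurable borel"
    by (rule borel_measurable_continuous_onI[OF \<gamma>(2)])
  have "compact ((\<lambda>(u, w). k u w) ` ({0..1} \<times> cball 0 1))"
    by (intro compact_continuous_image continuous_on_subset[OF kc] compact_Times) auto
  then obtain B where B: "\<And>u w. u \<in> {0..1} \<Longrightarrow> w \<in> cball 0 1 \<Longrightarrow> \<bar>k u w\<bar> \<le> B"
    by (force dest!: compact_imp_bounded simp: bounded_iff)
  define f where "f = (\<lambda>u w. indicator {0..1} u *\<^sub>R (k u w *\<^sub>R H w))"
  have int_bump: "integrable lborel (\<lambda>w. bump e (\<gamma> u) w *\<^sub>R H w)" for u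
  proof (rule integrableI_bounded_set[where A="ball 0 1" and B=1])
    show "AE w in lborel. w \<in> ball 0 1 \<longrightarrow> norm (bump e (\<gamma> u) w *\<^sub>R H w) \<le> 1"
      using h(2) bump_nonneg[of e "\<gamma> u"] bump_le_1[of e "\<gamma> u"] by (intro AE_I2) (auto simp: H_def intro!: mult_le_one)
    show "emeasure lborel (ball (0::complex) 1) < \<infinity>" by (rule emeasure_lborel_ball_finite)
    show "(\<lambda>w. bump e (\<gamma> u) w *\<^sub>R H w) \<in> borel_measurable lborel" by measurable
  qed (auto simp: H_def)
  have fi: "integrable (lborel \<Otimes>\<^sub>M lborel) (\<lambda>(u, w). f u w)"
  proof (rule integrableI_bounded_set[where A="{0..1} \<times> ball 0 1" and B=B])
    show "{0..1} \<times> ball 0 1 \<in> sets (lborel \<Otimes>\<^sub>M lborel :: (real \<times> complex) measure)" by auto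
    show "(\<lambda>(u, w). f u w) \<in> borel_measurable (lborel \<Otimes>\<^sub>M lborel)" unfolding f_def by measurable
    show "emeasure (lborel \<Otimes>\<^sub>M lborel) ({0..1::real} \<times> ball (0::complex) 1) < \<infinity>"
    proof -
      have "emeasure (lborel \<Otimes>\<^sub>M lborel) ({0..1::real} \<times> ball (0::complex) 1) = emeasure lborel {0..1::real} * emeasure lborel (ball (0::complex) 1)"
        by (rule lborel.emeasure_pair_measure_Times) auto
      also have "\<dots> = emeasure lborel (ball (0::complex) 1)" by simp
      also have "\<dots> < \<infinity>" by (rule emeasure_lborel_ball_finite)
      finally show ?thesis .
    qed
    show "AE x in lborel \<Otimes>\<^sub>M lborel. x \<in> {0..1} \<times> ball 0 1 \<longrightarrow> norm (case x of (u, w) \<Rightarrow> f u w) \<le> B"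
    proof (intro AE_I2 impI)
      fix x :: "real \<times> complex" assume "x \<in> {0..1} \<times> ball 0 1"
      then obtain u w where x: "x = (u, w)" "u \<in> {0..1}" "w \<in> ball 0 1" by auto
      have "norm (f u w) = \<bar>k u w\<bar> * cmod (h w)" using x by (simp add: f_def H_def)
      also have "\<dots> \<le> B * 1" using x B[of u w] h(2)[of w] by (intro mult_mono) auto
      finally show "norm (case x of (u, w) \<Rightarrow> f u w) \<le> B" by (simp add: x)
    qed
    show "AE x in lborel \<Otimes>\<^sub>M lborel. x \<notin> {0..1} \<times> ball 0 1 \<longrightarrow> (case x of (u, w) \<Rightarrow> f u w) = 0"
      by (intro AE_I2) (auto simp: f_def H_def indicator_def)
  qed
  have ftc: "(LINT u|lborel. f u w) = (bump e (\<gamma> 1) w - bump e (\<gamma> 0) w) *\<^sub>R H w" for w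
  proof -
    have "(LINT u|lborel. f u w) = (LINT u|lborel. (indicator {0..1} u *\<^sub>R k u w) *\<^sub>R H w)"
      unfolding f_def by simp
    also have "\<dots> = (LINT u|lborel. indicator {0..1} u *\<^sub>R k u w) *\<^sub>R H w"
    proof (rule integral_scaleR_left)
      show "integrable lborel (\<lambda>u. indicator {0..1} u *\<^sub>R k u w)" if "H w \<noteq> 0"
        using borel_integrable_atLeastAtMost'[OF kc1[of "{0..1}" w]] by (simp add: set_integrable_def)
    qed
    also have "(LINT u|lborel. indicator {0..1} u *\<^sub>R k u w) = bump e (\<gamma> 1) w - bump e (\<gamma> 0) w"
      by (rule integral_FTC_atLeastAtMost[OF _ _ kc1])
         (auto simp: k_def intro!: has_vector_derivative_at_within[OF bump_path_derivative[OF \<gamma>(1)]]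
           simp del: scaleR_minus_left)
    finally show ?thesis .
  qed
  define m where "m = (\<lambda>u. LINT w|lborel. bump e (\<gamma> u) w * g w)"
  have [measurable]: "m \<in> borel_measurable borel" unfolding m_def by measurable
  have bgi: "integrable lborel (\<lambda>w. bump e (\<gamma> u) w * g w)" for u
    by (rule Bochner_Integration.integrable_bound[OF gi])
       (use bump_nonneg[of e "\<gamma> u"] bump_le_1[of e "\<gamma> u"] g0 in \<open>auto intro!: AE_I2 mult_left_le_one_le simp: abs_mult\<close>)
  have m0: "0 \<le> m u" for u
    unfolding m_def using bump_nonneg[of e "\<gamma> u"] g0 by (intro integral_nonneg_AE AE_I2) auto
  have mB: "m u \<le> integral\<^sup>L lborel g" for u
    unfolding m_def using bump_nonneg[of e "\<gamma> u"] bump_le_1[of e "\<gamma> u"] g0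
    by (intro integral_mono[OF bgi gi] mult_left_le_one_le) auto
  have inner: "cmod (LINT w|lborel. f u w) \<le> cmod (\<gamma>' u) * m u" if u: "u \<in> {0..1}" for u
  proof -
    have tf: "test_function (ball 0 1) (bump e (\<gamma> u))"
      by (rule test_function_bump[OF e ball[OF u]])
    have "(LINT w|lborel. f u w) = - (LINT w|lborel. indicator (ball 0 1) w *\<^sub>R (frechet_derivative (bump e (\<gamma> u)) (at w) (\<gamma>' u) *\<^sub>R h w))"
      using u by (simp add: f_def H_def k_def Bochner_Integration.integral_minus[symmetric] mult.commute del: Bochner_Integration.integral_minus)
    also have "\<dots> = - (LINT w|lebesgue. indicator (ball 0 1) w *\<^sub>R (frechet_derivative (bump e (\<gamma> u)) (at w) (\<gamma>' u) *\<^sub>R h w))"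
    proof -
      have "(\<lambda>w. - (k u w *\<^sub>R H w)) \<in> borel_measurable lborel" by measurable
      then have "(\<lambda>w. indicator (ball 0 1) w *\<^sub>R (frechet_derivative (bump e (\<gamma> u)) (at w) (\<gamma>' u) *\<^sub>R h w)) \<in> borel_measurable lborel"
        by (simp add: k_def H_def mult.commute)
      then show ?thesis by (subst integral_completion) auto
    qed
    \<comment> \<open>The defining identity of the weak derivative, for the test function
      \<open>bump e (\<gamma> u)\<close> and the direction \<open>\<gamma>' u\<close>. Its two minus
      signs cancel.\<close>
    also have "\<dots> = (LINT w:ball 0 1|lebesgue. bump e (\<gamma> u) w *\<^sub>R blinfun_apply (Df w) (\<gamma>' u))"
      using wd tf unfolding has_weak_derivative_def set_lebesgue_integral_def by simp
    finally have eq: "(LINT w|lborel. f u w) = (LINT w:ball 0 1|lebesgue. bump e (\<gamma> u) w *\<^sub>R blinfun_apply (Df w) (\<gamma>' u))" .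
    have "cmod (LINT w|lborel. f u w) \<le> (LINT w|lebesgue. cmod (indicator (ball 0 1) w *\<^sub>R (bump e (\<gamma> u) w *\<^sub>R blinfun_apply (Df w) (\<gamma>' u))))"
      unfolding eq set_lebesgue_integral_def by (rule integral_norm_bound)
    also have "\<dots> \<le> (LINT w|lebesgue. cmod (\<gamma>' u) * (bump e (\<gamma> u) w * g w))"
    proof (rule integral_mono_AE')
      show "integrable lebesgue (\<lambda>w. cmod (\<gamma>' u) * (bump e (\<gamma> u) w * g w))"
        by (subst integrable_completion) (auto intro: bgi)
      have "AE w in lborel. cmod (indicator (ball 0 1) w *\<^sub>R (bump e (\<gamma> u) w *\<^sub>R blinfun_apply (Df w) (\<gamma>' u))) \<le> cmod (\<gamma>' u) * (bump e (\<gamma> u) w * g w)"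
        using Dg
      proof eventually_elim
        case (elim w)
        show ?case
        proof (cases "w \<in> ball 0 1")
          case True
          with elim have "cmod (blinfun_apply (Df w) (\<gamma>' u)) \<le> cmod (\<gamma>' u) * g w" by blast
          then have "bump e (\<gamma> u) w * cmod (blinfun_apply (Df w) (\<gamma>' u)) \<le> bump e (\<gamma> u) w * (cmod (\<gamma>' u) * g w)"
            by (intro mult_left_mono bump_nonneg)
          then show ?thesis using True bump_nonneg[of e "\<gamma> u" w] by (simp add: mult.left_commute)
        qed (use g0 bump_nonneg[of e "\<gamma> u" w] in auto)
      qed
      then show "AE w in lebesgue. cmod (indicator (ball 0 1) w *\<^sub>R (bump e (\<gamma> u) w *\<^sub>R blinfun_apply (Df w) (\<gamma>' u))) \<le> cmod (\<gamma>' u) * (bump e (\<gamma> u) w * g w)"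
        by (rule AE_completion)
      show "AE w in lebesgue. 0 \<le> cmod (\<gamma>' u) * (bump e (\<gamma> u) w * g w)"
        using g0 bump_nonneg[of e "\<gamma> u"] by (intro AE_I2) auto
    qed
    also have "\<dots> = cmod (\<gamma>' u) * m u"
      unfolding m_def by (subst integral_completion) auto
    finally show ?thesis .
  qed
  have "(LINT w|lborel. bump e (\<gamma> 1) w *\<^sub>R H w) - (LINT w|lborel. bump e (\<gamma> 0) w *\<^sub>R H w)
    = (LINT w|lborel. (LINT u|lborel. f u w))"
    unfolding ftc scaleR_diff_left by (rule Bochner_Integration.integral_diff[symmetric]) (rule int_bump)+
  also have "\<dots> = (LINT u|lborel. (LINT w|lborel. f u w))"
    by (rule lborel_pair.Fubini_integral[OF fi])
  finally have "cmod ((LINT w|lborel. bump e (\<gamma> 1) w *\<^sub>R H w) - (LINT w|lborel. bump e (\<gamma> 0) w *\<^sub>R H w))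
    = cmod (LINT u|lborel. (LINT w|lborel. f u w))" by simp
  also have "\<dots> \<le> (LINT u|lborel. cmod (LINT w|lborel. f u w))" by (rule integral_norm_bound)
  also have "\<dots> \<le> (LINT u|lborel. indicator {0..1} u *\<^sub>R (cmod (\<gamma>' u) * m u))"
  proof (rule integral_mono_AE')
    have "compact (\<gamma>' ` {0..1})"
      by (intro compact_continuous_image continuous_on_subset[OF \<gamma>(2)]) auto
    then obtain A where A: "\<And>u. u \<in> {0..1} \<Longrightarrow> cmod (\<gamma>' u) \<le> A"
      by (force dest!: compact_imp_bounded simp: bounded_iff)
    show "integrable lborel (\<lambda>u. indicator {0..1} u *\<^sub>R (cmod (\<gamma>' u) * m u))"
    proof (rule integrableI_bounded_set_indicator[where B="A * integral\<^sup>L lborel g"])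
      show "AE u in lborel. u \<in> {0..1} \<longrightarrow> norm (cmod (\<gamma>' u) * m u) \<le> A * integral\<^sup>L lborel g"
      proof (intro AE_I2 impI)
        fix u :: real assume "u \<in> {0..1}"
        then have "cmod (\<gamma>' u) * m u \<le> A * integral\<^sup>L lborel g"
          using A[of u] order_trans[OF norm_ge_zero A[of u]] by (intro mult_mono mB m0) auto
        then show "norm (cmod (\<gamma>' u) * m u) \<le> A * integral\<^sup>L lborel g" by (simp add: abs_mult m0)
      qed
    qed auto
    show "AE u in lborel. cmod (LINT w|lborel. f u w) \<le> indicator {0..1} u *\<^sub>R (cmod (\<gamma>' u) * m u)"
      using inner by (intro AE_I2) (auto simp: f_def split: split_indicator)
    show "AE u in lborel. 0 \<le> indicator {0..1} u *\<^sub>R (cmod (\<gamma>' u) * m u)"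
      by (intro AE_I2) (auto simp: m0)
  qed
  finally show ?thesis unfolding H_def m_def set_lebesgue_integral_def .
qed

section \<open>Convolution with a bump\<close>

lemma lborel_affine_measure:
  fixes t :: "'a::euclidean_space" and c :: real
  assumes "c \<noteq> 0"
  shows lborel_integral_affine: "\<And>f :: 'a \<Rightarrow> 'b::{banach, second_countable_topology}. f \<in> borel_measurable borel \<Longrightarrow>
      (LINT x|lborel. f x) = \<bar>c\<bar> ^ DIM('a) *\<^sub>R (LINT x|lborel. f (t + c *\<^sub>R x))"
    and lborel_nn_integral_affine: "\<And>f :: 'a \<Rightarrow> ennreal. f \<in> borel_measurable borel \<Longrightarrow>
      (\<integral>\<^sup>+x. f x \<partial>lborel) = ennreal (\<bar>c\<bar> ^ DIM('a)) * (\<integral>\<^sup>+x. f (t + c *\<^sub>R x) \<partial>lborel)"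
proof -
  show "(LINT x|lborel. f x) = \<bar>c\<bar> ^ DIM('a) *\<^sub>R (LINT x|lborel. f (t + c *\<^sub>R x))"
    if [measurable]: "f \<in> borel_measurable borel" for f :: "'a \<Rightarrow> 'b"
    by (subst lborel_affine[OF assms, of t], subst integral_density) (auto simp: integral_distr)
  show "(\<integral>\<^sup>+x. f x \<partial>lborel) = ennreal (\<bar>c\<bar> ^ DIM('a)) * (\<integral>\<^sup>+x. f (t + c *\<^sub>R x) \<partial>lborel)"
    if [measurable]: "f \<in> borel_measurable borel" for f :: "'a \<Rightarrow> ennreal"
    by (subst lborel_affine[OF assms, of t], subst nn_integral_density) (auto simp: nn_integral_distr nn_integral_cmult)
qed

definition bump_mass :: "'a::euclidean_space itself \<Rightarrow> real" where
  "bump_mass _ = (LINT v|lborel. bump 1 (0::'a) v)"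

text \<open>Normalised to a probability measure, so that Jensen's inequality applies to averages
  against it.\<close>

definition bump_measure :: "'a::euclidean_space measure" where
  "bump_measure = density lborel (\<lambda>v. ennreal (bump 1 0 v / bump_mass TYPE('a)))"

text \<open>Convolution written as an average of translates against a measure that does not depend
  on e: this suits Jensen's inequality and the limit e \<rightarrow> 0. The kernel form, which suits
  differentiation, is \<open>mollify_eq\<close>.\<close>

definition mollify :: "real \<Rightarrow> ('a::euclidean_space \<Rightarrow> 'b::{banach, second_countable_topology}) \<Rightarrow> 'a \<Rightarrow> 'b" where
  "mollify e f z = (LINT v|bump_measure. f (z + e *\<^sub>R v))"

lemma measurable_bump [measurable]: "bump e a \<in> borel_measurable borel"
  by (intro borel_measurable_continuous_onI continuous_intros)

lemma measurable_bump2 [measurable]: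
  assumes [measurable]: "f \<in> borel_measurable M" "g \<in> borel_measurable M"
  shows "(\<lambda>x. bump e (f x) (g x)) \<in> borel_measurable M"
proof -
  have "continuous_on UNIV (\<lambda>(a, w). bump e a w)"
    unfolding case_prod_beta by (intro continuous_intros)
  then have *: "(\<lambda>(a, w). bump e a w) \<in> borel_measurable (borel \<Otimes>\<^sub>M borel)"
    unfolding borel_prod by (rule borel_measurable_continuous_onI)
  show ?thesis using measurable_compose[OF _ *, of "\<lambda>x. (f x, g x)"] by simp
qed

lemma integrable_bump: "integrable lborel (bump 1 (0::'a::euclidean_space))"
proof (rule integrableI_bounded_set[where A="ball 0 1" and B=1])
  show "emeasure lborel (ball (0::'a) 1) < \<infinity>" by (rule emeasure_lborel_ball_finite)
  show "AE w in lborel. w \<in> ball 0 1 \<longrightarrow> norm (bump 1 (0::'a) w) \<le> 1"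
    using bump_nonneg[of 1 "0::'a"] bump_le_1[of 1 "0::'a"] by (intro AE_I2) auto
  show "AE w in lborel. w \<notin> ball 0 1 \<longrightarrow> bump 1 (0::'a) w = 0"
    using bump_eq_0[of 1 _ "0::'a"] by (intro AE_I2) auto
qed auto

lemma bump_mass_pos: "bump_mass TYPE('a::euclidean_space) > 0"
proof -
  have ne: "\<not> (AE w in lborel. bump 1 (0::'a) w = 0)"
  proof
    assume "AE w in lborel. bump 1 (0::'a) w = 0"
    then have "AE w in lborel. w \<notin> ball (0::'a) 1"
      by eventually_elim (use bump_pos_iff[of 1 "0::'a"] in force)
    then have "emeasure lborel (ball (0::'a) 1) = 0"
      by (subst (asm) AE_iff_measurable[where N="ball 0 1"]) auto
    then show False using unit_ball_vol_pos[of "DIM('a)"] by (simp add: emeasure_ball)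
  qed
  have "0 \<le> bump_mass TYPE('a)" unfolding bump_mass_def using bump_nonneg[of 1 "0::'a"] by simp
  moreover have "bump_mass TYPE('a) \<noteq> 0"
    unfolding bump_mass_def using ne bump_nonneg[of 1 "0::'a"]
    by (subst integral_nonneg_eq_0_iff_AE[OF integrable_bump]) auto
  ultimately show ?thesis by simp
qed

lemma sets_bump_measure [simp, measurable_cong]: "sets bump_measure = sets borel"
  by (simp add: bump_measure_def)

lemma space_bump_measure [simp]: "space bump_measure = UNIV"
  by (simp add: bump_measure_def)

lemma prob_space_bump_measure: "prob_space (bump_measure :: 'a::euclidean_space measure)"
proof (rule prob_spaceI)
  have "emeasure (bump_measure :: 'a measure) (space bump_measure) = (\<integral>\<^sup>+v. ennreal (bump 1 (0::'a) v / bump_mass TYPE('a)) \<partial>lborel)"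
    unfolding bump_measure_def by (subst emeasure_density) auto
  also have "\<dots> = ennreal (LINT v|lborel. bump 1 (0::'a) v / bump_mass TYPE('a))"
    using bump_mass_pos[where 'a='a] bump_nonneg[of 1 "0::'a"] integrable_bump[where 'a='a]
    by (intro nn_integral_eq_integral) auto
  also have "\<dots> = 1" using bump_mass_pos[where 'a='a] by (simp add: bump_mass_def)
  finally show "emeasure (bump_measure :: 'a measure) (space bump_measure) = 1" .
qed

lemma mollify_eq:
  fixes f :: "'a::euclidean_space \<Rightarrow> 'b::{banach, second_countable_topology}"
  assumes [measurable]: "f \<in> borel_measurable borel" and e: "0 < e"
  shows "mollify e f z = (1 / (bump_mass TYPE('a) * e ^ DIM('a))) *\<^sub>R (LINT w|lborel. bump e z w *\<^sub>R f w)"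
proof -
  have b: "bump e z (z + e *\<^sub>R v) = bump 1 0 v" for v
    using e by (simp add: bump_def power2_eq_square)
  have "(LINT w|lborel. bump e z w *\<^sub>R f w) = e ^ DIM('a) *\<^sub>R (LINT v|lborel. bump 1 0 v *\<^sub>R f (z + e *\<^sub>R v))"
    using lborel_integral_affine[of e "\<lambda>w. bump e z w *\<^sub>R f w" z] e by (simp add: b)
  moreover have "mollify e f z = (LINT v|lborel. (bump 1 0 v / bump_mass TYPE('a)) *\<^sub>R f (z + e *\<^sub>R v))"
    unfolding mollify_def bump_measure_def using bump_mass_pos[where 'a='a] bump_nonneg[of 1 "0::'a"]
    by (subst integral_density) (auto intro!: AE_I2 divide_nonneg_nonneg)
  moreover have "\<dots> = (1 / bump_mass TYPE('a)) *\<^sub>R (LINT v|lborel. bump 1 0 v *\<^sub>R f (z + e *\<^sub>R v))"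
    by (subst integral_scaleR_right[symmetric]) (auto intro!: Bochner_Integration.integral_cong)
  ultimately show ?thesis using e by simp
qed

lemma measurable_mollify [measurable]:
  fixes f :: "'a::euclidean_space \<Rightarrow> 'b::{banach, second_countable_topology}"
  assumes [measurable]: "f \<in> borel_measurable borel"
  shows "mollify e f \<in> borel_measurable borel"
proof -
  interpret prob_space "bump_measure :: 'a measure" by (rule prob_space_bump_measure)
  show ?thesis unfolding mollify_def[abs_def] by measurable
qed

lemma integrable_mollify:
  fixes f :: "'a::euclidean_space \<Rightarrow> real"
  assumes f: "integrable lborel f" and e: "0 < e"
  shows "integrable bump_measure (\<lambda>v. f (z + e *\<^sub>R v))"
proof -
  have [measurable]: "f \<in> borel_measurable borel" using f by auto
  have i: "integrable lborel (\<lambda>v. f (z + e *\<^sub>R v))"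
  proof -
    have "(\<integral>\<^sup>+v. ennreal (norm (f (z + e *\<^sub>R v))) \<partial>lborel) < \<infinity>"
    proof (rule ccontr)
      assume "\<not> ?thesis"
      then have "(\<integral>\<^sup>+v. ennreal (norm (f (z + e *\<^sub>R v))) \<partial>lborel) = \<infinity>" using top.not_eq_extremum by force
      then have "(\<integral>\<^sup>+v. ennreal (norm (f v)) \<partial>lborel) = \<infinity>"
        using lborel_nn_integral_affine[of e "\<lambda>v. ennreal (norm (f v))" z] e by (simp add: ennreal_mult_top)
      with f show False by (simp add: integrable_iff_bounded)
    qed
    then show ?thesis by (simp add: integrable_iff_bounded)
  qed
  have nn: "0 \<le> bump 1 (0::'a) v / bump_mass TYPE('a)" for v
    using bump_mass_pos[where 'a='a] bump_nonneg[of 1 "0::'a" v] by simp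
  show ?thesis unfolding bump_measure_def
  proof (subst integrable_density)
    show "integrable lborel (\<lambda>v. (bump 1 0 v / bump_mass TYPE('a)) *\<^sub>R f (z + e *\<^sub>R v))"
    proof (rule Bochner_Integration.integrable_bound)
      show "integrable lborel (\<lambda>v. (1 / bump_mass TYPE('a)) *\<^sub>R f (z + e *\<^sub>R v))" using i by simp
      show "AE v in lborel. norm ((bump 1 0 v / bump_mass TYPE('a)) *\<^sub>R f (z + e *\<^sub>R v)) \<le> norm ((1 / bump_mass TYPE('a)) *\<^sub>R f (z + e *\<^sub>R v))"
        using bump_mass_pos[where 'a='a] bump_nonneg[of 1 "0::'a"] bump_le_1[of 1 "0::'a"]
        by (intro AE_I2) (auto simp: abs_mult intro!: divide_right_mono mult_left_le_one_le)
    qed measurable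
    show "AE v in lborel. 0 \<le> bump 1 (0::'a) v / bump_mass TYPE('a)" by (intro AE_I2 nn)
  qed measurable
qed

text \<open>By Jensen's inequality and Tonelli, mollification does not increase the modular
  \<open>\<integral> \<Phi>(g)\<close>; the dilation by \<open>c\<close> costs the factor \<open>1 / c\<^sup>2\<close>.\<close>

lemma nn_integral_N_function_mollify:
  fixes g :: "complex \<Rightarrow> real"
  assumes N: "N_function \<Phi>" and g [measurable]: "g \<in> borel_measurable borel" and g0: "\<And>z. 0 \<le> g z"
    and gi: "integrable lborel g" and e: "0 < e" and c: "1/2 \<le> c"
  shows "(\<integral>\<^sup>+z. ennreal (\<Phi> (mollify e g (c *\<^sub>R z))) \<partial>lborel) \<le> 4 * (\<integral>\<^sup>+z. ennreal (\<Phi> (g z)) \<partial>lborel)"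
proof -
  interpret P: prob_space "bump_measure :: complex measure" by (rule prob_space_bump_measure)
  interpret pair_sigma_finite "lborel :: complex measure" "bump_measure :: complex measure" ..
  have [measurable]: "(\<lambda>z. \<Phi> (g z)) \<in> borel_measurable borel"
    by (rule borel_measurable_N_function[OF N g]) (rule g0)
  have "(\<integral>\<^sup>+z. ennreal (\<Phi> (mollify e g (c *\<^sub>R z))) \<partial>lborel)
    \<le> (\<integral>\<^sup>+z. (\<integral>\<^sup>+v. ennreal (\<Phi> (g (c *\<^sub>R z + e *\<^sub>R v))) \<partial>bump_measure) \<partial>lborel)"
    unfolding mollify_def
    by (intro nn_integral_mono N_function_Jensen[OF N] prob_space_bump_measure integrable_mollify[OF gi e] g0)
  also have "\<dots> = (\<integral>\<^sup>+v. (\<integral>\<^sup>+z. ennreal (\<Phi> (g (c *\<^sub>R z + e *\<^sub>R v))) \<partial>lborel) \<partial>bump_measure)"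
    by (rule Fubini'[symmetric]) measurable
  also have "\<dots> \<le> (\<integral>\<^sup>+v. 4 * (\<integral>\<^sup>+z. ennreal (\<Phi> (g z)) \<partial>lborel) \<partial>(bump_measure :: complex measure))"
  proof (rule nn_integral_mono)
    fix v :: complex
    have "(\<integral>\<^sup>+z. ennreal (\<Phi> (g (c *\<^sub>R z + e *\<^sub>R v))) \<partial>lborel) \<le> 4 * (ennreal (\<bar>c\<bar> ^ DIM(complex)) * (\<integral>\<^sup>+z. ennreal (\<Phi> (g (e *\<^sub>R v + c *\<^sub>R z))) \<partial>lborel))"
    proof -
      \<comment> \<open>The real dimension is 2, so the dilation has Jacobian c^2, which is at least
        1/4.\<close>
      have "1 \<le> 4 * c\<^sup>2" using power_mono[OF c, of 2] by (simp add: power2_eq_square)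
      then have "ennreal 1 \<le> ennreal 4 * ennreal (c\<^sup>2)" by (subst ennreal_mult[symmetric]) (auto intro!: ennreal_leI)
      then have "1 * (\<integral>\<^sup>+z. ennreal (\<Phi> (g (e *\<^sub>R v + c *\<^sub>R z))) \<partial>lborel) \<le> (4 * ennreal (c\<^sup>2)) * (\<integral>\<^sup>+z. ennreal (\<Phi> (g (e *\<^sub>R v + c *\<^sub>R z))) \<partial>lborel)"
        by (intro mult_right_mono) auto
      then show ?thesis by (simp add: mult.assoc add.commute)
    qed
    also have "\<dots> = 4 * (\<integral>\<^sup>+z. ennreal (\<Phi> (g z)) \<partial>lborel)"
      using lborel_nn_integral_affine[of c "\<lambda>z. ennreal (\<Phi> (g z))" "e *\<^sub>R v"] c by simp
    finally show "(\<integral>\<^sup>+z. ennreal (\<Phi> (g (c *\<^sub>R z + e *\<^sub>R v))) \<partial>lborel) \<le> 4 * (\<integral>\<^sup>+z. ennreal (\<Phi> (g z)) \<partial>lborel)" .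
  qed
  also have "\<dots> = 4 * (\<integral>\<^sup>+z. ennreal (\<Phi> (g z)) \<partial>lborel)"
    using P.emeasure_space_1 by simp
  finally show ?thesis .
qed

text \<open>The weak derivative is controlled direction by direction and only up to Lebesgue
  measurability. The sum of its norms in the directions 1 and \<i> has a Borel version, dominates
  the derivative in every direction, and is at most twice the operator norm; doubling absorbs this 2
  in the modular.\<close>

lemma weak_gradient_bound:
  fixes h :: "complex \<Rightarrow> complex"
  assumes N: "N_function \<Phi>" and d: "doubling \<Phi>"
    and wd: "has_weak_derivative h Df (ball 0 1)"
    and fin: "(\<integral>\<^sup>+x\<in>ball 0 1. ennreal (\<Phi> (norm (Df x))) \<partial>lebesgue) < \<infinity>"
  obtains g :: "complex \<Rightarrow> real" where "g \<in> borel_measurable borel" "\<And>z. 0 \<le> g z" "integrable lborel g"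
    "AE w in lborel. w \<in> ball 0 1 \<longrightarrow> (\<forall>v. cmod (blinfun_apply (Df w) v) \<le> cmod v * g w)"
    "(\<integral>\<^sup>+z. ennreal (\<Phi> (g z)) \<partial>lborel) < \<infinity>"
proof -
  \<comment> \<open>\<open>has_weak_derivative\<close> gives integrability on compact subsets only,
    so measurability on the open disc comes from an exhaustion by closed discs.\<close>
  have meas: "(\<lambda>w. indicator (ball 0 1) w *\<^sub>R blinfun_apply (Df w) v) \<in> borel_measurable lebesgue" for v
  proof (rule borel_measurable_LIMSEQ_metric)
    fix n :: nat
    have "0 < 1 / real (Suc n)" by simp
    then have "cball 0 (1 - 1 / real (Suc n)) \<subseteq> ball (0::complex) 1" by (subst cball_subset_ball_iff) simp
    then have "set_integrable lebesgue (cball 0 (1 - 1 / real (Suc n))) (\<lambda>x. blinfun_apply (Df x) v)"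
      using wd unfolding has_weak_derivative_def by auto
    then show "(\<lambda>w. indicator (cball 0 (1 - 1 / real (Suc n))) w *\<^sub>R blinfun_apply (Df w) v) \<in> borel_measurable lebesgue"
      by (auto simp: set_integrable_def)
  next
    fix w :: complex
    show "(\<lambda>n. indicator (cball 0 (1 - 1 / real (Suc n))) w *\<^sub>R blinfun_apply (Df w) v) \<longlonglongrightarrow> indicator (ball 0 1) w *\<^sub>R blinfun_apply (Df w) v"
    proof (cases "w \<in> ball 0 1")
      case True
      then have "cmod w < 1" by simp
      moreover have "(\<lambda>n. 1 - 1 / real (Suc n)) \<longlonglongrightarrow> 1 - 0" by (intro tendsto_intros lim_1_over_n[THEN LIMSEQ_Suc])
      ultimately have "eventually (\<lambda>n. cmod w < 1 - 1 / real (Suc n)) sequentially"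
        by (intro order_tendstoD) auto
      then have "eventually (\<lambda>n. indicator (cball 0 (1 - 1 / real (Suc n))) w *\<^sub>R blinfun_apply (Df w) v = indicator (ball 0 1) w *\<^sub>R blinfun_apply (Df w) v) sequentially"
        by eventually_elim (use True in auto)
      then show ?thesis by (rule tendsto_eventually)
    next
      case False
      have "0 < 1 / real (Suc n)" for n by simp
      then have "\<not> cmod w \<le> 1 - 1 / real (Suc n)" for n
        using False by (simp only: mem_ball dist_0_norm) (smt (verit))
      then show ?thesis using False by simp
    qed
  qed
  define gL where "gL = (\<lambda>w. cmod (indicator (ball 0 1) w *\<^sub>R blinfun_apply (Df w) 1) + cmod (indicator (ball 0 1) w *\<^sub>R blinfun_apply (Df w) \<i>))"
  have "gL \<in> borel_measurable lebesgue"
    unfolding gL_def by (intro borel_measurable_add measurable_compose[OF meas borel_measurable_norm])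
  then obtain g' where g' [measurable]: "g' \<in> borel_measurable borel" and eq: "AE w in lborel. gL w = g' w"
    using completion_ex_borel_measurable_real[of gL lborel] by auto
  \<comment> \<open>g' agrees with gL only almost everywhere; the absolute value and the cutoff make
    nonnegativity and the support hold at every point.\<close>
  define g where "g = (\<lambda>w. indicator (ball 0 1) w * \<bar>g' w\<bar>)"
  have [measurable]: "g \<in> borel_measurable borel" unfolding g_def
    by (intro borel_measurable_times borel_measurable_indicator borel_measurable_abs g') auto
  have g0: "0 \<le> g z" for z by (simp add: g_def)
  have \<Phi>g [measurable]: "(\<lambda>z. \<Phi> (g z)) \<in> borel_measurable borel"
    by (rule borel_measurable_N_function[OF N]) (auto simp: g0)
  have geq: "AE w in lborel. w \<in> ball 0 1 \<longrightarrow> g w = cmod (blinfun_apply (Df w) 1) + cmod (blinfun_apply (Df w) \<i>)"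
    using eq
  proof eventually_elim
    case (elim w)
    have "0 \<le> gL w" by (simp add: gL_def)
    then have "\<bar>g' w\<bar> = gL w" using elim by simp
    then show ?case by (simp add: g_def gL_def)
  qed
  have dom: "AE w in lborel. w \<in> ball 0 1 \<longrightarrow> (\<forall>v. cmod (blinfun_apply (Df w) v) \<le> cmod v * g w)"
    using geq
  proof eventually_elim
    case (elim w)
    show ?case
    proof (intro impI allI)
      fix v assume w: "w \<in> ball 0 1"
      have "v = Re v *\<^sub>R 1 + Im v *\<^sub>R \<i>" by (simp add: complex_eq_iff)
      then have "blinfun_apply (Df w) v = Re v *\<^sub>R blinfun_apply (Df w) 1 + Im v *\<^sub>R blinfun_apply (Df w) \<i>"
        by (metis blinfun.add_right blinfun.scaleR_right)
      then have "cmod (blinfun_apply (Df w) v) \<le> \<bar>Re v\<bar> * cmod (blinfun_apply (Df w) 1) + \<bar>Im v\<bar> * cmod (blinfun_apply (Df w) \<i>)"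
        by (metis norm_triangle_ineq norm_scaleR)
      also have "\<dots> \<le> cmod v * cmod (blinfun_apply (Df w) 1) + cmod v * cmod (blinfun_apply (Df w) \<i>)"
        by (intro add_mono mult_right_mono abs_Re_le_cmod abs_Im_le_cmod) auto
      also have "\<dots> = cmod v * g w" using elim w by (simp add: distrib_left)
      finally show "cmod (blinfun_apply (Df w) v) \<le> cmod v * g w" .
    qed
  qed
  obtain D where D: "D \<ge> 1" "\<And>t. 0 \<le> t \<Longrightarrow> \<Phi> (2 * t) \<le> D * \<Phi> t" using doubling_scale[OF N d, of 2] by auto
  have modular: "(\<integral>\<^sup>+z. ennreal (\<Phi> (g z)) \<partial>lborel) < \<infinity>"
  proof -
    have "ennreal (1 / D) * (\<integral>\<^sup>+z. ennreal (\<Phi> (g z)) \<partial>lborel) = (\<integral>\<^sup>+z. ennreal (1 / D) * ennreal (\<Phi> (g z)) \<partial>lborel)"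
      by (rule nn_integral_cmult[symmetric]) measurable
    also have "\<dots> = (\<integral>\<^sup>+z. ennreal (1 / D) * ennreal (\<Phi> (g z)) \<partial>lebesgue)"
      by (rule nn_integral_completion[symmetric])
    also have "\<dots> \<le> (\<integral>\<^sup>+z\<in>ball 0 1. ennreal (\<Phi> (norm (Df z))) \<partial>lebesgue)"
    proof (rule nn_integral_mono_AE, rule AE_completion)
      show "AE z in lborel. ennreal (1 / D) * ennreal (\<Phi> (g z)) \<le> ennreal (\<Phi> (norm (Df z))) * indicator (ball 0 1) z"
        using geq
      proof eventually_elim
        case (elim z)
        show ?case
        proof (cases "z \<in> ball 0 1")
          case True
          then have "g z \<le> 2 * norm (Df z)"
            using elim norm_blinfun[of "Df z" 1] norm_blinfun[of "Df z" \<i>] by simp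
          then have "\<Phi> (g z) \<le> \<Phi> (2 * norm (Df z))" by (intro N_function_mono[OF N] g0)
          also have "\<dots> \<le> D * \<Phi> (norm (Df z))" by (intro D) auto
          finally have "1 / D * \<Phi> (g z) \<le> \<Phi> (norm (Df z))" using D by (simp add: field_simps)
          then have "ennreal (1 / D * \<Phi> (g z)) \<le> ennreal (\<Phi> (norm (Df z)))" by (rule ennreal_leI)
          moreover have "ennreal (1 / D * \<Phi> (g z)) = ennreal (1 / D) * ennreal (\<Phi> (g z))"
            using D N_function_nonneg[OF N g0] by (intro ennreal_mult) auto
          ultimately show ?thesis using True by simp
        next
          case False
          then show ?thesis by (simp add: g_def N_function_0[OF N])
        qed
      qed
    qed
    also have "\<dots> < \<infinity>" by (rule fin)
    finally have "ennreal (1 / D) * (\<integral>\<^sup>+z. ennreal (\<Phi> (g z)) \<partial>lborel) < \<infinity>" .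
    moreover have "ennreal (1 / D) \<noteq> 0" using D by simp
    ultimately show ?thesis by (auto simp: ennreal_mult_less_top)
  qed
  have "(\<integral>\<^sup>+z\<in>ball 0 1. ennreal (\<Phi> (g z)) \<partial>lborel) \<le> (\<integral>\<^sup>+z. ennreal (\<Phi> (g z)) \<partial>lborel)"
    by (intro nn_integral_mono) (auto split: split_indicator)
  then have "integrable lborel (\<lambda>z. indicator (ball 0 1) z *\<^sub>R g z)"
    using modular by (intro N_function_set_integrable[OF N _ _ g0] emeasure_lborel_ball_finite) auto
  also have "(\<lambda>z. indicator (ball 0 1) z *\<^sub>R g z) = g" by (simp add: g_def fun_eq_iff indicator_def)
  finally have "integrable lborel g" .
  then show ?thesis using that[of g] g0 dom modular by simp
qed

text \<open>The path is contracted by c = 1 - 2 e, so discs of radius e around its points lie inside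
  the unit disc. Radial and angular motion contribute 2 \<tau> u each to the speed, which is the 4
  \<tau> u of \<open>path_bounded\<close>.\<close>

lemma mollified_path_bound:
  fixes h :: "complex \<Rightarrow> complex"
  assumes h: "continuous_on (ball 0 1) h" "\<And>z. z \<in> ball 0 1 \<Longrightarrow> cmod (h z) \<le> 1"
    and wd: "has_weak_derivative h Df (ball 0 1)"
    and g [measurable]: "g \<in> borel_measurable borel" and g0: "\<And>z. 0 \<le> g z" and gi: "integrable lborel g"
    and Dg: "AE w in lborel. w \<in> ball 0 1 \<longrightarrow> (\<forall>v. cmod (blinfun_apply (Df w) v) \<le> cmod v * g w)"
    and e: "0 < e" "0 \<le> c" "c + 2 * e = 1"
    and \<tau>: "0 < \<tau>" "\<tau> \<le> 1/2" and \<kappa>: "\<kappa> \<in> {1, -1}"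
  defines "H \<equiv> \<lambda>w. indicator (ball 0 1) w *\<^sub>R h w"
  shows "cmod (mollify e H (c *\<^sub>R cis b) - mollify e H (c *\<^sub>R (of_real (1 - \<tau>) * cis (b + \<kappa> * \<tau>))))
    \<le> (LINT u:{0..1}|lborel. 4 * \<tau> * u * mollify e g (c *\<^sub>R (of_real (1 - \<tau> * u\<^sup>2) * cis (b + \<kappa> * \<tau> * u\<^sup>2))))"
proof -
  define \<gamma> where "\<gamma> = (\<lambda>u. c *\<^sub>R (of_real (1 - \<tau> * u\<^sup>2) * cis (b + \<kappa> * \<tau> * u\<^sup>2)))"
  define \<gamma>' where "\<gamma>' = (\<lambda>u. c *\<^sub>R (of_real (- 2 * \<tau> * u) * cis (b + \<kappa> * \<tau> * u\<^sup>2)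
     + of_real ((1 - \<tau> * u\<^sup>2) * (2 * \<kappa> * \<tau> * u)) * (\<i> * cis (b + \<kappa> * \<tau> * u\<^sup>2))))"
  have d: "(\<gamma> has_vector_derivative \<gamma>' u) (at u)" for u
    unfolding has_vector_derivative_complex_iff \<gamma>_def \<gamma>'_def
    by (auto intro!: derivative_eq_intros simp: algebra_simps power2_eq_square)
  have c': "continuous_on UNIV \<gamma>'" unfolding \<gamma>'_def by (intro continuous_intros)
  have range: "0 \<le> 1 - \<tau> * u\<^sup>2" "1 - \<tau> * u\<^sup>2 \<le> 1" if "u \<in> {0..1}" for u
  proof -
    have "u\<^sup>2 \<le> 1" using that by (simp add: power_le_one)
    then have "\<tau> * u\<^sup>2 \<le> (1/2) * 1" using \<tau> by (intro mult_mono) auto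
    then show "0 \<le> 1 - \<tau> * u\<^sup>2" by simp
    show "1 - \<tau> * u\<^sup>2 \<le> 1" using \<tau> by simp
  qed
  have norm\<gamma>: "cmod (\<gamma> u) \<le> c" if "u \<in> {0..1}" for u
  proof -
    have "cmod (\<gamma> u) = c * (1 - \<tau> * u\<^sup>2)" unfolding \<gamma>_def norm_scaleR norm_mult norm_of_real norm_cis using range[OF that] e by simp
    also have "\<dots> \<le> c * 1" using range[OF that] e by (intro mult_left_mono) auto
    finally show ?thesis by simp
  qed
  have ball: "cball (\<gamma> u) e \<subseteq> ball 0 1" if "u \<in> {0..1}" for u
  proof
    fix w assume "w \<in> cball (\<gamma> u) e"
    then have "cmod (w - \<gamma> u) \<le> e" by (simp add: dist_norm norm_minus_commute)
    then show "w \<in> ball 0 1" using norm\<gamma>[OF that] norm_triangle_sub[of w "\<gamma> u"] e by simp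
  qed
  have norm\<gamma>': "cmod (\<gamma>' u) \<le> 4 * \<tau> * u" if u: "u \<in> {0..1}" for u
  proof -
    have "cmod (\<gamma>' u) \<le> c * (cmod (of_real (- 2 * \<tau> * u) * cis (b + \<kappa> * \<tau> * u\<^sup>2))
       + cmod (of_real ((1 - \<tau> * u\<^sup>2) * (2 * \<kappa> * \<tau> * u)) * (\<i> * cis (b + \<kappa> * \<tau> * u\<^sup>2))))"
      unfolding \<gamma>'_def norm_scaleR using e by (simp only: abs_of_nonneg) (intro mult_left_mono norm_triangle_ineq)
    also have "\<dots> = c * (2 * \<tau> * u + (1 - \<tau> * u\<^sup>2) * (2 * \<tau> * u))"
      using u \<tau> \<kappa> range[OF u] by (simp only: norm_mult norm_of_real norm_cis norm_ii) (auto simp: abs_mult)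
    also have "\<dots> \<le> 1 * (2 * \<tau> * u + 1 * (2 * \<tau> * u))"
      using u \<tau> e range[OF u] by (intro mult_mono add_mono order_refl) auto
    finally show ?thesis by simp
  qed
  have [measurable]: "H \<in> borel_measurable borel"
    unfolding H_def by (rule borel_measurable_continuous_on_indicator[OF _ h(1)]) auto
  define q where "q = 1 / (bump_mass TYPE(complex) * e\<^sup>2)"
  have q: "q > 0" using bump_mass_pos[where 'a=complex] e by (simp add: q_def)
  have mH: "mollify e H z = q *\<^sub>R (LINT w|lborel. bump e z w *\<^sub>R H w)" for z
    by (subst mollify_eq) (auto simp: q_def e)
  have mg: "mollify e g z = q * (LINT w|lborel. bump e z w * g w)" for z
    by (subst mollify_eq) (auto simp: q_def e)
  have mg0: "0 \<le> mollify e g z" for z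
    unfolding mollify_def by (intro integral_nonneg_AE AE_I2 g0)
  have mgB: "mollify e g z \<le> q * integral\<^sup>L lborel g" for z
    unfolding mg using q bump_nonneg[of e z] bump_le_1[of e z] g0
    by (intro mult_left_mono integral_mono' gi mult_left_le_one_le) auto
  have \<gamma>0: "\<gamma> 0 = c *\<^sub>R cis b" and \<gamma>1: "\<gamma> 1 = c *\<^sub>R (of_real (1 - \<tau>) * cis (b + \<kappa> * \<tau>))"
    by (simp_all add: \<gamma>_def)
  have "cmod (mollify e H (\<gamma> 1) - mollify e H (\<gamma> 0)) = q * cmod ((LINT w|lborel. bump e (\<gamma> 1) w *\<^sub>R H w) - (LINT w|lborel. bump e (\<gamma> 0) w *\<^sub>R H w))"
    unfolding mH scaleR_diff_right[symmetric] norm_scaleR using q by simp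
  also have "\<dots> \<le> q * (LINT u:{0..1}|lborel. cmod (\<gamma>' u) * (LINT w|lborel. bump e (\<gamma> u) w * g w))"
    unfolding H_def using q
    by (intro mult_left_mono mollified_path_estimate[OF h wd g g0 gi Dg e(1) d c' ball]) auto
  also have "\<dots> = (LINT u:{0..1}|lborel. cmod (\<gamma>' u) * mollify e g (\<gamma> u))"
    unfolding mg set_integral_mult_right[symmetric] by (simp only: mult.left_commute)
  also have "\<dots> \<le> (LINT u:{0..1}|lborel. 4 * \<tau> * u * mollify e g (\<gamma> u))"
    unfolding set_lebesgue_integral_def
  proof (rule integral_mono')
    have [measurable]: "\<gamma> \<in> borel_measurable borel" unfolding \<gamma>_def by measurable
    show "integrable lborel (\<lambda>u. indicator {0..1} u *\<^sub>R (4 * \<tau> * u * mollify e g (\<gamma> u)))"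
    proof (rule integrableI_bounded_set_indicator[where B="4 * \<tau> * (q * integral\<^sup>L lborel g)"])
      show "AE u in lborel. u \<in> {0..1} \<longrightarrow> norm (4 * \<tau> * u * mollify e g (\<gamma> u)) \<le> 4 * \<tau> * (q * integral\<^sup>L lborel g)"
      proof (intro AE_I2 impI)
        fix u :: real assume u: "u \<in> {0..1}"
        have "u * mollify e g (\<gamma> u) \<le> 1 * (q * integral\<^sup>L lborel g)"
          using u mg0 mgB by (intro mult_mono) auto
        then have "4 * \<tau> * (u * mollify e g (\<gamma> u)) \<le> 4 * \<tau> * (q * integral\<^sup>L lborel g)"
          using \<tau> by (intro mult_left_mono) auto
        then show "norm (4 * \<tau> * u * mollify e g (\<gamma> u)) \<le> 4 * \<tau> * (q * integral\<^sup>L lborel g)"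
          using u \<tau> mg0 by (simp add: abs_mult mult.assoc)
      qed
      show "(\<lambda>u. 4 * \<tau> * u * mollify e g (\<gamma> u)) \<in> borel_measurable lborel" by measurable
    qed auto
    show "indicator {0..1} u *\<^sub>R (cmod (\<gamma>' u) * mollify e g (\<gamma> u)) \<le> indicator {0..1} u *\<^sub>R (4 * \<tau> * u * mollify e g (\<gamma> u))" for u
      using norm\<gamma>'[of u] mg0[of "\<gamma> u"] by (auto simp: mult_right_mono split: split_indicator)
    show "0 \<le> indicator {0..1} u *\<^sub>R (4 * \<tau> * u * mollify e g (\<gamma> u))" for u
      using \<tau> mg0[of "\<gamma> u"] by (auto split: split_indicator)
  qed
  finally have "cmod (mollify e H (\<gamma> 1) - mollify e H (\<gamma> 0)) \<le> (LINT u:{0..1}|lborel. 4 * \<tau> * u * mollify e g (\<gamma> u))" .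
  then show ?thesis unfolding \<gamma>0 \<gamma>1 by (simp only: \<gamma>_def norm_minus_commute)
qed

section \<open>From an Orlicz-Sobolev extension to the Douglas condition\<close>

theorem Orlicz_Sobolev_imp_Douglas:
  fixes h \<phi> :: "complex \<Rightarrow> complex"
  assumes N: "N_function \<Phi>" and d: "doubling \<Phi>" and p: "p > 1" and t0: "t0 \<ge> 0" and a: "aInc p t0 \<Phi>"
    and hc: "continuous_on (cball 0 1) h" and hb: "h ` cball 0 1 \<subseteq> cball 0 1"
    and h\<phi>: "\<And>\<xi>. \<xi> \<in> sphere 0 1 \<Longrightarrow> h \<xi> = \<phi> \<xi>"
    and hO: "h \<in> Orlicz_Sobolev \<Phi> (ball 0 1)"
  shows "Douglas_condition \<Phi> \<phi>"
proof -
  obtain Df where wd: "has_weak_derivative h Df (ball 0 1)"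
    and fin: "(\<integral>\<^sup>+x\<in>ball 0 1. ennreal (\<Phi> (norm (Df x))) \<partial>lebesgue) < \<infinity>"
    using hO by (auto simp: Orlicz_Sobolev_def)
  obtain g where g [measurable]: "g \<in> borel_measurable borel" and g0: "\<And>z. 0 \<le> g z" and gi: "integrable lborel g"
    and Dg: "AE w in lborel. w \<in> ball 0 1 \<longrightarrow> (\<forall>v. cmod (blinfun_apply (Df w) v) \<le> cmod v * g w)"
    and gfin: "(\<integral>\<^sup>+z. ennreal (\<Phi> (g z)) \<partial>lborel) < \<infinity>"
    using weak_gradient_bound[OF N d wd fin] by blast
  have hb1: "cmod (h z) \<le> 1" if "z \<in> cball 0 1" for z using hb that by (auto simp: image_subset_iff)
  define H where "H = (\<lambda>w. indicator (ball 0 1) w *\<^sub>R h w)"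
  have hcb: "continuous_on (ball 0 1) h" by (rule continuous_on_subset[OF hc]) auto
  have H [measurable]: "H \<in> borel_measurable borel"
    unfolding H_def by (rule borel_measurable_continuous_on_indicator[OF _ hcb]) auto
  have H1: "cmod (H w) \<le> 1" for w using hb1[of w] by (auto simp: H_def split: split_indicator)
  \<comment> \<open>The offset 4 makes e \<le> 1/4 from the start, hence c \<ge> 1/2, as
    \<open>nn_integral_N_function_mollify\<close> requires.\<close>
  define e where "e = (\<lambda>n. 1 / (real n + 4))"
  define c where "c = (\<lambda>n. 1 - 2 * e n)"
  have e: "0 < e n" "e n \<le> 1/4" for n by (auto simp: e_def field_simps)
  have c: "1/2 \<le> c n" "c n + 2 * e n = 1" "c n \<le> 1" for n using e[of n] by (auto simp: c_def)
  define F where "F = (\<lambda>n z. mollify (e n) H (c n *\<^sub>R z))"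
  define G where "G = (\<lambda>n z. mollify (e n) g (c n *\<^sub>R z))"
  have [measurable]: "F n \<in> borel_measurable borel" for n unfolding F_def by measurable
  have [measurable]: "G n \<in> borel_measurable borel" for n unfolding G_def by measurable
  interpret P: prob_space "bump_measure :: complex measure" by (rule prob_space_bump_measure)
  have F1: "cmod (F n z) \<le> 1" for n z
  proof -
    have "cmod (F n z) \<le> (LINT v|bump_measure. cmod (H (c n *\<^sub>R z + e n *\<^sub>R v)))"
      unfolding F_def mollify_def by (rule integral_norm_bound)
    also have "\<dots> \<le> (LINT v|(bump_measure :: complex measure). 1)"
      by (intro integral_mono' H1) auto
    finally show ?thesis using P.prob_space by simp
  qed
  have G0: "0 \<le> G n z" for n z unfolding G_def mollify_def by (intro integral_nonneg_AE AE_I2 g0)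
  have GB: "\<exists>B. \<forall>z. G n z \<le> B" for n
  proof (intro exI allI)
    fix z
    have "G n z = 1 / (bump_mass TYPE(complex) * (e n)\<^sup>2) * (LINT w|lborel. bump (e n) (c n *\<^sub>R z) w * g w)"
      unfolding G_def by (subst mollify_eq) (auto simp: e)
    also have "\<dots> \<le> 1 / (bump_mass TYPE(complex) * (e n)\<^sup>2) * integral\<^sup>L lborel g"
      using bump_mass_pos[where 'a=complex] bump_nonneg[of "e n" "c n *\<^sub>R z"] bump_le_1[of "e n" "c n *\<^sub>R z"] g0 e[of n]
      by (intro mult_left_mono integral_mono' gi mult_left_le_one_le) auto
    finally show "G n z \<le> 1 / (bump_mass TYPE(complex) * (e n)\<^sup>2) * integral\<^sup>L lborel g" .
  qed
  obtain C where C: "\<And>F G B. \<lbrakk>\<And>z. z \<in> sphere 0 1 \<Longrightarrow> cmod (F z) \<le> 1; G \<in> borel_measurable borel; \<And>z. 0 \<le> G z; \<And>z. G z \<le> B;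
      path_bounded F G\<rbrakk> \<Longrightarrow> quotient_modular \<Phi> F \<le> ennreal C * ((\<integral>\<^sup>+z\<in>ball 0 1. ennreal (\<Phi> (G z)) \<partial>lborel) + 1)"
    by (rule trace_estimate[OF N d p t0 a]) (erule that)
  define A where "A = ennreal C * (4 * (\<integral>\<^sup>+z. ennreal (\<Phi> (g z)) \<partial>lborel) + 1)"
  have Afin: "A < \<infinity>" using gfin by (simp add: A_def ennreal_mult_less_top)
  define E where "E = (\<lambda>n b s. ennreal (\<Phi> (cmod (F n (cis (b + s)) - F n (cis b)) / cmod (cis s - 1))) * indicator {-pi..<pi} s * indicator {0..<2 * pi} b)"
  have Emeas [measurable]: "(\<lambda>(b, s). E n b s) \<in> borel_measurable (borel \<Otimes>\<^sub>M borel)" for n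
  proof -
    have [measurable]: "(\<lambda>x. \<Phi> (cmod (F n (cis (fst x + snd x)) - F n (cis (fst x))) / cmod (cis (snd x) - 1))) \<in> borel_measurable (borel \<Otimes>\<^sub>M borel)"
      by (rule borel_measurable_N_function[OF N]) auto
    show ?thesis unfolding E_def case_prod_beta by measurable
  qed
  have Ebound: "(\<integral>\<^sup>+b. (\<integral>\<^sup>+s. E n b s \<partial>lborel) \<partial>lborel) \<le> A" for n
  proof -
    obtain B where B: "\<And>z. G n z \<le> B" using GB by blast
    have [measurable]: "(\<lambda>s. ennreal (\<Phi> (cmod (F n (cis (b + s)) - F n (cis b)) / cmod (cis s - 1)))) \<in> borel_measurable borel" for b
      by (rule measurable_compose[OF borel_measurable_N_function[OF N] measurable_ennreal]) auto
    have "(\<integral>\<^sup>+b. (\<integral>\<^sup>+s. E n b s \<partial>lborel) \<partial>lborel) = quotient_modular \<Phi> (F n)"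
      unfolding E_def quotient_modular_def by (intro nn_integral_cong nn_integral_multc) measurable
    also have "\<dots> \<le> ennreal C * ((\<integral>\<^sup>+z\<in>ball 0 1. ennreal (\<Phi> (G n z)) \<partial>lborel) + 1)"
    proof (rule C[OF F1 _ G0 B])
      show "path_bounded (F n) (G n)"
        unfolding path_bounded_def F_def G_def H_def using c[of n]
        by (intro allI impI mollified_path_bound[OF hcb hb1 wd g g0 gi Dg e(1)]) auto
    qed measurable
    also have "\<dots> \<le> A"
      unfolding A_def
    proof (intro mult_left_mono add_right_mono)
      have "(\<integral>\<^sup>+z\<in>ball 0 1. ennreal (\<Phi> (G n z)) \<partial>lborel) \<le> (\<integral>\<^sup>+z. ennreal (\<Phi> (G n z)) \<partial>lborel)"
        by (intro nn_integral_mono) (auto split: split_indicator)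
      also have "\<dots> \<le> 4 * (\<integral>\<^sup>+z. ennreal (\<Phi> (g z)) \<partial>lborel)"
        unfolding G_def by (rule nn_integral_N_function_mollify[OF N g g0 gi e(1) c(1)])
      finally show "(\<integral>\<^sup>+z\<in>ball 0 1. ennreal (\<Phi> (G n z)) \<partial>lborel) \<le> 4 * (\<integral>\<^sup>+z. ennreal (\<Phi> (g z)) \<partial>lborel)" .
    qed auto
    finally show ?thesis .
  qed
  have e_lim: "e \<longlonglongrightarrow> 0" unfolding e_def using LIMSEQ_ignore_initial_segment[OF lim_1_over_n, of 4] by simp
  then have c_lim: "c \<longlonglongrightarrow> 1" unfolding c_def by (auto intro!: tendsto_eq_intros)
  have Flim: "(\<lambda>n. F n z) \<longlonglongrightarrow> h z" if z: "z \<in> sphere 0 1" for z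
  proof -
    have "(\<lambda>n. LINT v|bump_measure. H (c n *\<^sub>R z + e n *\<^sub>R v)) \<longlonglongrightarrow> (LINT v|(bump_measure :: complex measure). h z)"
    proof (rule integral_dominated_convergence[where w="\<lambda>_. 1"])
      \<comment> \<open>The kernel lives in the unit ball, so the sample points c z + e v have
        modulus below c + e = 1 - e. They stay in the open disc, where H is h, and approach z, where
        h is continuous from inside.\<close>
      have bm: "AE v in (bump_measure :: complex measure). v \<in> ball 0 1"
      proof -
        have "v \<in> ball 0 1" if "0 < bump 1 (0::complex) v / bump_mass TYPE(complex)" for v
        proof (rule ccontr)
          assume "v \<notin> ball 0 1"
          then have "bump 1 0 v = 0" by (intro bump_eq_0) auto
          with that show False by simp
        qed
        then show ?thesis unfolding bump_measure_def by (subst AE_density) auto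
      qed
      show "AE v in bump_measure. (\<lambda>n. H (c n *\<^sub>R z + e n *\<^sub>R v)) \<longlonglongrightarrow> h z"
        using bm
      proof eventually_elim
        case (elim v)
        have inb: "c n *\<^sub>R z + e n *\<^sub>R v \<in> ball 0 1" for n
        proof -
          have "cmod (c n *\<^sub>R z + e n *\<^sub>R v) \<le> c n * 1 + e n * 1"
            using z elim c[of n] e[of n]
            by (intro order_trans[OF norm_triangle_ineq] add_mono) (auto intro: mult_left_mono)
          also have "\<dots> < 1" using c(2)[of n] e[of n] by simp
          finally show ?thesis by simp
        qed
        have "(\<lambda>n. c n *\<^sub>R z + e n *\<^sub>R v) \<longlonglongrightarrow> 1 *\<^sub>R z + 0 *\<^sub>R v"
          by (intro tendsto_intros e_lim c_lim)
        then have "(\<lambda>n. h (c n *\<^sub>R z + e n *\<^sub>R v)) \<longlonglongrightarrow> h z"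
          using z inb by (intro continuous_on_tendsto_compose[OF hc]) (auto intro!: always_eventually less_imp_le)
        moreover have "H (c n *\<^sub>R z + e n *\<^sub>R v) = h (c n *\<^sub>R z + e n *\<^sub>R v)" for n
          using inb[of n] by (simp add: H_def)
        ultimately show ?case by simp
      qed
      show "AE v in bump_measure. norm (H (c n *\<^sub>R z + e n *\<^sub>R v)) \<le> 1" for n by (intro AE_I2 H1)
    qed auto
    then show ?thesis unfolding F_def mollify_def using P.prob_space by simp
  qed
  define E' where "E' = (\<lambda>b s. ennreal (\<Phi> (cmod (h (cis (b + s)) - h (cis b)) / cmod (cis s - 1))) * indicator {-pi..<pi} s * indicator {0..<2 * pi} b)"
  have Elim: "(\<lambda>n. E n b s) \<longlonglongrightarrow> E' b s" for b s
  proof -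
    have "(\<lambda>n. cmod (F n (cis (b + s)) - F n (cis b)) / cmod (cis s - 1)) \<longlonglongrightarrow> cmod (h (cis (b + s)) - h (cis b)) / cmod (cis s - 1)"
    \<comment> \<open>If the chord vanishes, all quotients are 0 by the convention for division, and
      the limit is trivial.\<close>
    proof (cases "cis s = 1")
      case False
      then show ?thesis by (intro tendsto_intros Flim) auto
    qed simp
    then have "(\<lambda>n. \<Phi> (cmod (F n (cis (b + s)) - F n (cis b)) / cmod (cis s - 1))) \<longlonglongrightarrow> \<Phi> (cmod (h (cis (b + s)) - h (cis b)) / cmod (cis s - 1))"
      by (intro continuous_on_tendsto_compose[OF N_function_continuous[OF N]]) (auto intro!: always_eventually)
    then show ?thesis unfolding E_def E'_def
      by (auto intro!: tendsto_ennrealI split: split_indicator)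
  qed
  \<comment> \<open>Fatou's lemma is used once for s and once for b; the bound \<open>A\<close> on
    the iterated integrals is uniform in n.\<close>
  have "(\<integral>\<^sup>+b. (\<integral>\<^sup>+s. E' b s \<partial>lborel) \<partial>lborel) = (\<integral>\<^sup>+b. (\<integral>\<^sup>+s. liminf (\<lambda>n. E n b s) \<partial>lborel) \<partial>lborel)"
    by (intro nn_integral_cong) (simp add: lim_imp_Liminf[OF _ Elim])
  also have "\<dots> \<le> (\<integral>\<^sup>+b. liminf (\<lambda>n. \<integral>\<^sup>+s. E n b s \<partial>lborel) \<partial>lborel)"
    by (intro nn_integral_mono nn_integral_liminf) measurable
  also have "\<dots> \<le> liminf (\<lambda>n. \<integral>\<^sup>+b. (\<integral>\<^sup>+s. E n b s \<partial>lborel) \<partial>lborel)"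
    by (intro nn_integral_liminf) measurable
  also have "\<dots> \<le> A"
    by (intro Liminf_le) (auto simp: Ebound)
  also note Afin
  finally have E'fin: "(\<integral>\<^sup>+b. (\<integral>\<^sup>+s. E' b s \<partial>lborel) \<partial>lborel) < \<infinity>" .
  have "quotient_modular \<Phi> \<phi> = (\<integral>\<^sup>+b. (\<integral>\<^sup>+s. E' b s \<partial>lborel) \<partial>lborel)"
    unfolding quotient_modular_def E'_def
    by (intro nn_integral_cong) (auto simp: h\<phi> split: split_indicator)
  with E'fin have "quotient_modular \<Phi> \<phi> < \<infinity>" by simp
  moreover have "continuous_on (sphere 0 1) \<phi>"
    by (rule continuous_on_eq[OF continuous_on_subset[OF hc]]) (auto simp: h\<phi>)
  ultimately show ?thesis
    by (subst Douglas_condition_iff[OF _ N_function_continuous[OF N]])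
qed

section \<open>The Beurling--Ahlfors extension of a circle homeomorphism\<close>

lemma cis_eq_cis_iff: "cis x = cis y \<longleftrightarrow> (\<exists>n::int. x = y + 2 * pi * of_int n)"
  using sin_cos_eq_iff[of x y] by (auto simp: complex_eq_iff)

text \<open>The imaginary part of a continuous logarithm is a lift t with integer degree k.
  Injectivity of \<phi> forbids degree 0, where t would repeat a value within a period, and degrees
  of modulus above 1, where t would make a full turn before the period ends. The sign \<sigma>
  separates the orientation from an increasing \<theta>.\<close>

lemma circle_homeomorphism_lift:
  assumes "homeomorphism (sphere 0 1) (sphere 0 1) \<phi> \<phi>'"
  obtains \<theta> :: "real \<Rightarrow> real" and \<sigma> :: real where "\<sigma> \<in> {1, -1}" "continuous_on UNIV \<theta>" "strict_mono \<theta>"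
    "\<And>x. \<theta> (x + 2 * pi) = \<theta> x + 2 * pi" "\<And>x. \<phi> (cis x) = cis (\<sigma> * \<theta> x)"
proof -
  have \<phi>c: "continuous_on (sphere 0 1) \<phi>" and \<phi>i: "\<phi> ` sphere 0 1 = sphere 0 1"
    using assms by (auto simp: homeomorphism_def)
  have "\<And>x. x \<in> sphere 0 1 \<Longrightarrow> \<phi>' (\<phi> x) = x" using assms unfolding homeomorphism_def by blast
  then have \<phi>inj: "inj_on \<phi> (sphere 0 1)" by (rule inj_on_inverseI)
  have norm\<phi>: "cmod (\<phi> (cis x)) = 1" for x
  proof -
    have "\<phi> (cis x) \<in> sphere 0 1" by (subst \<phi>i[symmetric], rule imageI) simp
    then show ?thesis by simp
  qed
  have "contractible (UNIV :: real set)" by (rule convex_imp_contractible) simp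
  then obtain g where g: "continuous_on (UNIV::real set) g" "\<And>x. \<phi> (cis x) = exp (g x)"
  proof (rule continuous_logarithm_on_contractible[OF continuous_on_circle_cis[OF \<phi>c]])
    show "\<phi> (cis x) \<noteq> 0" for x using norm\<phi>[of x] by auto
  qed auto
  define t where "t = (\<lambda>x. Im (g x))"
  have tc: "continuous_on S t" for S
    unfolding t_def by (intro continuous_intros continuous_on_subset[OF g(1)]) auto
  have lift: "\<phi> (cis x) = cis (t x)" for x
  proof -
    have "exp (Re (g x)) = 1" using norm\<phi>[of x] by (simp add: g(2))
    then show ?thesis unfolding g(2) t_def by (simp add: exp_eq_polar)
  qed
  have sep: "cis x = cis y" if "cis (t x) = cis (t y)" for x y
    using that \<phi>inj lift by (metis inj_on_def mem_sphere_0 norm_cis)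
  \<comment> \<open>The increment over a period, in units of full turns, is continuous and
    integer-valued, hence constant.\<close>
  have "(\<lambda>x. (t (x + 2 * pi) - t x) / (2 * pi)) constant_on (UNIV :: real set)"
  proof (rule continuous_discrete_range_constant)
    show "continuous_on UNIV (\<lambda>x. (t (x + 2 * pi) - t x) / (2 * pi))"
      by (intro continuous_intros continuous_on_compose2[OF tc[of UNIV]] tc) auto
    have int: "(t (x + 2 * pi) - t x) / (2 * pi) \<in> \<int>" for x
    proof -
      have "cis (t (x + 2 * pi)) = cis (t x)" by (simp add: lift[symmetric] cis_mult[symmetric])
      then obtain n :: int where "t (x + 2 * pi) = t x + 2 * pi * of_int n" by (auto simp: cis_eq_cis_iff)
      then show ?thesis by simp
    qed
    show "\<exists>e>0. \<forall>y. y \<in> UNIV \<and> (t (y + 2 * pi) - t y) / (2 * pi) \<noteq> (t (x + 2 * pi) - t x) / (2 * pi) \<longrightarrow>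
        e \<le> norm ((t (y + 2 * pi) - t y) / (2 * pi) - (t (x + 2 * pi) - t x) / (2 * pi))" for x
    proof (intro exI[of _ 1] conjI allI impI)
      fix y assume *: "y \<in> UNIV \<and> (t (y + 2 * pi) - t y) / (2 * pi) \<noteq> (t (x + 2 * pi) - t x) / (2 * pi)"
      have "(t (y + 2 * pi) - t y) / (2 * pi) - (t (x + 2 * pi) - t x) / (2 * pi) \<in> \<int>" by (intro Ints_diff int)
      then show "1 \<le> norm ((t (y + 2 * pi) - t y) / (2 * pi) - (t (x + 2 * pi) - t x) / (2 * pi))"
        using * by (auto intro!: Ints_nonzero_abs_ge1)
    qed simp
  qed simp
  then obtain c where c: "\<And>x. (t (x + 2 * pi) - t x) / (2 * pi) = c" by (auto simp: constant_on_def)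
  have "cis (t (0 + 2 * pi)) = cis (t 0)" by (simp add: lift[symmetric])
  then obtain k :: int where "t (0 + 2 * pi) = t 0 + 2 * pi * of_int k" by (auto simp: cis_eq_cis_iff)
  with c[of 0] have "c = of_int k" by (simp add: field_simps)
  then have per: "t (x + 2 * pi) = t x + 2 * pi * of_int k" for x using c[of x] by (simp add: field_simps)
  have pern: "t (x + 2 * pi * real n) = t x + 2 * pi * of_int k * real n" for x n
  proof (induction n)
    case (Suc n)
    have "t (x + 2 * pi * real (Suc n)) = t ((x + 2 * pi * real n) + 2 * pi)" by (simp add: algebra_simps)
    also have "\<dots> = t x + 2 * pi * of_int k * real (Suc n)" unfolding per Suc by (simp add: algebra_simps)
    finally show ?case .
  qed simp
  have sep': "\<exists>n::int. x = y + 2 * pi * of_int n" if "t x = t y" for x y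
    using sep[of x y] that by (simp only: cis_eq_cis_iff[symmetric])
  have loc: "x = y" if eq: "t x = t y" and near: "\<bar>x - y\<bar> < 2 * pi" for x y
  proof -
    obtain n :: int where n: "x = y + 2 * pi * of_int n" using sep'[OF eq] by blast
    then have "\<bar>of_int n\<bar> * (2 * pi) < 1 * (2 * pi)" using near by (simp add: abs_mult mult.commute)
    then have "\<bar>of_int n :: real\<bar> < 1" by (subst (asm) mult_less_cancel_right) auto
    then have "n = 0" by simp
    then show ?thesis using n by simp
  qed
  \<comment> \<open>In degree 0 the lift returns to its initial value, so by the intermediate value
    theorem it takes the value halfway between t 0 and t pi on each of the two half periods.\<close>
  have k0: "k \<noteq> 0"
  proof
    assume "k = 0"
    then have p2: "t (2 * pi) = t 0" using per[of 0] by simp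
    define v where "v = (t 0 + t pi) / 2"
    have ne: "t pi \<noteq> t 0" using loc[of pi 0] by auto
    have "\<exists>x. 0 \<le> x \<and> x \<le> pi \<and> t x = v"
    proof (cases "t 0 \<le> t pi")
      case True then show ?thesis by (intro IVT' tc) (auto simp: v_def)
    next
      case False then show ?thesis by (intro IVT2' tc) (auto simp: v_def)
    qed
    then obtain x where x: "0 \<le> x" "x \<le> pi" "t x = v" by blast
    have "\<exists>y. pi \<le> y \<and> y \<le> 2 * pi \<and> t y = v"
    proof (cases "t 0 \<le> t pi")
      case True then show ?thesis by (intro IVT2' tc) (auto simp: v_def p2)
    next
      case False then show ?thesis by (intro IVT' tc) (auto simp: v_def p2)
    qed
    then obtain y where y: "pi \<le> y" "y \<le> 2 * pi" "t y = v" by blast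
    have "v \<noteq> t 0" "v \<noteq> t pi" using ne by (auto simp: v_def)
    then have "x \<noteq> 0" "x \<noteq> pi" "y \<noteq> pi" "y \<noteq> 2 * pi" using x y p2 by auto
    then have "\<bar>x - y\<bar> < 2 * pi" "x < y" using x y by auto
    then show False using loc[of x y] x y by auto
  qed
  have inj: "inj t"
  proof (rule injI)
    fix x y assume eq: "t x = t y"
    obtain n :: int where n: "x = y + 2 * pi * of_int n" using sep'[OF eq] by blast
    show "x = y"
    proof (cases "n \<ge> 0")
      case True
      then have "t x = t y + 2 * pi * of_int k * real (nat n)" using n pern[of y "nat n"] by simp
      then show ?thesis using eq k0 n True by simp
    next
      case False
      then have "t y = t x + 2 * pi * of_int k * real (nat (- n))" using n pern[of x "nat (- n)"] by simp
      then show ?thesis using eq k0 n False by simp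
    qed
  qed
  have "strict_mono_on UNIV t \<or> strict_antimono_on UNIV t"
    using injective_eq_monotone_map[OF is_interval_univ tc[of UNIV]] inj by simp
  then obtain \<sigma> :: real where \<sigma>: "\<sigma> \<in> {1, -1}" and mono: "strict_mono (\<lambda>x. \<sigma> * t x)"
  proof
    assume "strict_mono_on UNIV t"
    then show thesis using that[of 1] by simp
  next
    assume "strict_antimono_on UNIV t"
    then show thesis using that[of "-1"] by (auto simp: strict_mono_def monotone_on_def)
  qed
  define \<theta> where "\<theta> = (\<lambda>x. \<sigma> * t x)"
  have \<sigma>2: "\<sigma> * (\<sigma> * r) = r" for r using \<sigma> by auto
  have c\<theta>: "continuous_on S \<theta>" for S unfolding \<theta>_def by (intro continuous_intros tc)
  define m where "m = (if \<sigma> = 1 then k else - k)"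
  have \<theta>p: "\<theta> (x + 2 * pi) = \<theta> x + 2 * pi * of_int m" for x
    using \<sigma> per[of x] by (auto simp: \<theta>_def m_def algebra_simps)
  have lift\<theta>: "\<phi> (cis x) = cis (\<sigma> * \<theta> x)" for x by (simp add: \<theta>_def \<sigma>2 lift)
  have "\<theta> 0 < \<theta> (0 + 2 * pi)" using mono unfolding \<theta>_def strict_mono_def by simp
  then have m0: "m > 0" unfolding \<theta>p by (simp add: zero_less_mult_iff)
  \<comment> \<open>If m > 1, the value \<theta> 0 + 2 pi is reached strictly inside the period, at
    a point with the same image on the circle as 0.\<close>
  have "m = 1"
  proof (rule ccontr)
    assume "m \<noteq> 1"
    with m0 have m2: "2 * pi < 2 * pi * of_int m" by simp
    have "\<exists>y. 0 \<le> y \<and> y \<le> 2 * pi \<and> \<theta> y = \<theta> 0 + 2 * pi"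
      using \<theta>p[of 0] m2 by (intro IVT' c\<theta>) auto
    then obtain y where y: "0 \<le> y" "y \<le> 2 * pi" "\<theta> y = \<theta> 0 + 2 * pi" by blast
    have "y \<noteq> 0" "y \<noteq> 2 * pi" using y \<theta>p[of 0] m2 by auto
    have "\<sigma> * \<theta> y = \<sigma> * \<theta> 0 + 2 * pi * of_int (if \<sigma> = 1 then 1 else -1)" using y \<sigma> by auto
    then have "cis (\<sigma> * \<theta> y) = cis (\<sigma> * \<theta> 0)" unfolding cis_eq_cis_iff by blast
    then have "cis (t y) = cis (t 0)" by (simp add: \<theta>_def \<sigma>2)
    then obtain n :: int where "y = 0 + 2 * pi * of_int n" using sep[of y 0] unfolding cis_eq_cis_iff by auto
    then have n: "y = 2 * pi * of_int n" by simp
    have "0 < y" "y < 2 * pi" using y \<open>y \<noteq> 0\<close> \<open>y \<noteq> 2 * pi\<close> by auto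
    then have "0 < of_int n * (2 * pi)" "of_int n * (2 * pi) < 1 * (2 * pi)" unfolding n by (simp_all add: mult.commute)
    then have "0 < (of_int n :: real)" "(of_int n :: real) < 1" by (auto simp: zero_less_mult_iff)
    then show False by simp
  qed
  then show thesis using that[OF \<sigma> c\<theta> mono[folded \<theta>_def] _ lift\<theta>] \<theta>p by simp
qed

text \<open>The boundary is covered already, so an omitted point w would be interior. Mapping by h,
  retracting the punctured space onto the sphere and applying the inverse of \<phi> would then
  retract the ball onto its boundary, which is impossible.\<close>

lemma continuous_map_cball_surj:
  fixes h :: "'a::euclidean_space \<Rightarrow> 'a"
  assumes h: "continuous_on (cball 0 1) h" "h ` cball 0 1 \<subseteq> cball 0 1"
    and hom: "homeomorphism (sphere 0 1) (sphere 0 1) \<phi> \<phi>'"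
    and ext: "\<And>\<xi>. \<xi> \<in> sphere 0 1 \<Longrightarrow> h \<xi> = \<phi> \<xi>"
  shows "h ` cball 0 1 = cball 0 1"
proof (rule ccontr)
  assume "h ` cball 0 1 \<noteq> cball 0 1"
  then obtain w where w: "w \<in> cball 0 1" "w \<notin> h ` cball 0 1" using h(2) by blast
  have "sphere 0 1 \<subseteq> h ` cball 0 1"
  proof
    fix x :: 'a assume "x \<in> sphere 0 1"
    then obtain y where "y \<in> sphere 0 1" "x = \<phi> y" using hom unfolding homeomorphism_def by blast
    then show "x \<in> h ` cball 0 1" using ext[of y] by (auto intro!: image_eqI[of _ _ y])
  qed
  with w have "w \<notin> sphere 0 1" by blast
  then have "w \<in> ball 0 1" using w by auto
  have "rel_frontier (cball (0::'a) 1) retract_of (affine hull (cball 0 1) - {w})"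
    by (rule rel_frontier_retract_of_punctured_affine_hull)
       (use \<open>w \<in> ball 0 1\<close> in \<open>auto simp: rel_interior_interior affine_hull_nonempty_interior\<close>)
  moreover have "affine hull (cball (0::'a) 1) = UNIV"
    by (rule affine_hull_nonempty_interior) simp
  moreover have "rel_frontier (cball (0::'a) 1) = sphere 0 1"
    by (simp add: rel_frontier_nonempty_interior)
  ultimately have "sphere (0::'a) 1 retract_of (UNIV - {w})" by simp
  then obtain r where r: "continuous_on (UNIV - {w}) r" "r ` (UNIV - {w}) \<subseteq> sphere 0 1" "\<And>x. x \<in> sphere (0::'a) 1 \<Longrightarrow> r x = x"
    by (auto simp: retract_of_def retraction_def image_subset_iff Pi_iff)
  have \<phi>': "continuous_on (sphere 0 1) \<phi>'" "\<phi>' ` sphere 0 1 = sphere 0 1" "\<And>x. x \<in> sphere 0 1 \<Longrightarrow> \<phi>' (\<phi> x) = x"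
    "\<phi> ` sphere 0 1 = sphere 0 1"
    using hom by (auto simp: homeomorphism_def)
  have hw: "h ` cball 0 1 \<subseteq> UNIV - {w}" using w by auto
  have "retraction (cball 0 1) (sphere 0 1) (\<lambda>x. \<phi>' (r (h x)))"
    unfolding retraction_def
  proof (intro conjI ballI)
    show "continuous_on (cball 0 1) (\<lambda>x. \<phi>' (r (h x)))"
      using hw r(2)
      by (intro continuous_on_compose2[OF \<phi>'(1)] continuous_on_compose2[OF r(1)] h) blast+
    show "(\<lambda>x. \<phi>' (r (h x))) \<in> cball 0 1 \<rightarrow> sphere 0 1"
      using hw r(2) \<phi>'(2) by blast
    show "\<phi>' (r (h x)) = x" if "x \<in> sphere 0 1" for x
    proof -
      have "\<phi> x \<in> sphere 0 1" using that \<phi>'(4) by blast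
      then show ?thesis using that by (simp add: ext r(3) \<phi>'(3))
    qed
  qed auto
  then have "frontier (cball (0::'a) 1) retract_of (cball 0 1)"
    by (auto simp: retract_of_def)
  then show False using no_retraction_cball[of 1 "0::'a"] by simp
qed

text \<open>\<open>mean x y\<close> is the mean of \<open>\<theta>\<close> over the interval between \<open>x\<close> and \<open>x + y\<close>; the means over
  \<open>[x, x + y]\<close> and \<open>[x - y, x]\<close> are the coordinates of the Beurling--Ahlfors extension.\<close>

locale circle_lift =
  fixes \<theta> \<Theta> :: "real \<Rightarrow> real" and \<sigma> :: real
  assumes \<theta>_cont: "continuous_on UNIV \<theta>"
    and \<theta>_mono: "strict_mono \<theta>"
    and \<theta>_shift: "\<And>x. \<theta> (x + 2 * pi) = \<theta> x + 2 * pi"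
    and \<Theta>_deriv: "\<And>x. (\<Theta> has_field_derivative \<theta> x) (at x)"
    and \<sigma>: "\<sigma> \<in> {1, -1}"
begin

definition mean :: "real \<Rightarrow> real \<Rightarrow> real" where
  "mean x y = (if y = 0 then \<theta> x else (\<Theta> (x + y) - \<Theta> x) / y)"

lemma \<theta>_less: "x < y \<Longrightarrow> \<theta> x < \<theta> y"
  using \<theta>_mono by (simp add: strict_mono_def)

lemma \<theta>_le: "x \<le> y \<Longrightarrow> \<theta> x \<le> \<theta> y"
  using \<theta>_less[of x y] by (cases "x = y") auto

lemma \<theta>_continuous_on [continuous_intros]: "continuous_on S f \<Longrightarrow> continuous_on S (\<lambda>x. \<theta> (f x))"
  by (rule continuous_on_compose2[OF \<theta>_cont]) auto

lemma \<Theta>_continuous_on [continuous_intros]: "continuous_on S f \<Longrightarrow> continuous_on S (\<lambda>x. \<Theta> (f x))"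
  by (rule continuous_on_compose2[of UNIV]) (auto intro!: continuous_at_imp_continuous_on DERIV_isCont[OF \<Theta>_deriv])

lemma \<theta>_shift_nat: "\<theta> (x + 2 * pi * real n) = \<theta> x + 2 * pi * real n"
proof (induction n)
  case (Suc n)
  have "\<theta> (x + 2 * pi * real (Suc n)) = \<theta> ((x + 2 * pi * real n) + 2 * pi)" by (simp add: algebra_simps)
  then show ?case by (simp only: \<theta>_shift Suc) (simp add: algebra_simps)
qed simp

lemma mean_between:
  shows mean_pos: "0 < y \<Longrightarrow> \<theta> x < mean x y \<and> mean x y < \<theta> (x + y)"
    and mean_neg: "y < 0 \<Longrightarrow> \<theta> (x + y) < mean x y \<and> mean x y < \<theta> x"
proof -
  assume y: "0 < y"
  obtain z where z: "x < z" "z < x + y" "\<Theta> (x + y) - \<Theta> x = (x + y - x) * \<theta> z"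
    using MVT2[of x "x + y" \<Theta> \<theta>] \<Theta>_deriv y by auto
  then have "mean x y = \<theta> z" using y by (simp add: mean_def)
  then show "\<theta> x < mean x y \<and> mean x y < \<theta> (x + y)" using z \<theta>_less by auto
next
  assume y: "y < 0"
  obtain z where z: "x + y < z" "z < x" "\<Theta> x - \<Theta> (x + y) = (x - (x + y)) * \<theta> z"
    using MVT2[of "x + y" x \<Theta> \<theta>] \<Theta>_deriv y by auto
  then have "\<Theta> (x + y) - \<Theta> x = y * \<theta> z" by (simp add: algebra_simps)
  then have "mean x y = \<theta> z" using y by (simp add: mean_def)
  then show "\<theta> (x + y) < mean x y \<and> mean x y < \<theta> x" using z \<theta>_less by auto
qed

lemma mean_bounds: "\<theta> (x - \<bar>y\<bar>) \<le> mean x y" "mean x y \<le> \<theta> (x + \<bar>y\<bar>)"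
  using mean_pos[of y x] mean_neg[of y x] \<theta>_less[of "x - \<bar>y\<bar>" x] \<theta>_less[of x "x + \<bar>y\<bar>"]
  by (cases "0 < y"; cases "y < 0"; force simp: mean_def)+

text \<open>Off y = 0 these are the partial derivatives of \<open>mean\<close>. They involve values
  of \<theta> only, because what is differentiated is the primitive \<Theta>.\<close>

definition mean_dx :: "real \<Rightarrow> real \<Rightarrow> real" where "mean_dx x y = (\<theta> (x + y) - \<theta> x) / y"
definition mean_dy :: "real \<Rightarrow> real \<Rightarrow> real" where "mean_dy x y = (\<theta> (x + y) - mean x y) / y"

lemma mean_dx_pos: "y \<noteq> 0 \<Longrightarrow> 0 < mean_dx x y"
  using \<theta>_less[of x "x + y"] \<theta>_less[of "x + y" x]
  by (cases "0 < y") (auto simp: mean_dx_def zero_less_divide_iff)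

text \<open>The mean lies strictly between the values of \<theta> at the endpoints. Hence the
  y-derivative is positive and is dominated by the x-derivative, so gradient bounds can be stated
  with \<open>mean_dx\<close> alone.\<close>

lemma mean_dy_pos: "y \<noteq> 0 \<Longrightarrow> 0 < mean_dy x y" and mean_dy_le: "y \<noteq> 0 \<Longrightarrow> mean_dy x y \<le> mean_dx x y"
  using mean_pos[of y x] mean_neg[of y x]
  by (cases "0 < y"; force simp: mean_dy_def mean_dx_def zero_less_divide_iff divide_right_mono divide_right_mono_neg)+

lemma mean_has_derivative:
  assumes "(f has_derivative f') (at z within S)" "(g has_derivative g') (at z within S)" "g z \<noteq> 0"
  shows "((\<lambda>z. (\<Theta> (f z + g z) - \<Theta> (f z)) / g z) has_derivative
     (\<lambda>v. mean_dx (f z) (g z) * f' v + mean_dy (f z) (g z) * g' v)) (at z within S)"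
proof -
  have "((\<lambda>z. \<Theta> (f z + g z)) has_derivative (\<lambda>v. \<theta> (f z + g z) * (f' v + g' v))) (at z within S)"
    using has_derivative_compose[OF has_derivative_add[OF assms(1,2)] has_field_derivative_imp_has_derivative[OF \<Theta>_deriv]] by simp
  moreover have "((\<lambda>z. \<Theta> (f z)) has_derivative (\<lambda>v. \<theta> (f z) * f' v)) (at z within S)"
    using has_derivative_compose[OF assms(1) has_field_derivative_imp_has_derivative[OF \<Theta>_deriv]] by simp
  ultimately show ?thesis
    using assms(3)
    by (auto intro!: derivative_eq_intros assms(2) simp: fun_eq_iff mean_dx_def mean_dy_def mean_def field_simps)
qed

lemma mean_strict_mono_x: "x1 < x2 \<Longrightarrow> mean x1 y < mean x2 y"
proof (cases "y = 0")
  case False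
  assume "x1 < x2"
  have "(\<lambda>x. (\<Theta> (x + y) - \<Theta> x) / y) x1 < (\<lambda>x. (\<Theta> (x + y) - \<Theta> x) / y) x2"
  proof (rule DERIV_pos_imp_increasing[OF \<open>x1 < x2\<close>])
    fix x
    have "((\<lambda>x. (\<Theta> (x + y) - \<Theta> x) / y) has_field_derivative mean_dx x y) (at x)"
      using mean_has_derivative[of "\<lambda>x. x" "\<lambda>v. v" x UNIV "\<lambda>_. y" "\<lambda>_. 0"] False
      by (simp add: has_field_derivative_def)
    then show "\<exists>d. ((\<lambda>x. (\<Theta> (x + y) - \<Theta> x) / y) has_real_derivative d) (at x) \<and> 0 < d"
      using mean_dx_pos[OF False] by blast
  qed
  then show ?thesis using False by (simp add: mean_def)
qed (simp add: mean_def \<theta>_less)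

lemma mean_strict_mono_y: "y1 < y2 \<Longrightarrow> mean x y1 < mean x y2"
proof -
  assume y: "y1 < y2"
  have same_sign: "mean x y1 < mean x y2" if "y1 < y2" "\<And>y. y1 \<le> y \<Longrightarrow> y \<le> y2 \<Longrightarrow> y \<noteq> 0" for y1 y2
  proof -
    have "(\<lambda>y. (\<Theta> (x + y) - \<Theta> x) / y) y1 < (\<lambda>y. (\<Theta> (x + y) - \<Theta> x) / y) y2"
    proof (rule DERIV_pos_imp_increasing[OF \<open>y1 < y2\<close>])
      fix y assume "y1 \<le> y" "y \<le> y2"
      then have "y \<noteq> 0" using that by blast
      then have "((\<lambda>y. (\<Theta> (x + y) - \<Theta> x) / y) has_field_derivative mean_dy x y) (at y)"
        using mean_has_derivative[of "\<lambda>_. x" "\<lambda>_. 0" y UNIV "\<lambda>y. y" "\<lambda>v. v"] \<open>y \<noteq> 0\<close>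
        by (simp add: has_field_derivative_def)
      then show "\<exists>d. ((\<lambda>y. (\<Theta> (x + y) - \<Theta> x) / y) has_real_derivative d) (at y) \<and> 0 < d"
        using mean_dy_pos[OF \<open>y \<noteq> 0\<close>] by blast
    qed
    then show ?thesis using that(2)[of y1] that(2)[of y2] that(1) by (simp add: mean_def)
  qed
  consider "0 < y1" | "y2 < 0" | "y1 < 0" "0 < y2" | "y1 = 0" | "y2 = 0" by linarith
  then show ?thesis
  proof cases
    case 3 then show ?thesis using mean_neg[of y1 x] mean_pos[of y2 x] by linarith
  next
    case 4 then show ?thesis using mean_pos[of y2 x] y by (simp add: mean_def)
  next
    case 5 then show ?thesis using mean_neg[of y1 x] y by (simp add: mean_def)
  qed (use y in \<open>auto intro!: same_sign\<close>)
qed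

text \<open>Let x1 \<le> x2. By monotonicity y1 < y2 would make the first mean strictly larger at
  the second point, and y2 < y1 would do so for the second mean. So y1 = y2, and strict monotonicity
  in x finishes.\<close>

lemma mean_pair_inj:
  assumes "mean x1 y1 = mean x2 y2" "mean x1 (- y1) = mean x2 (- y2)"
  shows "x1 = x2 \<and> y1 = y2"
proof -
  have *: "x1 = x2 \<and> y1 = y2" if le: "x1 \<le> x2" and e: "mean x1 y1 = mean x2 y2" "mean x1 (- y1) = mean x2 (- y2)" for x1 x2 y1 y2
  proof -
    have mono: "mean x1 y \<le> mean x2 y" for y using le mean_strict_mono_x[of x1 x2 y] by (cases "x1 = x2") auto
    have "\<not> y1 < y2" using mean_strict_mono_y[of y1 y2 x1] mono[of y2] e by auto
    moreover have "\<not> y2 < y1" using mean_strict_mono_y[of "- y1" "- y2" x1] mono[of "- y2"] e by auto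
    ultimately have "y1 = y2" by simp
    then show ?thesis using mean_strict_mono_x[of x1 x2 y1] le e by (cases "x1 = x2") auto
  qed
  show ?thesis using *[of x1 x2 y1 y2] *[of x2 x1 y2 y1] assms by (cases "x1 \<le> x2") auto
qed

text \<open>\<Theta> (x + 2 pi) - \<Theta> x - 2 pi x has derivative 0 and is constant, so the
  primitive has the matching quasi-periodicity.\<close>

lemma mean_shift: "mean (x + 2 * pi) y = mean x y + 2 * pi"
proof (cases "y = 0")
  case False
  define K where "K = (\<lambda>x. \<Theta> (x + 2 * pi) - \<Theta> x - 2 * pi * x)"
  have "(K has_field_derivative 0) (at x)" for x
  proof -
    have "((\<lambda>x. \<Theta> (x + 2 * pi)) has_field_derivative \<theta> (x + 2 * pi)) (at x)"
      using \<Theta>_deriv[of "x + 2 * pi"] by (simp add: DERIV_shift)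
    then show ?thesis unfolding K_def
      by (auto intro!: derivative_eq_intros \<Theta>_deriv simp: \<theta>_shift)
  qed
  then have "K (x + y) = K x" using DERIV_isconst_all[of K] by blast
  then have "\<Theta> (x + 2 * pi + y) - \<Theta> (x + 2 * pi) = \<Theta> (x + y) - \<Theta> x + 2 * pi * y"
    by (simp add: K_def algebra_simps)
  then show ?thesis using False by (simp add: mean_def add_divide_distrib)
qed (simp add: mean_def \<theta>_shift)

lemma mean_shift_int: "mean (x + 2 * pi * of_int k) y = mean x y + 2 * pi * of_int k"
proof -
  have nat: "mean (x + 2 * pi * real n) y = mean x y + 2 * pi * real n" for x n
  proof (induction n)
    case (Suc n)
    have "mean (x + 2 * pi * real (Suc n)) y = mean ((x + 2 * pi * real n) + 2 * pi) y" by (simp add: algebra_simps)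
    then show ?case by (simp only: mean_shift Suc) (simp add: algebra_simps)
  qed simp
  show ?thesis
  proof (cases "k \<ge> 0")
    case True then show ?thesis using nat[of x "nat k"] by simp
  next
    case False then show ?thesis using nat[of "x + 2 * pi * of_int k" "nat (- k)"] by simp
  qed
qed

lemma continuous_mean: "continuous_on UNIV (\<lambda>(x, y). mean x y)"
proof (intro continuous_at_imp_continuous_on ballI)
  fix p :: "real \<times> real"
  obtain x y where p: "p = (x, y)" by (cases p)
  show "isCont (\<lambda>(x, y). mean x y) p"
  proof (cases "y = 0")
    case False
    have o: "open {p :: real \<times> real. snd p \<noteq> 0}" by (intro open_Collect_neq continuous_intros)
    have "continuous_on {p. snd p \<noteq> 0} (\<lambda>p. (\<Theta> (fst p + snd p) - \<Theta> (fst p)) / snd p)"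
      by (intro continuous_intros) auto
    then have "continuous_on {p. snd p \<noteq> 0} (\<lambda>(x, y). mean x y)"
      by (rule continuous_on_eq) (auto simp: mean_def)
    then show ?thesis using False o by (auto simp: continuous_on_eq_continuous_at p)
  next
    case True
    \<comment> \<open>At y = 0 the quotient is singular, but the mean is squeezed between values of
      \<theta> at x - |y| and x + |y|.\<close>
    have c: "continuous_on UNIV (\<lambda>p. \<theta> (fst p - \<bar>snd p\<bar>))" "continuous_on UNIV (\<lambda>p. \<theta> (fst p + \<bar>snd p\<bar>))"
      by (intro continuous_intros)+
    have t: "((\<lambda>p. \<theta> (fst p - \<bar>snd p\<bar>)) \<longlongrightarrow> \<theta> x) (at p)" "((\<lambda>p. \<theta> (fst p + \<bar>snd p\<bar>)) \<longlongrightarrow> \<theta> x) (at p)"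
      using c[unfolded continuous_on_def, rule_format, of p] by (simp_all add: p True)
    have "((\<lambda>(x, y). mean x y) \<longlongrightarrow> \<theta> x) (at p)"
      by (rule tendsto_sandwich[OF _ _ t]) (auto intro!: always_eventually mean_bounds)
    then show ?thesis by (simp add: isCont_def p True mean_def)
  qed
qed

lemma mean_continuous_on [continuous_intros]:
  "continuous_on S f \<Longrightarrow> continuous_on S g \<Longrightarrow> continuous_on S (\<lambda>x. mean (f x) (g x))"
  using continuous_on_compose2[OF continuous_mean, of S "\<lambda>x. (f x, g x)"] by (simp add: continuous_on_Pair)

text \<open>Over an interval \<theta> grows by at least its length minus one period. Integrated,
  this gives \<Theta> (x + y) + \<Theta> (x - y) - 2 \<Theta> x \<ge> y^2 - 2 pi y. The bound
  controls the extension near the origin.\<close>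

lemma mean_spread:
  assumes y: "0 < y"
  shows "y - 2 * pi \<le> mean x y - mean x (- y)"
proof -
  have up: "\<theta> w + (z - w) - 2 * pi \<le> \<theta> z" if "w \<le> z" for w z
  proof -
    define n where "n = nat \<lfloor>(z - w) / (2 * pi)\<rfloor>"
    have "0 \<le> \<lfloor>(z - w) / (2 * pi)\<rfloor>" using that by simp
    then have "real n = of_int \<lfloor>(z - w) / (2 * pi)\<rfloor>" by (simp add: n_def)
    then have n: "real n \<le> (z - w) / (2 * pi)" "(z - w) / (2 * pi) < real n + 1"
      by linarith+
    then have "w + 2 * pi * real n \<le> z" "z - w \<le> 2 * pi * real n + 2 * pi" by (auto simp: field_simps)
    then show ?thesis using \<theta>_le[of "w + 2 * pi * real n" z] by (simp add: \<theta>_shift_nat)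
  qed
  define K where "K = (\<lambda>s. \<Theta> (x + s) + \<Theta> (x - s) - s\<^sup>2 + 2 * pi * s)"
  have "K 0 \<le> K y"
  proof (rule DERIV_nonneg_imp_nondecreasing[where f=K])
    fix s :: real assume s: "0 \<le> s"
    have "((\<lambda>s. \<Theta> (x + s)) has_field_derivative \<theta> (x + s) * 1) (at s)"
      by (rule DERIV_chain2[OF \<Theta>_deriv]) (auto intro!: derivative_eq_intros)
    moreover have "((\<lambda>s. \<Theta> (x - s)) has_field_derivative \<theta> (x - s) * (- 1)) (at s)"
      by (rule DERIV_chain2[OF \<Theta>_deriv]) (auto intro!: derivative_eq_intros)
    ultimately have "(K has_field_derivative (\<theta> (x + s) - \<theta> (x - s) - 2 * s + 2 * pi)) (at s)"
      unfolding K_def by (auto intro!: derivative_eq_intros)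
    moreover have "0 \<le> \<theta> (x + s) - \<theta> (x - s) - 2 * s + 2 * pi" using up[of "x - s" "x + s"] s by simp
    ultimately show "\<exists>d. (K has_real_derivative d) (at s) \<and> 0 \<le> d" by blast
  qed (use y in simp)
  then have "(y - 2 * pi) * y \<le> \<Theta> (x + y) + \<Theta> (x - y) - 2 * \<Theta> x"
    by (simp add: K_def algebra_simps power2_eq_square)
  then have "y - 2 * pi \<le> (\<Theta> (x + y) + \<Theta> (x - y) - 2 * \<Theta> x) / y"
    using y by (subst pos_le_divide_eq) auto
  also have "\<dots> = mean x y - mean x (- y)" using y by (simp add: mean_def field_simps)
  finally show ?thesis .
qed

end

section \<open>The extension on the disc and its derivative\<close>

context circle_lift
begin

text \<open>The difference of the two means becomes minus the logarithm of the modulus, their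
  average the argument. Taking the full difference, not half of it, makes the modulus decay like
  e^(-y), that is, linearly in |z|.\<close>

definition strip_ext :: "real \<Rightarrow> real \<Rightarrow> complex" where
  "strip_ext x y = of_real (exp (- (mean x y - mean x (- y)))) * cis (\<sigma> * (mean x y + mean x (- y)) / 2)"

text \<open>The jump of Ln across the negative axis is a multiple of 2 pi, to which
  \<open>strip_ext\<close> is blind.\<close>

definition disc_ext :: "complex \<Rightarrow> complex" where
  "disc_ext z = (if z = 0 then 0 else strip_ext (Im (Ln z)) (- Re (Ln z)))"

lemma strip_ext_shift: "strip_ext (x + 2 * pi * of_int k) y = strip_ext x y"
proof -
  have "\<sigma> * (mean (x + 2 * pi * of_int k) y + mean (x + 2 * pi * of_int k) (- y)) / 2
      = \<sigma> * (mean x y + mean x (- y)) / 2 + 2 * pi * of_int (if \<sigma> = 1 then k else - k)"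
    using \<sigma> unfolding mean_shift_int by (auto simp: field_simps)
  then have "cis (\<sigma> * (mean (x + 2 * pi * of_int k) y + mean (x + 2 * pi * of_int k) (- y)) / 2) = cis (\<sigma> * (mean x y + mean x (- y)) / 2)"
    unfolding cis_eq_cis_iff by blast
  then show ?thesis by (simp add: strip_ext_def mean_shift_int)
qed

lemma exp_Ln_polar: "z \<noteq> 0 \<Longrightarrow> z = of_real (cmod z) * cis (Im (Ln z))"
  using exp_Ln[of z] by (simp add: exp_eq_polar)

lemma disc_ext_polar: "0 < r \<Longrightarrow> disc_ext (of_real r * cis x) = strip_ext x (- ln r)"
proof -
  assume r: "0 < r"
  define z where "z = of_real r * cis x"
  have z: "z \<noteq> 0" "cmod z = r" using r by (auto simp: z_def norm_mult)
  have "of_real r * cis (Im (Ln z)) = of_real r * cis x"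
    using exp_Ln_polar[OF z(1)] z(2) by (metis z_def)
  then have "cis (Im (Ln z)) = cis x" using r by simp
  then obtain k :: int where "Im (Ln z) = x + 2 * pi * of_int k" unfolding cis_eq_cis_iff by blast
  then show ?thesis using z by (simp add: disc_ext_def z_def[symmetric] strip_ext_shift)
qed

lemma disc_ext_circle: "disc_ext (cis x) = cis (\<sigma> * \<theta> x)"
  using disc_ext_polar[of 1 x] by (simp add: strip_ext_def mean_def)

lemma strip_ext_continuous_on [continuous_intros]:
  "continuous_on S f \<Longrightarrow> continuous_on S g \<Longrightarrow> continuous_on S (\<lambda>z. strip_ext (f z) (g z))"
  unfolding strip_ext_def by (intro continuous_intros) auto

lemma norm_strip_ext: "cmod (strip_ext x y) = exp (- (mean x y - mean x (- y)))"
  by (simp add: strip_ext_def norm_mult)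

text \<open>Gives continuity at the origin and, in the gradient bound, cancels the factor 1 / |z|
  from the derivative of Ln.\<close>

lemma norm_disc_ext_le:
  assumes "z \<noteq> 0" "cmod z < 1" shows "cmod (disc_ext z) \<le> exp (2 * pi) * cmod z"
proof -
  have y: "0 < - Re (Ln z)" using assms by simp
  have "cmod (disc_ext z) \<le> exp (- (- Re (Ln z) - 2 * pi))"
    using assms mean_spread[OF y, of "Im (Ln z)"] by (simp only: disc_ext_def norm_strip_ext if_False exp_le_cancel_iff)
  also have "\<dots> = exp (2 * pi) * cmod z" using assms by (simp add: exp_add)
  finally show ?thesis .
qed

lemma continuous_disc_ext: "continuous_on S disc_ext"
proof (rule continuous_at_imp_continuous_on, rule ballI)
  fix z :: complex
  have slit: "open (- \<real>\<^sub>\<le>\<^sub>0 :: complex set)" by (simp add: open_Compl)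
  consider "z = 0" | "z \<notin> \<real>\<^sub>\<le>\<^sub>0" | "z \<noteq> 0" "- z \<notin> \<real>\<^sub>\<le>\<^sub>0" by (metis add.inverse_neutral complex_nonpos_Reals_iff dual_order.antisym neg_le_0_iff_le uminus_complex.sel(1) complex_eq_iff zero_complex.sel)
  then show "isCont disc_ext z"
  proof cases
    case 1
    have "(disc_ext \<longlongrightarrow> 0) (at 0)"
    proof (rule Lim_null_comparison)
      have "eventually (\<lambda>z::complex. cmod z < 1) (at 0)"
        unfolding eventually_at by (intro exI[of _ 1]) auto
      then show "eventually (\<lambda>z. cmod (disc_ext z) \<le> exp (2 * pi) * cmod z) (at 0)"
        using eventually_neq_at_within[of 0 0 UNIV] by eventually_elim (rule norm_disc_ext_le)
      show "((\<lambda>z. exp (2 * pi) * cmod z) \<longlongrightarrow> 0) (at 0)" by (auto intro!: tendsto_eq_intros)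
    qed
    then show ?thesis by (simp add: isCont_def 1 disc_ext_def)
  next
    case 2
    have "continuous_on (- \<real>\<^sub>\<le>\<^sub>0) (\<lambda>z. strip_ext (Im (Ln z)) (- Re (Ln z)))"
      by (intro continuous_intros) auto
    then have "continuous_on (- \<real>\<^sub>\<le>\<^sub>0) disc_ext"
      by (rule continuous_on_eq) (auto simp: disc_ext_def)
    then show ?thesis using 2 slit by (simp add: continuous_on_eq_continuous_at)
  next
    case 3
    have o: "open (uminus -` (- \<real>\<^sub>\<le>\<^sub>0) :: complex set)" by (intro open_vimage slit continuous_intros)
    \<comment> \<open>Near the negative axis Ln (- w) is continuous, and adding pi to its imaginary
      part gives another argument of w. By \<open>disc_ext_polar\<close> any argument of w may be
      used.\<close>
    have "continuous_on (uminus -` (- \<real>\<^sub>\<le>\<^sub>0)) (\<lambda>z. strip_ext (Im (Ln (- z)) + pi) (- Re (Ln (- z))))"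
      by (intro continuous_intros) auto
    then have "continuous_on (uminus -` (- \<real>\<^sub>\<le>\<^sub>0)) disc_ext"
    proof (rule continuous_on_eq)
      fix w :: complex assume "w \<in> uminus -` (- \<real>\<^sub>\<le>\<^sub>0)"
      then have w: "w \<noteq> 0" by auto
      have "w = of_real (cmod w) * cis (Im (Ln (- w)) + pi)"
        using exp_Ln_polar[of "- w"] w by (simp add: cis_mult[symmetric] minus_equation_iff)
      then have "disc_ext w = strip_ext (Im (Ln (- w)) + pi) (- ln (cmod w))"
        using disc_ext_polar[of "cmod w" "Im (Ln (- w)) + pi"] w by simp
      then show "strip_ext (Im (Ln (- w)) + pi) (- Re (Ln (- w))) = disc_ext w" using w by simp
    qed
    then show ?thesis using 3 o by (simp add: continuous_on_eq_continuous_at)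
  qed
qed

lemma disc_ext_in_cball: "z \<in> cball 0 1 \<Longrightarrow> disc_ext z \<in> cball 0 1"
proof (cases "z = 0")
  case False
  assume z: "z \<in> cball 0 1"
  then have "Re (Ln z) \<le> 0" using False by simp
  then have "mean (Im (Ln z)) (Re (Ln z)) \<le> mean (Im (Ln z)) (- Re (Ln z))"
    using mean_strict_mono_y[of "Re (Ln z)" "- Re (Ln z)" "Im (Ln z)"] by (cases "Re (Ln z) = 0") auto
  then show ?thesis using False by (simp add: disc_ext_def norm_strip_ext)
qed (simp add: disc_ext_def)

lemma inj_disc_ext: "inj disc_ext"
proof (rule injI)
  fix z w assume eq: "disc_ext z = disc_ext w"
  have zero: "disc_ext z = 0 \<longleftrightarrow> z = 0" for z
  proof (cases "z = 0")
    case False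
    then have "cmod (disc_ext z) \<noteq> 0" by (simp add: disc_ext_def norm_strip_ext del: norm_eq_zero)
    then show ?thesis using False by simp
  qed (simp add: disc_ext_def)
  show "z = w"
  proof (cases "z = 0 \<or> w = 0")
    case True then show ?thesis using eq zero by metis
  next
    case False
    define x1 where "x1 = Im (Ln z)"
    define y1 where "y1 = - Re (Ln z)"
    define x2 where "x2 = Im (Ln w)"
    define y2 where "y2 = - Re (Ln w)"
    have se: "strip_ext x1 y1 = strip_ext x2 y2"
      using eq False by (simp add: disc_ext_def x1_def y1_def x2_def y2_def)
    then have V: "mean x1 y1 - mean x1 (- y1) = mean x2 y2 - mean x2 (- y2)"
      using norm_strip_ext[of x1 y1] norm_strip_ext[of x2 y2] by simp
    then have "cis (\<sigma> * (mean x1 y1 + mean x1 (- y1)) / 2) = cis (\<sigma> * (mean x2 y2 + mean x2 (- y2)) / 2)"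
      using se by (simp add: strip_ext_def)
    then obtain n :: int where "\<sigma> * (mean x1 y1 + mean x1 (- y1)) / 2 = \<sigma> * (mean x2 y2 + mean x2 (- y2)) / 2 + 2 * pi * of_int n"
      unfolding cis_eq_cis_iff by blast
    \<comment> \<open>The argument is half the sum of the means, so a discrepancy of n full turns
      changes the sum by 4 pi k with k = \<sigma> n. As the difference is unchanged, each mean
      changes by 2 pi k, which \<open>mean_shift_int\<close> absorbs into x2.\<close>
    then obtain k :: int where U: "mean x1 y1 + mean x1 (- y1) = mean x2 y2 + mean x2 (- y2) + 4 * pi * of_int k"
    proof -
      assume n: "\<sigma> * (mean x1 y1 + mean x1 (- y1)) / 2 = \<sigma> * (mean x2 y2 + mean x2 (- y2)) / 2 + 2 * pi * of_int n"
      show thesis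
      proof (cases "\<sigma> = 1")
        case True with n show thesis by (intro that[of n]) (simp add: field_simps)
      next
        case False with n \<sigma> show thesis by (intro that[of "- n"]) (auto simp: field_simps)
      qed
    qed
    have "mean x1 y1 = mean (x2 + 2 * pi * of_int k) y2" "mean x1 (- y1) = mean (x2 + 2 * pi * of_int k) (- y2)"
      unfolding mean_shift_int using U V by argo+
    then have *: "x1 = x2 + 2 * pi * of_int k" "y1 = y2" using mean_pair_inj by blast+
    then have "cis x1 = cis x2" unfolding cis_eq_cis_iff by blast
    moreover have "cmod z = cmod w" using *(2) False by (simp add: y1_def y2_def)
    ultimately show ?thesis
      using exp_Ln_polar[of z] exp_Ln_polar[of w] False unfolding x1_def x2_def by metis
  qed
qed

lemma homeomorphism_disc_ext:
  assumes "homeomorphism (sphere 0 1) (sphere 0 1) \<phi> \<phi>'" "\<And>x. \<phi> (cis x) = cis (\<sigma> * \<theta> x)"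
  shows "\<exists>h'. homeomorphism (cball 0 1) (cball 0 1) disc_ext h'"
    and "\<And>\<xi>. \<xi> \<in> sphere 0 1 \<Longrightarrow> disc_ext \<xi> = \<phi> \<xi>"
proof -
  show sph: "disc_ext \<xi> = \<phi> \<xi>" if "\<xi> \<in> sphere 0 1" for \<xi>
  proof -
    have "\<xi> = cis (Im (Ln \<xi>))" using that exp_Ln_polar[of \<xi>] by (cases "\<xi> = 0") auto
    then show ?thesis using disc_ext_circle[of "Im (Ln \<xi>)"] assms(2)[of "Im (Ln \<xi>)"] by simp
  qed
  have "disc_ext ` cball 0 1 = cball 0 1"
    using disc_ext_in_cball by (intro continuous_map_cball_surj[OF continuous_disc_ext _ assms(1) sph]) auto
  then show "\<exists>h'. homeomorphism (cball 0 1) (cball 0 1) disc_ext h'"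
    using homeomorphism_compact[OF compact_cball continuous_disc_ext, of 0 1 "cball 0 1"] inj_disc_ext
    by (meson inj_on_subset subset_UNIV)
qed

text \<open>A logarithmic derivative: v / z is the derivative of Ln in the direction v, so x changes
  by a and y by - b; A and B are the resulting changes of the two means.\<close>

definition disc_ext_deriv :: "complex \<Rightarrow> complex \<Rightarrow> complex" where
  "disc_ext_deriv z v =
    (let x = Im (Ln z); y = - Re (Ln z); a = Im (v / z); b = Re (v / z);
         A = mean_dx x y * a - mean_dy x y * b; B = mean_dx x (- y) * a + mean_dy x (- y) * b
     in disc_ext z * (of_real (B - A) + \<i> * of_real (\<sigma> * (A + B) / 2)))"

lemma has_derivative_disc_ext:
  assumes z: "z \<in> ball 0 1" "z \<notin> \<real>\<^sub>\<le>\<^sub>0"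
  shows "(disc_ext has_derivative disc_ext_deriv z) (at z)"
proof -
  define S :: "complex set" where "S = ball 0 1 - \<real>\<^sub>\<le>\<^sub>0"
  have S: "open S" "z \<in> S" using z by (auto simp: S_def open_Diff)
  have ne: "Re (Ln w) < 0" if "w \<in> S" for w
    using that by (cases "w = 0") (auto simp: S_def)
  define X Y where "X = (\<lambda>w. Im (Ln w))" and "Y = (\<lambda>w. - Re (Ln w))"
  define f where "f = (\<lambda>w. (\<Theta> (X w + Y w) - \<Theta> (X w)) / Y w)"
  define g where "g = (\<lambda>w. (\<Theta> (X w + - Y w) - \<Theta> (X w)) / - Y w)"
  have L: "(Ln has_derivative (\<lambda>v. v / z)) (at z)"
  proof -
    have "(*) (inverse z) = (\<lambda>v. v / z)" by (simp add: fun_eq_iff divide_inverse mult.commute)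
    then show ?thesis using has_field_derivative_imp_has_derivative[OF has_field_derivative_Ln[OF z(2)]] by simp
  qed
  have X: "(X has_derivative (\<lambda>v. Im (v / z))) (at z)" unfolding X_def by (rule bounded_linear.has_derivative[OF bounded_linear_Im L])
  have Y: "(Y has_derivative (\<lambda>v. - Re (v / z))) (at z)" unfolding Y_def
    by (intro has_derivative_minus bounded_linear.has_derivative[OF bounded_linear_Re L])
  have Yz: "Y z \<noteq> 0" using ne[OF S(2)] by (simp add: Y_def)
  define A where "A = (\<lambda>v. mean_dx (X z) (Y z) * Im (v / z) - mean_dy (X z) (Y z) * Re (v / z))"
  define B where "B = (\<lambda>v. mean_dx (X z) (- Y z) * Im (v / z) + mean_dy (X z) (- Y z) * Re (v / z))"
  have f: "(f has_derivative A) (at z)"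
    using mean_has_derivative[OF X Y Yz] by (simp add: f_def A_def)
  have g: "(g has_derivative B) (at z)"
    using mean_has_derivative[OF X has_derivative_minus[OF Y]] Yz by (simp add: g_def B_def)
  \<comment> \<open>On S one has y > 0, so the case split in \<open>mean\<close> disappears and the
    extension is a single complex exponential, to which the chain rule applies.\<close>
  define E where "E = (\<lambda>w. exp (of_real (g w - f w) + \<i> * of_real (\<sigma> * (f w + g w) / 2)))"
  have E: "disc_ext w = E w" if "w \<in> S" for w
  proof -
    have "w \<noteq> 0" "Y w \<noteq> 0" using that ne[OF that] by (auto simp: S_def Y_def)
    then have "disc_ext w = strip_ext (X w) (Y w)" "mean (X w) (Y w) = f w" "mean (X w) (- Y w) = g w"
      by (simp_all add: disc_ext_def mean_def f_def g_def X_def Y_def)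
    then have "disc_ext w = of_real (exp (g w - f w)) * cis (\<sigma> * (f w + g w) / 2)" by (simp add: strip_ext_def)
    then show ?thesis by (simp only: E_def exp_add exp_of_real cis_conv_exp)
  qed
  have "((\<lambda>w. of_real (g w - f w) + \<i> * of_real (\<sigma> * (f w + g w) / 2)) has_derivative
      (\<lambda>v. of_real (B v - A v) + \<i> * of_real (\<sigma> * (A v + B v) / 2))) (at z)"
    by (auto intro!: derivative_eq_intros f g)
  from has_derivative_compose[OF this has_field_derivative_imp_has_derivative[OF DERIV_exp]]
  have "(E has_derivative (\<lambda>v. E z * (of_real (B v - A v) + \<i> * of_real (\<sigma> * (A v + B v) / 2)))) (at z)"
    by (simp add: E_def)
  then have "(disc_ext has_derivative (\<lambda>v. E z * (of_real (B v - A v) + \<i> * of_real (\<sigma> * (A v + B v) / 2)))) (at z)"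
    by (rule has_derivative_transform_within_open[OF _ S]) (simp add: E)
  moreover have "(\<lambda>v. E z * (of_real (B v - A v) + \<i> * of_real (\<sigma> * (A v + B v) / 2))) = disc_ext_deriv z"
    unfolding disc_ext_deriv_def Let_def A_def B_def X_def Y_def E[OF S(2), symmetric] by simp
  ultimately show ?thesis by simp
qed

text \<open>A and B are at most 2 |v / z| times the respective \<open>mean_dx\<close>, and |B - A| +
  |A + B| / 2 \<le> (3/2) (|A| + |B|), which explains the 3. The factor e^(2 pi) |z| is the bound on
  the extension itself and removes the denominator of v / z.\<close>

lemma norm_disc_ext_deriv:
  assumes z: "z \<in> ball 0 1" "z \<noteq> 0"
  shows "cmod (disc_ext_deriv z v) \<le>
    3 * exp (2 * pi) * (mean_dx (Im (Ln z)) (- Re (Ln z)) + mean_dx (Im (Ln z)) (Re (Ln z))) * cmod v"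
proof -
  define x y where "x = Im (Ln z)" and "y = - Re (Ln z)"
  define a b where "a = Im (v / z)" and "b = Re (v / z)"
  define A where "A = mean_dx x y * a - mean_dy x y * b"
  define B where "B = mean_dx x (- y) * a + mean_dy x (- y) * b"
  define w where "w = cmod (v / z)"
  have y: "y \<noteq> 0" "- y \<noteq> 0" using z by (auto simp: y_def)
  have ab: "\<bar>a\<bar> \<le> w" "\<bar>b\<bar> \<le> w" by (simp_all only: a_def b_def w_def abs_Im_le_cmod abs_Re_le_cmod)
  have bnd: "\<bar>mean_dx x y * a\<bar> \<le> mean_dx x y * w" "\<bar>mean_dy x y * b\<bar> \<le> mean_dx x y * w" if "y \<noteq> 0" for y
    using mean_dx_pos[OF that, of x] mean_dy_pos[OF that, of x] mean_dy_le[OF that, of x] ab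
    by (auto simp: abs_mult intro!: mult_mono)
  have A: "\<bar>A\<bar> \<le> 2 * mean_dx x y * w" unfolding A_def using bnd[OF y(1)] by linarith
  have B: "\<bar>B\<bar> \<le> 2 * mean_dx x (- y) * w" unfolding B_def using bnd[OF y(2)] by linarith
  have "cmod (of_real (B - A) + \<i> * of_real (\<sigma> * (A + B) / 2)) \<le> cmod (of_real (B - A)) + cmod (\<i> * of_real (\<sigma> * (A + B) / 2))"
    by (rule norm_triangle_ineq)
  also have "\<dots> = \<bar>B - A\<bar> + \<bar>A + B\<bar> / 2" using \<sigma> by (auto simp: norm_mult simp del: of_real_diff of_real_add)
  also have "\<dots> \<le> 3 * (mean_dx x y + mean_dx x (- y)) * w"
  proof -
    have "\<bar>B - A\<bar> \<le> \<bar>A\<bar> + \<bar>B\<bar>" "\<bar>A + B\<bar> \<le> \<bar>A\<bar> + \<bar>B\<bar>" by simp_all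
    moreover define P Q where "P = mean_dx x y * w" and "Q = mean_dx x (- y) * w"
    moreover have "3 * (mean_dx x y + mean_dx x (- y)) * w = 3 * P + 3 * Q"
      unfolding P_def Q_def by (simp add: distrib_left distrib_right)
    moreover have "\<bar>A\<bar> \<le> 2 * P" "\<bar>B\<bar> \<le> 2 * Q" using A B by (simp_all add: P_def Q_def mult.assoc)
    ultimately show ?thesis by linarith
  qed
  finally have *: "cmod (of_real (B - A) + \<i> * of_real (\<sigma> * (A + B) / 2)) \<le> 3 * (mean_dx x y + mean_dx x (- y)) * w" .
  have m: "0 \<le> mean_dx x y + mean_dx x (- y)" using mean_dx_pos[OF y(1), of x] mean_dx_pos[OF y(2), of x] by simp
  have "cmod (disc_ext_deriv z v) = cmod (disc_ext z) * cmod (of_real (B - A) + \<i> * of_real (\<sigma> * (A + B) / 2))"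
    unfolding disc_ext_deriv_def Let_def A_def B_def x_def y_def a_def b_def by (simp only: norm_mult)
  also have "\<dots> \<le> (exp (2 * pi) * cmod z) * (3 * (mean_dx x y + mean_dx x (- y)) * w)"
    using z * by (intro mult_mono norm_disc_ext_le) auto
  also have "\<dots> = 3 * exp (2 * pi) * (mean_dx x y + mean_dx x (- y)) * cmod v"
    using z by (simp add: w_def norm_divide)
  finally show ?thesis by (simp add: x_def y_def)
qed

lemma bounded_linear_disc_ext_deriv: "bounded_linear (disc_ext_deriv z)"
proof -
  have a: "bounded_linear (\<lambda>v. Im (v / z))" and b: "bounded_linear (\<lambda>v. Re (v / z))"
    by (intro bounded_linear_compose[OF bounded_linear_Im] bounded_linear_compose[OF bounded_linear_Re] bounded_linear_divide)+
  define A where "A = (\<lambda>v. mean_dx (Im (Ln z)) (- Re (Ln z)) * Im (v / z) - mean_dy (Im (Ln z)) (- Re (Ln z)) * Re (v / z))"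
  define B where "B = (\<lambda>v. mean_dx (Im (Ln z)) (- (- Re (Ln z))) * Im (v / z) + mean_dy (Im (Ln z)) (- (- Re (Ln z))) * Re (v / z))"
  have A: "bounded_linear A" and B: "bounded_linear B"
    unfolding A_def B_def by (intro bounded_linear_add bounded_linear_sub bounded_linear_const_mult a b)+
  have "bounded_linear (\<lambda>v. disc_ext z * (of_real (B v - A v) + \<i> * of_real ((\<sigma> / 2) * (A v + B v))))"
    by (intro bounded_linear_const_mult bounded_linear_add bounded_linear_compose[OF bounded_linear_of_real] bounded_linear_sub A B)
  moreover have "(\<lambda>v. disc_ext z * (of_real (B v - A v) + \<i> * of_real ((\<sigma> / 2) * (A v + B v)))) = disc_ext_deriv z"
    unfolding disc_ext_deriv_def Let_def A_def B_def by simp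
  ultimately show ?thesis by simp
qed

lemma continuous_disc_ext_deriv: "continuous_on (ball 0 1 - \<real>\<^sub>\<le>\<^sub>0) (\<lambda>z. disc_ext_deriv z v)"
proof -
  have ne: "Re (Ln w) \<noteq> 0" if "w \<in> ball 0 1 - \<real>\<^sub>\<le>\<^sub>0" for w
    using that by (cases "w = 0") auto
  show ?thesis
    unfolding disc_ext_deriv_def Let_def mean_dx_def mean_dy_def
    by (intro continuous_intros continuous_disc_ext) (use ne in auto)
qed

end

section \<open>Weak differentiability and the modular of the extension\<close>

lemma lborel_complex_Fubini:
  fixes g :: "complex \<Rightarrow> 'b::{banach, second_countable_topology}"
  assumes g: "integrable lborel g"
  shows integral_complex_xy: "(LINT z|lborel. g z) = (LINT x|lborel. LINT y|lborel. g (Complex x y))"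
    and integral_complex_yx: "(LINT z|lborel. g z) = (LINT y|lborel. LINT x|lborel. g (Complex x y))"
    and AE_integrable_complex_x: "AE x in lborel. integrable lborel (\<lambda>y. g (Complex x y))"
    and AE_integrable_complex_y: "AE y in lborel. integrable lborel (\<lambda>x. g (Complex x y))"
proof -
  let ?C = "\<lambda>p. Complex (fst p) (snd p)"
  have [measurable]: "g \<in> borel_measurable borel" using g by auto
  have d: "distr (lborel \<Otimes>\<^sub>M lborel) borel ?C = lborel"
    using lborel_complex by (simp add: lborel_prod case_prod_beta')
  have m: "?C \<in> lborel \<Otimes>\<^sub>M lborel \<rightarrow>\<^sub>M borel" by measurable
  have i: "integrable (lborel \<Otimes>\<^sub>M lborel) (\<lambda>(x, y). g (Complex x y))"
    using g by (subst (asm) d[symmetric], subst (asm) integrable_distr_eq[OF m]) (auto simp: case_prod_beta')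
  have e: "(LINT z|lborel. g z) = (LINT p|(lborel \<Otimes>\<^sub>M lborel). (case p of (x, y) \<Rightarrow> g (Complex x y)))"
    by (subst d[symmetric], subst integral_distr[OF m]) (auto simp: case_prod_beta')
  show "(LINT z|lborel. g z) = (LINT x|lborel. LINT y|lborel. g (Complex x y))"
    unfolding e by (rule lborel_pair.integral_fst[OF i, symmetric])
  show "(LINT z|lborel. g z) = (LINT y|lborel. LINT x|lborel. g (Complex x y))"
    unfolding e by (rule lborel_pair.integral_snd[OF i, symmetric])
  show "AE x in lborel. integrable lborel (\<lambda>y. g (Complex x y))"
    by (rule lborel_pair.AE_integrable_fst[OF i])
  show "AE y in lborel. integrable lborel (\<lambda>x. g (Complex x y))"
    by (rule lborel_pair.AE_integrable_snd[OF i])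
qed

text \<open>For continuous F the fundamental theorem tolerates an exceptional point c. It yields a
  gauge integral; the assumed integrability identifies it with the Lebesgue integral.\<close>

lemma integral_derivative_compact_support:
  fixes F :: "real \<Rightarrow> 'a::euclidean_space"
  assumes F: "continuous_on UNIV F" and d: "\<And>x. x \<noteq> c \<Longrightarrow> (F has_vector_derivative F' x) (at x)"
    and i: "integrable lborel F'" and supp: "\<And>x. R \<le> \<bar>x\<bar> \<Longrightarrow> F x = 0" "\<And>x. R \<le> \<bar>x\<bar> \<Longrightarrow> F' x = 0"
  shows "(LINT x|lborel. F' x) = 0"
proof -
  have "(F' has_integral (F \<bar>R\<bar> - F (- \<bar>R\<bar>))) {- \<bar>R\<bar>..\<bar>R\<bar>}"
    by (rule fundamental_theorem_of_calculus_strong[where S="{c}"])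
       (auto intro: d continuous_on_subset[OF F])
  then have "(F' has_integral 0) {- \<bar>R\<bar>..\<bar>R\<bar>}" using supp(1)[of "\<bar>R\<bar>"] supp(1)[of "- \<bar>R\<bar>"] by simp
  then have "(F' has_integral 0) UNIV"
  proof (rule has_integral_on_superset)
    fix x :: real assume "x \<notin> {- \<bar>R\<bar>..\<bar>R\<bar>}"
    then have "R \<le> \<bar>x\<bar>" by auto
    then show "F' x = 0" by (rule supp(2))
  qed simp
  moreover have "(F' has_integral (LINT x|lborel. F' x)) UNIV" by (rule has_integral_integral_lborel[OF i])
  ultimately show ?thesis by (rule has_integral_unique[symmetric])
qed

lemma test_functionD:
  assumes "test_function U \<psi>"
  shows "\<psi> differentiable (at x)" "continuous_on UNIV \<psi>" "continuous_on UNIV (\<lambda>x. frechet_derivative \<psi> (at x) v)"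
proof -
  have "C_k (Suc 0) \<psi>" "C_k 0 \<psi>" using assms by (auto simp: test_function_def)
  then show "\<psi> differentiable (at x)" "continuous_on UNIV \<psi>" "continuous_on UNIV (\<lambda>x. frechet_derivative \<psi> (at x) v)" by auto
qed

text \<open>Continuity across the real axis suffices: almost every horizontal line misses the axis, and
  every vertical line meets it in one point, which the fundamental theorem of calculus tolerates.\<close>

lemma has_weak_derivative_off_axis:
  fixes f :: "complex \<Rightarrow> complex"
  assumes f: "continuous_on UNIV f"
    and df: "\<And>z. z \<in> U \<Longrightarrow> Im z \<noteq> 0 \<Longrightarrow> (f has_derivative blinfun_apply (D z)) (at z)"
    and U: "U \<in> sets borel"
    and int: "\<And>v. set_integrable lborel U (\<lambda>z. blinfun_apply (D z) v)"
  shows "has_weak_derivative f D U"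
  unfolding has_weak_derivative_def
proof (intro conjI allI impI)
  fix K :: "complex set" assume K: "compact K \<and> K \<subseteq> U"
  have "set_integrable lborel K f"
    unfolding set_integrable_def using K by (intro borel_integrable_compact continuous_on_subset[OF f]) auto
  then show "set_integrable lebesgue K f"
    by (simp add: set_integrable_def integrable_completion borel_measurable_integrable)
  show "set_integrable lebesgue K (\<lambda>x. blinfun_apply (D x) v)" for v
  proof -
    have "set_integrable lborel K (\<lambda>x. blinfun_apply (D x) v)"
      by (rule set_integrable_subset[OF int]) (use K borel_compact in auto)
    then show ?thesis by (simp add: set_integrable_def integrable_completion borel_measurable_integrable)
  qed
next
  fix \<psi> :: "complex \<Rightarrow> real" and v :: complex
  assume \<psi>: "test_function U \<psi>"
  define S where "S = closure {x. \<psi> x \<noteq> 0}"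
  have S: "compact S" "S \<subseteq> U" "closed S" using \<psi> by (auto simp: test_function_def S_def)
  define d\<psi> where "d\<psi> = (\<lambda>z. frechet_derivative \<psi> (at z))"
  have d\<psi>: "(\<psi> has_derivative d\<psi> z) (at z)" for z
    using test_functionD(1)[OF \<psi>] by (simp add: d\<psi>_def frechet_derivative_works[symmetric])
  have \<psi>0: "\<psi> z = 0" if "z \<notin> S" for z using that closure_subset[of "{x. \<psi> x \<noteq> 0}"] by (auto simp: S_def)
  have d\<psi>0: "d\<psi> z = (\<lambda>v. 0)" if "z \<notin> S" for z
  proof -
    have "(\<psi> has_derivative (\<lambda>v. 0)) (at z)"
      by (rule has_derivative_transform_within_open[of "\<lambda>_. 0" _ _ _ "- S"]) (use that S(3) \<psi>0 in auto)
    then show ?thesis using has_derivative_unique[OF d\<psi>] by blast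
  qed
  \<comment> \<open>With the product P = \<psi> f, which vanishes outside a compact set, the
    identity to be shown says that the integral of the derivative P' v over the plane is 0.\<close>
  define P where "P = (\<lambda>z. \<psi> z *\<^sub>R f z)"
  define P' where "P' = (\<lambda>v z. d\<psi> z v *\<^sub>R f z + \<psi> z *\<^sub>R blinfun_apply (D z) v)"
  have Pc: "continuous_on UNIV P" unfolding P_def by (intro continuous_intros test_functionD(2)[OF \<psi>] f)
  have dP: "(P has_derivative (\<lambda>v. P' v z)) (at z)" if "Im z \<noteq> 0" for z
  proof (cases "z \<in> S")
    case True
    then have "(f has_derivative blinfun_apply (D z)) (at z)" using df that S by blast
    from has_derivative_scaleR[OF d\<psi> this] show ?thesis by (simp add: P_def P'_def add.commute)
  next
    case False
    have "(P has_derivative (\<lambda>v. 0)) (at z)"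
      by (rule has_derivative_transform_within_open[of "\<lambda>_. 0" _ _ _ "- S"]) (use False S(3) \<psi>0 in \<open>auto simp: P_def\<close>)
    then show ?thesis using False by (simp add: P'_def \<psi>0 d\<psi>0)
  qed
  obtain R where R: "\<And>z. z \<in> S \<Longrightarrow> cmod z < R"
    using compact_imp_bounded[OF S(1)] by (metis bounded_pos_less)
  have P0: "P z = 0" "P' v z = 0" if "R \<le> cmod z" for z v
  proof -
    have "z \<notin> S" using R[of z] that by auto
    then show "P z = 0" "P' v z = 0" using \<psi>0[of z] d\<psi>0[of z] by (simp_all add: P_def P'_def)
  qed
  have i1: "integrable lborel (\<lambda>z. d\<psi> z v *\<^sub>R f z)" for v
  proof -
    have "integrable lborel (\<lambda>z. indicator S z *\<^sub>R (d\<psi> z v *\<^sub>R f z))"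
      unfolding d\<psi>_def
      by (intro borel_integrable_compact S continuous_intros continuous_on_subset[OF test_functionD(3)[OF \<psi>]] continuous_on_subset[OF f]) auto
    moreover have "indicator S z *\<^sub>R (d\<psi> z v *\<^sub>R f z) = d\<psi> z v *\<^sub>R f z" for z
      using d\<psi>0[of z] by (cases "z \<in> S") auto
    ultimately show ?thesis by (simp only:)
  qed
  have i2: "integrable lborel (\<lambda>z. \<psi> z *\<^sub>R blinfun_apply (D z) v)" for v
  proof -
    have "compact (\<psi> ` S)" by (intro compact_continuous_image S continuous_on_subset[OF test_functionD(2)[OF \<psi>]]) auto
    then obtain B where B: "\<And>z. z \<in> S \<Longrightarrow> \<bar>\<psi> z\<bar> \<le> B" by (force dest!: compact_imp_bounded simp: bounded_iff)
    have [measurable]: "\<psi> \<in> borel_measurable borel" by (rule borel_measurable_continuous_onI[OF test_functionD(2)[OF \<psi>]])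
    have iD: "integrable lborel (\<lambda>z. indicator U z *\<^sub>R blinfun_apply (D z) v)"
      using int[of v] by (simp add: set_integrable_def)
    have "integrable lborel (\<lambda>z. \<psi> z *\<^sub>R (indicator U z *\<^sub>R blinfun_apply (D z) v))"
    proof (rule Bochner_Integration.integrable_bound)
      show "integrable lborel (\<lambda>z. B *\<^sub>R (indicator U z *\<^sub>R blinfun_apply (D z) v))" using iD by (rule integrable_scaleR_right)
      show "(\<lambda>z. \<psi> z *\<^sub>R (indicator U z *\<^sub>R blinfun_apply (D z) v)) \<in> borel_measurable lborel"
        by (intro borel_measurable_scaleR borel_measurable_integrable[OF iD]) auto
      show "AE z in lborel. norm (\<psi> z *\<^sub>R (indicator U z *\<^sub>R blinfun_apply (D z) v)) \<le> norm (B *\<^sub>R (indicator U z *\<^sub>R blinfun_apply (D z) v))"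
      proof (rule AE_I2)
        fix z
        have "\<bar>\<psi> z\<bar> \<le> \<bar>B\<bar>" using B[of z] \<psi>0[of z] by (cases "z \<in> S") auto
        then show "norm (\<psi> z *\<^sub>R (indicator U z *\<^sub>R blinfun_apply (D z) v)) \<le> norm (B *\<^sub>R (indicator U z *\<^sub>R blinfun_apply (D z) v))"
          unfolding norm_scaleR by (intro mult_right_mono) auto
      qed
    qed
    moreover have "\<psi> z *\<^sub>R (indicator U z *\<^sub>R blinfun_apply (D z) v) = \<psi> z *\<^sub>R blinfun_apply (D z) v" for z
      using \<psi>0[of z] S(2) by (cases "z \<in> S") auto
    ultimately show ?thesis by (simp only:)
  qed
  have iP: "integrable lborel (P' v)" for v
    unfolding P'_def by (intro Bochner_Integration.integrable_add i1 i2)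
  have lin: "P' (of_real h * w) z = h *\<^sub>R P' w z" for h w z
  proof -
    have "of_real h * w = h *\<^sub>R w" by (simp add: scaleR_conv_of_real)
    then show ?thesis
      using linear_scale[OF has_derivative_linear[OF d\<psi>[of z]], of h w]
      by (simp add: P'_def blinfun.scaleR_right scaleR_add_right mult.commute)
  qed
  have line: "((\<lambda>t. P (a + of_real t * w)) has_vector_derivative P' w (a + of_real t * w)) (at t)" if "Im (a + of_real t * w) \<noteq> 0" for a w t
  proof -
    have "((\<lambda>t. a + of_real t * w) has_derivative (\<lambda>h. of_real h * w)) (at t)"
      by (auto intro!: derivative_eq_intros)
    from has_derivative_compose[OF this dP[OF that]]
    show ?thesis by (simp add: has_vector_derivative_def lin)
  qed
  have C1: "Complex x y = of_real y * \<i> + of_real x * 1" and C2: "Complex x y = of_real x + of_real y * \<i>" for x y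
    by (simp_all add: complex_eq_iff)
  have "(LINT x|lborel. P' 1 (Complex x y)) = 0" if "y \<noteq> 0" "integrable lborel (\<lambda>x. P' 1 (Complex x y))" for y
  proof (rule integral_derivative_compact_support[OF _ _ that(2)])
    show "continuous_on UNIV (\<lambda>x. P (Complex x y))"
      unfolding C1 by (intro continuous_on_compose2[OF Pc] continuous_intros) auto
    show "((\<lambda>x. P (Complex x y)) has_vector_derivative P' 1 (Complex x y)) (at x)" for x
      unfolding C1 by (rule line) (use that in simp)
    show "P (Complex x y) = 0" "P' 1 (Complex x y) = 0" if "R \<le> \<bar>x\<bar>" for x
      using P0[of "Complex x y"] abs_Re_le_cmod[of "Complex x y"] that by auto
  qed
  moreover have "AE y in lborel. y \<noteq> (0::real)" by (rule AE_lborel_singleton)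
  ultimately have "AE y in lborel. (LINT x|lborel. P' 1 (Complex x y)) = 0"
    using AE_integrable_complex_y[OF iP[of 1]] by auto
  then have z1: "(LINT z|lborel. P' 1 z) = 0"
    unfolding integral_complex_yx[OF iP] by (rule integral_eq_zero_AE)
  have "(LINT y|lborel. P' \<i> (Complex x y)) = 0" if "integrable lborel (\<lambda>y. P' \<i> (Complex x y))" for x
  proof (rule integral_derivative_compact_support[OF _ _ that])
    show "continuous_on UNIV (\<lambda>y. P (Complex x y))"
      unfolding C2 by (intro continuous_on_compose2[OF Pc] continuous_intros) auto
    show "((\<lambda>y. P (Complex x y)) has_vector_derivative P' \<i> (Complex x y)) (at y)" if "y \<noteq> 0" for y
      unfolding C2 by (rule line) (use that in simp)
    show "P (Complex x y) = 0" "P' \<i> (Complex x y) = 0" if "R \<le> \<bar>y\<bar>" for y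
      using P0[of "Complex x y"] abs_Im_le_cmod[of "Complex x y"] that by auto
  qed
  then have "AE x in lborel. (LINT y|lborel. P' \<i> (Complex x y)) = 0"
    using AE_integrable_complex_x[OF iP[of \<i>]] by auto
  then have z2: "(LINT z|lborel. P' \<i> z) = 0"
    unfolding integral_complex_xy[OF iP] by (rule integral_eq_zero_AE)
  \<comment> \<open>The two coordinate directions suffice by linearity, also on the axis, where P'
    is only a formula and not a derivative.\<close>
  have "P' v z = Re v *\<^sub>R P' 1 z + Im v *\<^sub>R P' \<i> z" for z
  proof -
    have v: "v = of_real (Re v) * 1 + of_real (Im v) * \<i>" by (simp add: complex_eq_iff)
    have "P' (of_real (Re v) * 1 + of_real (Im v) * \<i>) z = P' (of_real (Re v) * 1) z + P' (of_real (Im v) * \<i>) z"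
      using linear_add[OF has_derivative_linear[OF d\<psi>[of z]]]
      by (simp add: P'_def blinfun.add_right scaleR_add_left scaleR_add_right)
    then show ?thesis unfolding lin using v by simp
  qed
  then have "(LINT z|lborel. P' v z) = Re v *\<^sub>R (LINT z|lborel. P' 1 z) + Im v *\<^sub>R (LINT z|lborel. P' \<i> z)"
    by (simp add: iP)
  then have "(LINT z|lborel. P' v z) = 0" by (simp only: z1 z2 scaleR_zero_right add_0)
  then have "(LINT z|lborel. d\<psi> z v *\<^sub>R f z) + (LINT z|lborel. \<psi> z *\<^sub>R blinfun_apply (D z) v) = 0"
    unfolding P'_def by (simp add: i1 i2)
  then have eq: "(LINT z|lborel. d\<psi> z v *\<^sub>R f z) = - (LINT z|lborel. \<psi> z *\<^sub>R blinfun_apply (D z) v)"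
    by (simp add: eq_neg_iff_add_eq_0)
  have "(LINT x:U|lebesgue. frechet_derivative \<psi> (at x) v *\<^sub>R f x) = (LINT z|lborel. d\<psi> z v *\<^sub>R f z)"
  proof -
    have "(LINT x:U|lebesgue. frechet_derivative \<psi> (at x) v *\<^sub>R f x) = (LINT z|lebesgue. d\<psi> z v *\<^sub>R f z)"
      unfolding set_lebesgue_integral_def
    proof (rule Bochner_Integration.integral_cong[OF refl])
      fix z
      show "indicat_real U z *\<^sub>R (frechet_derivative \<psi> (at z) v *\<^sub>R f z) = d\<psi> z v *\<^sub>R f z"
        using d\<psi>0[of z] S(2) by (cases "z \<in> S") (auto simp: d\<psi>_def)
    qed
    then show ?thesis using i1[of v] by (simp add: integral_completion borel_measurable_integrable)
  qed
  moreover have "(LINT x:U|lebesgue. \<psi> x *\<^sub>R blinfun_apply (D x) v) = (LINT z|lborel. \<psi> z *\<^sub>R blinfun_apply (D z) v)"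
  proof -
    have "(LINT x:U|lebesgue. \<psi> x *\<^sub>R blinfun_apply (D x) v) = (LINT z|lebesgue. \<psi> z *\<^sub>R blinfun_apply (D z) v)"
      unfolding set_lebesgue_integral_def
    proof (rule Bochner_Integration.integral_cong[OF refl])
      fix z
      show "indicat_real U z *\<^sub>R (\<psi> z *\<^sub>R blinfun_apply (D z) v) = \<psi> z *\<^sub>R blinfun_apply (D z) v"
        using \<psi>0[of z] S(2) by (cases "z \<in> S") auto
    qed
    then show ?thesis using i2[of v] by (simp add: integral_completion borel_measurable_integrable)
  qed
  ultimately show "(LINT x:U|lebesgue. frechet_derivative \<psi> (at x) v *\<^sub>R f x) = - (LINT x:U|lebesgue. \<psi> x *\<^sub>R blinfun_apply (D x) v)"
    using eq by simp
qed

lemma nn_integral_expand: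
  fixes f :: "real \<Rightarrow> ennreal"
  assumes [measurable]: "f \<in> borel_measurable borel" and c: "1 \<le> \<bar>c\<bar>"
  shows "(\<integral>\<^sup>+x. f (t + c * x) \<partial>lborel) \<le> (\<integral>\<^sup>+x. f x \<partial>lborel)"
proof -
  have "1 * (\<integral>\<^sup>+x. f (t + c * x) \<partial>lborel) \<le> ennreal \<bar>c\<bar> * (\<integral>\<^sup>+x. f (t + c * x) \<partial>lborel)"
    using c by (intro mult_right_mono) (auto simp flip: ennreal_1)
  also have "\<dots> = (\<integral>\<^sup>+x. f x \<partial>lborel)"
    using c by (subst nn_integral_real_affine[of f c t]) auto
  finally show ?thesis by simp
qed

section \<open>The modular of the gradient bound\<close>

context circle_lift
begin

definition spread :: "real \<Rightarrow> real \<Rightarrow> real" where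
  "spread x y = mean_dx x y + mean_dx x (- y)"

lemma spread_eq: "spread x y = (\<theta> (x + y) - \<theta> (x - y)) / y"
  by (cases "y = 0") (auto simp: spread_def mean_dx_def field_simps)

lemma spread_nonneg: "0 \<le> y \<Longrightarrow> 0 \<le> spread x y"
  using \<theta>_le[of "x - y" "x + y"] by (simp add: spread_eq)

lemma \<theta>_shift_int: "\<theta> (x + 2 * pi * of_int k) = \<theta> x + 2 * pi * of_int k"
  using mean_shift_int[of x k 0] by (simp add: mean_def)

lemma spread_shift: "spread (x + 2 * pi * of_int k) y = spread x y"
  using \<theta>_shift_int[of "x + y" k] \<theta>_shift_int[of "x - y" k] by (simp add: spread_eq algebra_simps)

text \<open>Used with t = 1 - r and y = - ln r. Replacing y by 2 t makes the increment affine in r,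
  so the radial integral becomes an integral over the increment s with constant Jacobian.\<close>

lemma spread_double:
  assumes "0 < t" "t \<le> y" "y \<le> 2 * t"
  shows "spread x y \<le> 2 * spread x (2 * t)"
proof -
  have "\<theta> (x - 2 * t) \<le> \<theta> (x - y)" "\<theta> (x + y) \<le> \<theta> (x + 2 * t)" using assms by (auto intro!: \<theta>_le)
  moreover have "\<theta> (x - y) \<le> \<theta> (x + y)" using assms by (intro \<theta>_le) auto
  ultimately have "spread x y \<le> (\<theta> (x + 2 * t) - \<theta> (x - 2 * t)) / t"
    unfolding spread_eq using assms by (intro frac_le) auto
  then show ?thesis using assms by (simp add: spread_eq field_simps)
qed

text \<open>Away from the circle the gradient bound is uniform: \<theta> grows by at most the length
  of an interval plus one period.\<close>

lemma spread_far:
  assumes "0 < \<delta>" "\<delta> \<le> y" shows "spread x y \<le> 2 + 2 * pi / \<delta>"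
proof -
  have up: "\<theta> z \<le> \<theta> w + (z - w) + 2 * pi" for w z
  proof -
    define n where "n = \<lceil>(z - w) / (2 * pi)\<rceil>"
    have "(z - w) / (2 * pi) \<le> of_int n" "of_int n < (z - w) / (2 * pi) + 1" unfolding n_def by linarith+
    then have "z \<le> w + 2 * pi * of_int n" "2 * pi * of_int n \<le> z - w + 2 * pi" by (auto simp: field_simps)
    then show ?thesis using \<theta>_le[of z "w + 2 * pi * of_int n"] by (simp add: \<theta>_shift_int)
  qed
  have "spread x y \<le> (2 * y + 2 * pi) / y"
    unfolding spread_eq using up[of "x + y" "x - y"] assms by (intro divide_right_mono) auto
  also have "\<dots> = 2 + 2 * pi / y" using assms by (simp add: field_simps)
  also have "\<dots> \<le> 2 + 2 * pi / \<delta>" using assms by (intro add_left_mono divide_left_mono) auto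
  finally show ?thesis .
qed

text \<open>For angular increments up to 1 arcs and chords in the image are comparable. Uniform
  continuity on one period, with a margin for x + s, provides the scale.\<close>

lemma near_diagonal:
  obtains \<delta> where "0 < \<delta>" "\<delta> \<le> 1/4" "\<And>x s. 0 \<le> x \<Longrightarrow> x \<le> 2 * pi \<Longrightarrow> \<bar>s\<bar> \<le> 2 * \<delta> \<Longrightarrow> \<bar>\<theta> (x + s) - \<theta> x\<bar> \<le> 1"
proof -
  have "uniformly_continuous_on {-1..2 * pi + 1} \<theta>"
    by (intro compact_uniformly_continuous continuous_on_subset[OF \<theta>_cont]) auto
  then obtain d where d: "d > 0" "\<And>x y. x \<in> {-1..2 * pi + 1} \<Longrightarrow> y \<in> {-1..2 * pi + 1} \<Longrightarrow> dist y x < d \<Longrightarrow> dist (\<theta> y) (\<theta> x) < 1"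
    unfolding uniformly_continuous_on_def by (metis zero_less_one)
  show ?thesis
  proof (rule that[of "min (1/4) (d / 4)"])
    fix x s assume "0 \<le> x" "x \<le> 2 * pi" "\<bar>s\<bar> \<le> 2 * min (1 / 4) (d / 4)"
    then have "\<bar>s\<bar> \<le> 1 / 2" "\<bar>s\<bar> < d" using d(1) by auto
    moreover have "x + s \<in> {-1..2 * pi + 1}" "x \<in> {-1..2 * pi + 1}"
      using \<open>\<bar>s\<bar> \<le> 1 / 2\<close> \<open>0 \<le> x\<close> \<open>x \<le> 2 * pi\<close> by auto
    ultimately show "\<bar>\<theta> (x + s) - \<theta> x\<bar> \<le> 1"
      using d(2)[of x "x + s"] by (simp add: dist_real_def)
  qed (use d(1) in auto)
qed

definition dilation :: "real \<Rightarrow> real \<Rightarrow> real" where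
  "dilation x s = cmod (cis (\<sigma> * \<theta> (x + s)) - cis (\<sigma> * \<theta> x)) / cmod (cis s - 1)"

lemma dilation_nonneg: "0 \<le> dilation x s" by (simp add: dilation_def)

text \<open>In the numerator a chord is at least half its arc, and in the denominator a chord is at
  most its arc.\<close>

lemma mean_dx_le_dilation:
  assumes s: "s \<noteq> 0" "\<bar>s\<bar> \<le> 1" and \<Delta>: "\<bar>\<theta> (x + s) - \<theta> x\<bar> \<le> 1"
  shows "mean_dx x s \<le> 2 * dilation x s"
proof -
  define \<Delta> where "\<Delta> = \<theta> (x + s) - \<theta> x"
  have "mean_dx x s = \<bar>\<Delta>\<bar> / \<bar>s\<bar>"
    using mean_dx_pos[OF s(1), of x] by (simp add: mean_dx_def \<Delta>_def flip: abs_divide)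
  also have "\<dots> = 2 * ((\<bar>\<Delta>\<bar> / 2) / \<bar>s\<bar>)" by simp
  also have "\<dots> \<le> 2 * dilation x s"
  proof -
    have "\<bar>\<Delta>\<bar> / 2 \<le> cmod (cis (\<sigma> * \<Delta>) - 1)"
      using cmod_cis_minus_1_ge[of "\<sigma> * \<Delta>"] \<sigma> \<Delta> by (auto simp: \<Delta>_def abs_mult)
    also have "\<dots> = cmod (cis (\<sigma> * \<theta> (x + s)) - cis (\<sigma> * \<theta> x))"
      using cmod_cis_diff[of "\<sigma> * \<theta> x" "\<sigma> * \<Delta>"] by (simp add: \<Delta>_def algebra_simps)
    finally have num: "\<bar>\<Delta>\<bar> / 2 \<le> cmod (cis (\<sigma> * \<theta> (x + s)) - cis (\<sigma> * \<theta> x))" .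
    have "cmod (cis s - 1) \<le> \<bar>s\<bar>" unfolding cmod_cis_minus_1 using abs_sin_x_le_abs_x[of "s / 2"] by simp
    moreover have "0 < cmod (cis s - 1)" using cmod_cis_minus_1_ge[of s] s by linarith
    ultimately show ?thesis unfolding dilation_def using num by (intro mult_left_mono frac_le) auto
  qed
  finally show ?thesis .
qed

lemma disc_ext_gradient_modular:
  assumes N: "N_function \<Phi>" and d: "doubling \<Phi>" and M: "0 \<le> M"
    and D: "(\<integral>\<^sup>+x\<in>{0..<2 * pi}. (\<integral>\<^sup>+s\<in>{-pi..<pi}. ennreal (\<Phi> (dilation x s)) \<partial>lborel) \<partial>lborel) < \<infinity>"
    and G [measurable]: "G \<in> borel_measurable borel" and G0: "\<And>z. 0 \<le> G z"
    and GM: "\<And>r x. 0 < r \<Longrightarrow> r < 1 \<Longrightarrow> G (of_real r * cis x) \<le> M * spread x (- ln r)"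
  shows "(\<integral>\<^sup>+z\<in>ball 0 1. ennreal (\<Phi> (G z)) \<partial>lborel) < \<infinity>"
proof -
  \<comment> \<open>8 M is M times three factors 2: from \<open>spread_double\<close>, from
    \<open>mean_dx_le_dilation\<close>, and from \<open>N_function_add\<close>.\<close>
  obtain C where C: "C \<ge> 1" "\<And>t. 0 \<le> t \<Longrightarrow> \<Phi> ((8 * M) * t) \<le> C * \<Phi> t"
    using doubling_scale[OF N d, of "8 * M"] M by auto
  obtain \<delta> where \<delta>: "0 < \<delta>" "\<delta> \<le> 1/4" "\<And>x s. 0 \<le> x \<Longrightarrow> x \<le> 2 * pi \<Longrightarrow> \<bar>s\<bar> \<le> 2 * \<delta> \<Longrightarrow> \<bar>\<theta> (x + s) - \<theta> x\<bar> \<le> 1"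
    by (rule near_diagonal) (erule that)
  define K where "K = \<Phi> (M * (2 + 2 * pi / \<delta>))"
  define W where "W = (\<lambda>x s. ennreal (\<Phi> (dilation x s)))"
  have K0: "0 \<le> K" unfolding K_def using M \<delta> by (intro N_function_nonneg[OF N]) auto
  have [measurable]: "\<theta> \<in> borel_measurable borel" by (rule borel_measurable_continuous_onI[OF \<theta>_cont])
  have Wm [measurable]: "(\<lambda>p. W (f p) (g p)) \<in> borel_measurable N"
    if [measurable]: "f \<in> borel_measurable N" "g \<in> borel_measurable N" for f g and N :: "'z measure"
  proof -
    have "(\<lambda>p. \<Phi> (dilation (f p) (g p))) \<in> borel_measurable N"
      by (rule borel_measurable_N_function[OF assms(1)]) (auto simp: dilation_def)
    then show ?thesis unfolding W_def by measurable
  qed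
  have near: "\<Phi> (M * spread x y) \<le> C * (\<Phi> (dilation x (2 * t)) + \<Phi> (dilation x (- 2 * t)))"
    if x: "0 \<le> x" "x \<le> 2 * pi" and t: "0 < t" "t < \<delta>" and y: "t \<le> y" "y \<le> 2 * t" for x y t
  proof -
    have q: "mean_dx x (2 * t) \<le> 2 * dilation x (2 * t)" "mean_dx x (- (2 * t)) \<le> 2 * dilation x (- 2 * t)"
      using mean_dx_le_dilation[of "2 * t" x] mean_dx_le_dilation[of "- 2 * t" x] \<delta>(3)[of x "2 * t"] \<delta>(3)[of x "- 2 * t"] \<delta>(2) x t by auto
    have "spread x y \<le> 2 * spread x (2 * t)" by (rule spread_double[OF t(1) y])
    also have "\<dots> \<le> 4 * dilation x (2 * t) + 4 * dilation x (- 2 * t)" using q by (simp add: spread_def)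
    finally have "M * spread x y \<le> M * (4 * dilation x (2 * t) + 4 * dilation x (- 2 * t))" using M by (rule mult_left_mono)
    then have "\<Phi> (M * spread x y) \<le> \<Phi> (4 * M * dilation x (2 * t) + 4 * M * dilation x (- 2 * t))"
      using M t y spread_nonneg[of y x] by (intro N_function_mono[OF N]) (auto simp: algebra_simps)
    also have "\<dots> \<le> \<Phi> (2 * (4 * M * dilation x (2 * t))) + \<Phi> (2 * (4 * M * dilation x (- 2 * t)))"
      using M dilation_nonneg by (intro N_function_add[OF N]) auto
    also have "\<dots> \<le> C * \<Phi> (dilation x (2 * t)) + C * \<Phi> (dilation x (- 2 * t))"
      using C(2)[OF dilation_nonneg[of x "2 * t"]] C(2)[OF dilation_nonneg[of x "- 2 * t"]] by (simp add: mult.assoc)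
    finally show ?thesis by (simp add: distrib_left)
  qed
  \<comment> \<open>K is the contribution far from the circle, W the one near it. The arguments
    \<plusminus> 2 t are written as affine functions of r for the substitution in
    \<open>slice\<close>.\<close>
  have point: "ennreal (\<Phi> (G (of_real r * cis x))) \<le> ennreal K + ennreal C * (W x (2 + -2 * r) * indicator {-pi..<pi} (2 + -2 * r) + W x (-2 + 2 * r) * indicator {-pi..<pi} (-2 + 2 * r))"
    if x: "x \<in> {0..<2 * pi}" and r: "r \<in> {0<..<1}" for x r
  proof -
    define t where "t = 1 - r"
    define y where "y = - ln r"
    have t: "0 < t" "t < 1" using r by (auto simp: t_def)
    have ty: "t \<le> y" using ln_le_minus_one[of r] r by (simp add: t_def y_def)
    have "\<Phi> (G (of_real r * cis x)) \<le> \<Phi> (M * spread x y)"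
      using GM[of r x] r by (intro N_function_mono[OF N G0]) (auto simp: y_def)
    then have *: "ennreal (\<Phi> (G (of_real r * cis x))) \<le> ennreal (\<Phi> (M * spread x y))" by (rule ennreal_leI)
    show ?thesis
    proof (cases "t < \<delta>")
      case True
      \<comment> \<open>From ln (1 / r) \<le> 1 / r - 1 = t / r, where r \<ge> 1/2 because t <
        \<delta> \<le> 1/4.\<close>
      have "y \<le> 2 * t"
      proof -
        have "y = ln (1 / r)" using r by (simp add: y_def ln_div)
        also have "\<dots> \<le> 1 / r - 1" using r by (intro ln_le_minus_one) auto
        also have "\<dots> = t / r" using r by (simp add: t_def field_simps)
        also have "\<dots> \<le> t / (1/2)" using r t True \<delta>(2) by (intro divide_left_mono) (auto simp: t_def)
        finally show ?thesis by simp
      qed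
      then have "ennreal (\<Phi> (M * spread x y)) \<le> ennreal (C * (\<Phi> (dilation x (2 * t)) + \<Phi> (dilation x (- 2 * t))))"
        using x t True ty by (intro ennreal_leI near) auto
      also have "\<dots> = ennreal C * (W x (2 * t) + W x (- 2 * t))"
        using C(1) N_function_nonneg[OF N dilation_nonneg] by (simp add: W_def ennreal_mult)
      also have "\<dots> = ennreal C * (W x (2 + -2 * r) * indicator {-pi..<pi} (2 + -2 * r) + W x (-2 + 2 * r) * indicator {-pi..<pi} (-2 + 2 * r))"
      proof -
        have e: "2 + -2 * r = 2 * t" "-2 + 2 * r = - 2 * t" by (auto simp: t_def)
        have "2 * t \<in> {-pi..<pi}" "- 2 * t \<in> {-pi..<pi}" using t True \<delta>(2) pi_gt3 by auto
        then show ?thesis unfolding e by simp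
      qed
      finally show ?thesis using * by (intro add_increasing) auto
    next
      case False
      then have "spread x y \<le> 2 + 2 * pi / \<delta>" using ty \<delta>(1) by (intro spread_far) auto
      then have "\<Phi> (M * spread x y) \<le> K"
        unfolding K_def using M ty t spread_nonneg[of y x] by (intro N_function_mono[OF N] mult_left_mono mult_nonneg_nonneg) auto
      then have "ennreal (\<Phi> (M * spread x y)) \<le> ennreal K" by (rule ennreal_leI)
      with * show ?thesis by (intro add_increasing2) auto
    qed
  qed
  define I where "I = (\<integral>\<^sup>+x\<in>{0..<2 * pi}. (\<integral>\<^sup>+s\<in>{-pi..<pi}. W x s \<partial>lborel) \<partial>lborel)"
  have If: "I < \<infinity>" using D by (simp add: I_def W_def)
  let ?V = "\<lambda>a c r x. W x (a + c * r) * indicator {-pi..<pi} (a + c * r)"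
  \<comment> \<open>The substitution s = a + c r, used with c = \<plusminus> 2, expands lengths, so
    dropping its Jacobian only enlarges the bound. The indicator keeps s in the range of the Douglas
    integral.\<close>
  have slice: "(\<integral>\<^sup>+r\<in>UNIV. (\<integral>\<^sup>+x\<in>{0..<2 * pi}. ?V a c r x \<partial>lborel) \<partial>lborel) \<le> I" if c: "1 \<le> \<bar>c\<bar>" for a c
  proof -
    have "(\<integral>\<^sup>+r\<in>UNIV. (\<integral>\<^sup>+x\<in>{0..<2 * pi}. ?V a c r x \<partial>lborel) \<partial>lborel)
      = (\<integral>\<^sup>+x\<in>{0..<2 * pi}. (\<integral>\<^sup>+r\<in>UNIV. ?V a c r x \<partial>lborel) \<partial>lborel)"
    proof -
      have "(\<lambda>(r, x). ?V a c r x) \<in> borel_measurable (borel \<Otimes>\<^sub>M borel)" by measurable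
      then show ?thesis by (rule set_nn_integral_swap) (rule borel_open open_UNIV atLeastLessThan_borel)+
    qed
    also have "\<dots> \<le> I"
      unfolding I_def indicator_UNIV mult_1_right
      by (intro nn_integral_mono mult_right_mono nn_integral_expand[where f="\<lambda>s. W _ s * indicator {-pi..<pi} s"] c) auto
    finally show ?thesis .
  qed
  have [measurable]: "(\<lambda>z. \<Phi> (G z)) \<in> borel_measurable borel"
    by (rule borel_measurable_N_function[OF N G]) (rule G0)
  have "(\<integral>\<^sup>+z\<in>ball 0 1. ennreal (\<Phi> (G z)) \<partial>lborel) =
    (\<integral>\<^sup>+r\<in>{0<..<1}. ennreal r * (\<integral>\<^sup>+x\<in>{0..<2 * pi}. ennreal (\<Phi> (G (of_real r * cis x))) \<partial>lborel) \<partial>lborel)"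
    by (rule nn_integral_polar) measurable
  also have "\<dots> \<le> (\<integral>\<^sup>+r. ennreal (2 * pi * K) * indicator {0<..<1} r + ennreal C * ((\<integral>\<^sup>+x\<in>{0..<2 * pi}. ?V 2 (-2) r x \<partial>lborel)
      + (\<integral>\<^sup>+x\<in>{0..<2 * pi}. ?V (-2) 2 r x \<partial>lborel)) \<partial>lborel)"
  proof (rule nn_integral_mono)
    fix r :: real
    let ?A = "\<integral>\<^sup>+x\<in>{0..<2 * pi}. ?V 2 (-2) r x \<partial>lborel"
    let ?B = "\<integral>\<^sup>+x\<in>{0..<2 * pi}. ?V (-2) 2 r x \<partial>lborel"
    let ?g = "\<integral>\<^sup>+x\<in>{0..<2 * pi}. ennreal (\<Phi> (G (of_real r * cis x))) \<partial>lborel"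
    show "ennreal r * ?g * indicator {0<..<1} r \<le> ennreal (2 * pi * K) * indicator {0<..<1} r + ennreal C * (?A + ?B)"
    proof (cases "r \<in> {0<..<1}")
      case True
      have "ennreal r * ?g \<le> 1 * ?g"
        using True by (intro mult_right_mono) (auto simp flip: ennreal_1)
      also have "\<dots> \<le> (\<integral>\<^sup>+x. ennreal K * indicator {0..<2 * pi} x
          + ennreal C * (?V 2 (-2) r x * indicator {0..<2 * pi} x + ?V (-2) 2 r x * indicator {0..<2 * pi} x) \<partial>lborel)"
        unfolding mult_1 using point[OF _ True] by (intro nn_integral_mono) (auto split: split_indicator)
      also have "\<dots> = ennreal (2 * pi * K) + ennreal C * (?A + ?B)"
      proof -
        have "(\<integral>\<^sup>+x. ennreal K * indicator {0..<2 * pi} x \<partial>lborel) = ennreal (2 * pi * K)"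
          using K0 by (subst nn_integral_cmult_indicator) (auto simp: ennreal_mult'[symmetric] mult.commute)
        then show ?thesis by (subst nn_integral_add) (auto simp: nn_integral_cmult nn_integral_add)
      qed
      finally show ?thesis using True by simp
    qed auto
  qed
  also have "\<dots> = ennreal (2 * pi * K) + ennreal C * ((\<integral>\<^sup>+r\<in>UNIV. (\<integral>\<^sup>+x\<in>{0..<2 * pi}. ?V 2 (-2) r x \<partial>lborel) \<partial>lborel)
    + (\<integral>\<^sup>+r\<in>UNIV. (\<integral>\<^sup>+x\<in>{0..<2 * pi}. ?V (-2) 2 r x \<partial>lborel) \<partial>lborel))"
    by (subst nn_integral_add, measurable, subst nn_integral_cmult, measurable, subst nn_integral_add, measurable)
       (simp add: nn_integral_cmult)
  also have "\<dots> \<le> ennreal (2 * pi * K) + ennreal C * (I + I)"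
    by (intro add_left_mono mult_left_mono add_mono slice) auto
  also have "\<dots> < \<infinity>" using If by (simp add: ennreal_mult_less_top)
  finally show ?thesis .
qed

lemma disc_ext_Orlicz_Sobolev:
  assumes N: "N_function \<Phi>" and d: "doubling \<Phi>"
    and D: "(\<integral>\<^sup>+x\<in>{0..<2 * pi}. (\<integral>\<^sup>+s\<in>{-pi..<pi}. ennreal (\<Phi> (dilation x s)) \<partial>lborel) \<partial>lborel) < \<infinity>"
  shows "disc_ext \<in> Orlicz_Sobolev \<Phi> (ball 0 1)"
proof -
  define M where "M = 3 * exp (2 * pi)"
  have M: "0 \<le> M" by (simp add: M_def)
  \<comment> \<open>The cutoff removes the slit, where Ln jumps, and makes G Borel. The polar bound
    \<open>GM\<close> survives because \<open>spread\<close> is nonnegative.\<close>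
  define G where "G = (\<lambda>z. indicator (ball 0 1 - \<real>\<^sub>\<le>\<^sub>0) z *\<^sub>R (M * spread (Im (Ln z)) (- Re (Ln z))))"
  have slit: "ball 0 1 - \<real>\<^sub>\<le>\<^sub>0 \<in> sets (borel :: complex measure)" by (intro borel_open open_Diff) auto
  have neg: "Re (Ln z) < 0" if "z \<in> ball 0 1 - \<real>\<^sub>\<le>\<^sub>0" for z
    using that by (cases "z = 0") auto
  have Gm [measurable]: "G \<in> borel_measurable borel"
    unfolding G_def
  proof (rule borel_measurable_continuous_on_indicator[OF slit])
    show "continuous_on (ball 0 1 - \<real>\<^sub>\<le>\<^sub>0) (\<lambda>z. M * spread (Im (Ln z)) (- Re (Ln z)))"
      unfolding spread_def mean_dx_def using neg by (intro continuous_intros) force+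
  qed
  have G0: "0 \<le> G z" for z
    using neg[of z] M spread_nonneg[of "- Re (Ln z)" "Im (Ln z)"] by (auto simp: G_def split: split_indicator)
  have GM: "G (of_real r * cis x) \<le> M * spread x (- ln r)" if r: "0 < r" "r < 1" for r x
  proof (cases "of_real r * cis x \<in> ball 0 1 - \<real>\<^sub>\<le>\<^sub>0")
    case True
    define z where "z = of_real r * cis x"
    have z: "z \<noteq> 0" "cmod z = r" using r by (auto simp: z_def norm_mult)
    have "of_real r * cis (Im (Ln z)) = of_real r * cis x"
      using exp_Ln_polar[OF z(1)] z(2) by (metis z_def)
    then have "cis (Im (Ln z)) = cis x" using r by simp
    then obtain k :: int where "Im (Ln z) = x + 2 * pi * of_int k" unfolding cis_eq_cis_iff by blast
    then show ?thesis using z True by (simp add: G_def z_def[symmetric] spread_shift)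
  next
    case False
    then show ?thesis using r M spread_nonneg[of "- ln r" x] by (simp add: G_def)
  qed
  have fin: "(\<integral>\<^sup>+z\<in>ball 0 1. ennreal (\<Phi> (G z)) \<partial>lborel) < \<infinity>"
    by (rule disc_ext_gradient_modular[OF N d M D Gm G0 GM])
  \<comment> \<open>Setting the derivative to 0 on the real axis changes it on a null set only, and
    disposes of the slit and the origin together.\<close>
  define Df where "Df = (\<lambda>z. if z \<in> ball 0 1 \<and> Im z \<noteq> 0 then Blinfun (disc_ext_deriv z) else 0)"
  have off: "z \<notin> \<real>\<^sub>\<le>\<^sub>0" if "Im z \<noteq> 0" for z using that by (auto simp: complex_nonpos_Reals_iff)
  have Dapp: "blinfun_apply (Df z) v = (if z \<in> ball 0 1 \<and> Im z \<noteq> 0 then disc_ext_deriv z v else 0)" for z v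
    by (simp add: Df_def bounded_linear_Blinfun_apply[OF bounded_linear_disc_ext_deriv])
  have DG: "norm (Df z) \<le> G z" for z
  proof (cases "z \<in> ball 0 1 \<and> Im z \<noteq> 0")
    case True
    then have "z \<noteq> 0" "z \<in> ball 0 1 - \<real>\<^sub>\<le>\<^sub>0" using off by auto
    then show ?thesis
      using norm_disc_ext_deriv[of z] True G0[of z]
      by (intro norm_blinfun_bound) (auto simp: Dapp G_def M_def spread_def)
  next
    case False
    then have "Df z = 0" unfolding Df_def by (rule if_not_P)
    then show ?thesis using G0[of z] by simp
  qed
  have Gi: "integrable lborel (\<lambda>z. indicator (ball 0 1) z *\<^sub>R G z)"
    by (rule N_function_set_integrable[OF N Gm _ G0 emeasure_lborel_ball_finite fin]) simp
  have Di: "set_integrable lborel (ball 0 1) (\<lambda>z. blinfun_apply (Df z) v)" for v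
    unfolding set_integrable_def
  proof (rule Bochner_Integration.integrable_bound)
    show "integrable lborel (\<lambda>z. cmod v *\<^sub>R (indicator (ball 0 1) z *\<^sub>R G z))" using Gi by (rule integrable_scaleR_right)
    have S: "open (ball 0 1 \<inter> {z. Im z \<noteq> 0})" by (intro open_Int open_Collect_neq continuous_intros) auto
    have "(\<lambda>z. indicator (ball 0 1 \<inter> {z. Im z \<noteq> 0}) z *\<^sub>R disc_ext_deriv z v) \<in> borel_measurable borel"
      using S off by (intro borel_measurable_continuous_on_indicator continuous_on_subset[OF continuous_disc_ext_deriv]) auto
    also have "(\<lambda>z. indicator (ball 0 1 \<inter> {z. Im z \<noteq> 0}) z *\<^sub>R disc_ext_deriv z v) = (\<lambda>z. indicator (ball 0 1) z *\<^sub>R blinfun_apply (Df z) v)"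
      by (auto simp: fun_eq_iff Dapp indicator_def)
    finally show "(\<lambda>z. indicator (ball 0 1) z *\<^sub>R blinfun_apply (Df z) v) \<in> borel_measurable lborel" by simp
    show "AE z in lborel. norm (indicator (ball 0 1) z *\<^sub>R blinfun_apply (Df z) v) \<le> norm (cmod v *\<^sub>R (indicator (ball 0 1) z *\<^sub>R G z))"
    proof (rule AE_I2)
      fix z
      have "cmod (blinfun_apply (Df z) v) \<le> G z * cmod v"
        by (rule order_trans[OF norm_blinfun]) (intro mult_right_mono DG, simp)
      then show "norm (indicator (ball 0 1) z *\<^sub>R blinfun_apply (Df z) v) \<le> norm (cmod v *\<^sub>R (indicator (ball 0 1) z *\<^sub>R G z))"
        using G0[of z] by (auto simp: abs_mult mult.commute split: split_indicator)
    qed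
  qed
  have wd: "has_weak_derivative disc_ext Df (ball 0 1)"
  proof (rule has_weak_derivative_off_axis[OF continuous_disc_ext _ _ Di])
    fix z assume z: "z \<in> ball 0 1" "Im z \<noteq> 0"
    then have "blinfun_apply (Df z) = disc_ext_deriv z" by (auto simp: fun_eq_iff Dapp)
    then show "(disc_ext has_derivative blinfun_apply (Df z)) (at z)"
      using has_derivative_disc_ext[OF z(1) off[OF z(2)]] by simp
  qed auto
  have leb: "set_integrable lebesgue A f" if "set_integrable lborel A f" for A and f :: "complex \<Rightarrow> complex"
    using that by (simp add: set_integrable_def integrable_completion borel_measurable_integrable)
  have "set_integrable lborel (cball 0 1) disc_ext"
    unfolding set_integrable_def by (intro borel_integrable_compact continuous_disc_ext) auto
  then have "set_integrable lborel (ball 0 1) disc_ext" by (rule set_integrable_subset) auto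
  then have "disc_ext \<in> Sobolev_1_1 (ball 0 1)"
    unfolding Sobolev_1_1_def using wd Di leb by blast
  moreover have "(\<integral>\<^sup>+z\<in>ball 0 1. ennreal (\<Phi> (norm (Df z))) \<partial>lebesgue) < \<infinity>"
  proof -
    have "(\<integral>\<^sup>+z\<in>ball 0 1. ennreal (\<Phi> (norm (Df z))) \<partial>lebesgue) \<le> (\<integral>\<^sup>+z\<in>ball 0 1. ennreal (\<Phi> (G z)) \<partial>lebesgue)"
      by (intro nn_integral_mono mult_right_mono ennreal_leI N_function_mono[OF N] DG) auto
    also have "\<dots> = (\<integral>\<^sup>+z\<in>ball 0 1. ennreal (\<Phi> (G z)) \<partial>lborel)" by (rule nn_integral_completion)
    also note fin
    finally show ?thesis .
  qed
  ultimately show ?thesis unfolding Orlicz_Sobolev_def using wd by blast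
qed

end

section \<open>Existence of the extension and the equivalence\<close>

theorem Douglas_imp_Orlicz_Sobolev_extension:
  fixes \<phi> :: "complex \<Rightarrow> complex"
  assumes N: "N_function \<Phi>" and d: "doubling \<Phi>"
    and hom: "homeomorphism (sphere 0 1) (sphere 0 1) \<phi> \<phi>'" and D: "Douglas_condition \<Phi> \<phi>"
  shows "\<exists>h h'. homeomorphism (cball 0 1) (cball 0 1) h h' \<and> (\<forall>\<xi>\<in>sphere 0 1. h \<xi> = \<phi> \<xi>) \<and>
    h \<in> Orlicz_Sobolev \<Phi> (ball 0 1)"
proof -
  obtain \<theta> :: "real \<Rightarrow> real" and \<sigma> :: real where \<sigma>: "\<sigma> \<in> {1, -1}" and \<theta>: "continuous_on UNIV \<theta>" "strict_mono \<theta>"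
    "\<And>x. \<theta> (x + 2 * pi) = \<theta> x + 2 * pi" and lift: "\<And>x. \<phi> (cis x) = cis (\<sigma> * \<theta> x)"
    using circle_homeomorphism_lift[OF hom] by metis
  \<comment> \<open>A primitive of \<theta> on the whole line is needed, since the means reach
    arbitrarily far as y grows towards the origin of the disc.\<close>
  have "\<exists>\<Theta>. \<forall>x::real. - \<infinity> < ereal x \<longrightarrow> ereal x < \<infinity> \<longrightarrow> (\<Theta> has_vector_derivative \<theta> x) (at x)"
    using \<theta>(1) by (intro einterval_antiderivative) (auto simp: continuous_on_eq_continuous_at)
  then obtain \<Theta> where \<Theta>: "\<And>x. (\<Theta> has_field_derivative \<theta> x) (at x)"
    by (auto simp: has_real_derivative_iff_has_vector_derivative)
  interpret circle_lift \<theta> \<Theta> \<sigma>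
    by unfold_locales (fact \<theta> \<Theta> \<sigma>)+
  have \<phi>c: "continuous_on (sphere 0 1) \<phi>" using hom by (simp add: homeomorphism_def)
  have "(\<integral>\<^sup>+x\<in>{0..<2 * pi}. (\<integral>\<^sup>+s\<in>{-pi..<pi}. ennreal (\<Phi> (dilation x s)) \<partial>lborel) \<partial>lborel) < \<infinity>"
    using D unfolding Douglas_condition_iff[OF \<phi>c N_function_continuous[OF N]] quotient_modular_def lift dilation_def .
  then have "disc_ext \<in> Orlicz_Sobolev \<Phi> (ball 0 1)" by (rule disc_ext_Orlicz_Sobolev[OF N d])
  then show ?thesis using homeomorphism_disc_ext[OF hom lift] by blast
qed

theorem corollary1p4:
  fixes \<phi> :: "complex \<Rightarrow> complex" and \<Phi> :: "real \<Rightarrow> real" and p t0 :: real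
  assumes "\<exists>\<phi>'. homeomorphism (sphere 0 1) (sphere 0 1) \<phi> \<phi>'"
    and "N_function \<Phi>"
    and "doubling \<Phi>"
    and "p > 1" and "t0 \<ge> 0" and "aInc p t0 \<Phi>"
  shows "Douglas_condition \<Phi> \<phi> \<longleftrightarrow>
    (\<exists>h h'. homeomorphism (cball 0 1) (cball 0 1) h h' \<and>
            (\<forall>\<xi>\<in>sphere 0 1. h \<xi> = \<phi> \<xi>) \<and>
            h \<in> Orlicz_Sobolev \<Phi> (ball 0 1))"
proof
  obtain \<phi>' where hom: "homeomorphism (sphere 0 1) (sphere 0 1) \<phi> \<phi>'" using assms(1) by blast
  assume "Douglas_condition \<Phi> \<phi>"
  then show "\<exists>h h'. homeomorphism (cball 0 1) (cball 0 1) h h' \<and> (\<forall>\<xi>\<in>sphere 0 1. h \<xi> = \<phi> \<xi>) \<and>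
      h \<in> Orlicz_Sobolev \<Phi> (ball 0 1)"
    by (rule Douglas_imp_Orlicz_Sobolev_extension[OF assms(2,3) hom])
next
  assume "\<exists>h h'. homeomorphism (cball 0 1) (cball 0 1) h h' \<and> (\<forall>\<xi>\<in>sphere 0 1. h \<xi> = \<phi> \<xi>) \<and>
      h \<in> Orlicz_Sobolev \<Phi> (ball 0 1)"
  then obtain h h' where h: "homeomorphism (cball 0 1) (cball 0 1) h h'" "\<And>\<xi>. \<xi> \<in> sphere 0 1 \<Longrightarrow> h \<xi> = \<phi> \<xi>"
    "h \<in> Orlicz_Sobolev \<Phi> (ball 0 1)" by blast
  then have "continuous_on (cball 0 1) h" "h ` cball 0 1 \<subseteq> cball 0 1" by (simp_all add: homeomorphism_def)
  then show "Douglas_condition \<Phi> \<phi>"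
    by (rule Orlicz_Sobolev_imp_Douglas[OF assms(2-6) _ _ h(2,3)])
qed

end
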